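(* Let $T$ be the theory of an infinite-dimensional complex Hilbert space and let $\mathfrak{C}$ be the monster model of $T$. Then $T$ is inseparably categorical, but for every small set of parameters $A\subseteq\mathfrak{C}$ and every partial type $\Sigma$ over $A$ (in one variable), the set of realizations $\Sigma(\mathfrak{C})$ is not an infinite-dimensional (real) indiscernible subspace over $\varnothing$.
   Context: We work in continuous first-order logic. A complex Banach (in particular Hilbert) space $X$ is regarded as a metric structure whose universe is the closed unit ball $B(X)$, with metric $d(x,y)=\|x-y\|$, a predicate $\left\|\sum_i a_ix_i\right\|$ for each finite tuple $\bar a$ from $\mathbb{C}$ (evaluated in $X$), a constant $\mathbf{0}$, and functions $\sigma_{\bar a}(\bar x)$ equal to $\sum_i a_ix_i$ if this lies in $B(X)$ and to $\sum_i a_ix_i/\|\sum_i a_ix_i\|$ otherwise. The space $X$ and the structure are conflated; in particular, a subset of the universe is said to be a real subspace if it is the intersection of the unit ball with a (closed) real linear subspace of $X$. A countable theory (up to interdefinability of the language, as here, with a countable one) is inseparably categorical if it has, up to isomorphism, a unique model in each uncountable density character. The monster model is a sufficiently saturated and strongly homogeneous model; "small" means of cardinality less than its degree of saturation. Two $n$-tuples $\bar b,\bar c$ are congruent, $\bar b\cong\bar c$, if $\|b_i-b_j\|=\|c_i-c_j\|$ for all $i,j\le n$, where $b_n=c_n=\mathbf{0}$. A real subspace $V$ of a structure is an indiscernible subspace over $\varnothing$ if for every $n<\omega$ and all $n$-tuples $\bar b,\bar c$ from (the unit ball of) $V$, $\bar b\equiv\bar c$ (same type over $\varnothing$) if and only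 if $\bar b\cong\bar c$. *)

theory Defs
  imports "HOL-Analysis.Analysis"
begin

unbundle cardinal_syntax

section \<open>Continuous first-order logic\<close>

text \<open>
  Real-valued formulas with arbitrary continuous connectives, over bounded complete metric
  structures. A signature fixes arities, a bound for the metric, an interval
  \<open>[0, pbound P]\<close> for the values of each predicate \<open>P\<close>, and moduli of uniform continuity
  (with respect to the maximum metric on tuples).
\<close>

record ('f, 'p) signature =
  farity :: "'f \<Rightarrow> nat"
  fmodulus :: "'f \<Rightarrow> real \<Rightarrow> real"
  parity :: "'p \<Rightarrow> nat"
  pmodulus :: "'p \<Rightarrow> real \<Rightarrow> real"
  pbound :: "'p \<Rightarrow> real"
  dbound :: real

record ('f, 'p, 'm) mstruct =
  universe :: "'m set"
  mdst :: "'m \<Rightarrow> 'm \<Rightarrow> real"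
  fint :: "'f \<Rightarrow> 'm list \<Rightarrow> 'm"
  pint :: "'p \<Rightarrow> 'm list \<Rightarrow> real"

definition tuples :: "'m set \<Rightarrow> nat \<Rightarrow> 'm list set" where
  "tuples U n = {xs. length xs = n \<and> set xs \<subseteq> U}"

definition metric_structure :: "('f, 'p) signature \<Rightarrow> ('f, 'p, 'm) mstruct \<Rightarrow> bool" where
  "metric_structure L M \<longleftrightarrow>
     universe M \<noteq> {} \<and>
     Metric_space (universe M) (mdst M) \<and>
     Metric_space.mcomplete (universe M) (mdst M) \<and>
     (\<forall>x\<in>universe M. \<forall>y\<in>universe M. mdst M x y \<le> dbound L) \<and>
     (\<forall>F. \<forall>xs\<in>tuples (universe M) (farity L F). fint M F xs \<in> universe M) \<and>
     (\<forall>F. \<forall>\<epsilon>>0. \<forall>xs\<in>tuples (universe M) (farity L F). \<forall>ys\<in>tuples (universe M) (farity L F).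
        (\<forall>i<farity L F. mdst M (xs ! i) (ys ! i) < fmodulus L F \<epsilon>) \<longrightarrow>
        mdst M (fint M F xs) (fint M F ys) \<le> \<epsilon>) \<and>
     (\<forall>P. \<forall>xs\<in>tuples (universe M) (parity L P). pint M P xs \<in> {0..pbound L P}) \<and>
     (\<forall>P. \<forall>\<epsilon>>0. \<forall>xs\<in>tuples (universe M) (parity L P). \<forall>ys\<in>tuples (universe M) (parity L P).
        (\<forall>i<parity L P. mdst M (xs ! i) (ys ! i) < pmodulus L P \<epsilon>) \<longrightarrow>
        \<bar>pint M P xs - pint M P ys\<bar> \<le> \<epsilon>)"

datatype 'f tm = Var nat | App 'f "'f tm list"

text \<open>
  An \<open>n\<close>-ary connective \<open>Conn u [\<phi>\<^sub>0, \<dots>, \<phi>\<^sub>n\<^sub>-\<^sub>1]\<close> is given by a function \<open>u\<close> on sequences, of which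
  only the values at sequences vanishing from \<open>n\<close> on matter. Continuity for the product topology
  on \<open>nat \<Rightarrow> real\<close> yields precisely the continuous functions on the space of \<open>n\<close>-tuples.
\<close>

datatype ('f, 'p) fm =
    Dist "'f tm" "'f tm"
  | Pred 'p "'f tm list"
  | Conn "(nat \<Rightarrow> real) \<Rightarrow> real" "('f, 'p) fm list"
  | QSup nat "('f, 'p) fm"
  | QInf nat "('f, 'p) fm"

fun wf_tm :: "('f, 'p) signature \<Rightarrow> 'f tm \<Rightarrow> bool" where
  "wf_tm L (Var i) = True"
| "wf_tm L (App F ts) = (length ts = farity L F \<and> (\<forall>t\<in>set ts. wf_tm L t))"

fun wf_fm :: "('f, 'p) signature \<Rightarrow> ('f, 'p) fm \<Rightarrow> bool" where
  "wf_fm L (Dist t t') = (wf_tm L t \<and> wf_tm L t')"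
| "wf_fm L (Pred P ts) = (length ts = parity L P \<and> (\<forall>t\<in>set ts. wf_tm L t))"
| "wf_fm L (Conn u \<phi>s) = (continuous_on UNIV u \<and> (\<forall>\<phi>\<in>set \<phi>s. wf_fm L \<phi>))"
| "wf_fm L (QSup i \<phi>) = wf_fm L \<phi>"
| "wf_fm L (QInf i \<phi>) = wf_fm L \<phi>"

fun fv_tm :: "'f tm \<Rightarrow> nat set" where
  "fv_tm (Var i) = {i}"
| "fv_tm (App F ts) = (\<Union>t\<in>set ts. fv_tm t)"

fun fv :: "('f, 'p) fm \<Rightarrow> nat set" where
  "fv (Dist t t') = fv_tm t \<union> fv_tm t'"
| "fv (Pred P ts) = (\<Union>t\<in>set ts. fv_tm t)"
| "fv (Conn u \<phi>s) = (\<Union>\<phi>\<in>set \<phi>s. fv \<phi>)"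
| "fv (QSup i \<phi>) = fv \<phi> - {i}"
| "fv (QInf i \<phi>) = fv \<phi> - {i}"

fun eval_tm :: "('f, 'p, 'm) mstruct \<Rightarrow> 'f tm \<Rightarrow> (nat \<Rightarrow> 'm) \<Rightarrow> 'm" where
  "eval_tm M (Var i) s = s i"
| "eval_tm M (App F ts) s = fint M F (map (\<lambda>t. eval_tm M t s) ts)"

fun eval :: "('f, 'p, 'm) mstruct \<Rightarrow> ('f, 'p) fm \<Rightarrow> (nat \<Rightarrow> 'm) \<Rightarrow> real" where
  "eval M (Dist t t') s = mdst M (eval_tm M t s) (eval_tm M t' s)"
| "eval M (Pred P ts) s = pint M P (map (\<lambda>t. eval_tm M t s) ts)"
| "eval M (Conn u \<phi>s) s = u (nth_default 0 (map (\<lambda>\<phi>. eval M \<phi> s) \<phi>s))"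
| "eval M (QSup i \<phi>) s = (SUP x\<in>universe M. eval M \<phi> (s(i := x)))"
| "eval M (QInf i \<phi>) s = (INF x\<in>universe M. eval M \<phi> (s(i := x)))"

text \<open>
  A theory is a set of sentences \<open>\<phi>\<close>, each standing for the condition \<open>\<phi> = 0\<close>. Conditions
  \<open>\<phi> \<le> r\<close> and \<open>\<phi> \<ge> r\<close> are of this form, by means of connectives.
\<close>

definition theory_of ::
  "('f, 'p) signature \<Rightarrow> ('f, 'p, 'm) mstruct \<Rightarrow> ('f, 'p) fm set" where
  "theory_of L M = {\<phi>. wf_fm L \<phi> \<and> fv \<phi> = {} \<and> (\<forall>s. eval M \<phi> s = 0)}"

definition model_of ::
  "('f, 'p) signature \<Rightarrow> ('f, 'p) fm set \<Rightarrow> ('f, 'p, 'm) mstruct \<Rightarrow> bool" where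
  "model_of L T M \<longleftrightarrow> metric_structure L M \<and> (\<forall>\<phi>\<in>T. \<forall>s. eval M \<phi> s = 0)"

definition isomorphism ::
  "('f, 'p) signature \<Rightarrow> ('f, 'p, 'm) mstruct \<Rightarrow> ('f, 'p, 'n) mstruct \<Rightarrow> ('m \<Rightarrow> 'n) \<Rightarrow> bool" where
  "isomorphism L M N h \<longleftrightarrow>
     bij_betw h (universe M) (universe N) \<and>
     (\<forall>x\<in>universe M. \<forall>y\<in>universe M. mdst N (h x) (h y) = mdst M x y) \<and>
     (\<forall>F. \<forall>xs\<in>tuples (universe M) (farity L F). fint N F (map h xs) = h (fint M F xs)) \<and>
     (\<forall>P. \<forall>xs\<in>tuples (universe M) (parity L P). pint N P (map h xs) = pint M P xs)"

definition dense_in :: "('f, 'p, 'm) mstruct \<Rightarrow> 'm set \<Rightarrow> bool" where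
  "dense_in M D \<longleftrightarrow> D \<subseteq> universe M \<and>
     Metric_space.mtopology (universe M) (mdst M) closure_of D = universe M"

definition has_density_character :: "('f, 'p, 'm) mstruct \<Rightarrow> 'k rel \<Rightarrow> bool" where
  "has_density_character M \<kappa> \<longleftrightarrow>
     (\<exists>D. dense_in M D \<and> |D| =o \<kappa>) \<and> (\<forall>D. dense_in M D \<longrightarrow> \<kappa> \<le>o |D| )"

text \<open>
  The type arguments stand for quantifiers over types: \<open>'k\<close> carries the cardinals \<open>\<kappa>\<close>, and
  \<open>'m\<close>, \<open>'n\<close> carry the two models compared. The type \<open>nat \<Rightarrow> 'k\<close> is no restriction on the model
  whose existence is claimed: a metric space of density character \<open>\<kappa>\<close> has at most
  \<open>\<kappa>\<close> to the power \<open>\<aleph>\<^sub>0\<close> points.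
\<close>

definition inseparably_categorical ::
  "'k itself \<Rightarrow> 'm itself \<Rightarrow> 'n itself \<Rightarrow> ('f, 'p) signature \<Rightarrow> ('f, 'p) fm set \<Rightarrow> bool" where
  "inseparably_categorical _ _ _ L T \<longleftrightarrow>
     (\<forall>\<kappa> :: 'k rel. Card_order \<kappa> \<and> natLeq <o \<kappa> \<longrightarrow>
        (\<exists>M :: ('f, 'p, nat \<Rightarrow> 'k) mstruct. model_of L T M \<and> has_density_character M \<kappa>) \<and>
        (\<forall>(M :: ('f, 'p, 'm) mstruct) (N :: ('f, 'p, 'n) mstruct).
           model_of L T M \<and> has_density_character M \<kappa> \<and>
           model_of L T N \<and> has_density_character N \<kappa> \<longrightarrow>
           (\<exists>h. isomorphism L M N h)))"

definition same_type ::
  "('f, 'p) signature \<Rightarrow> ('f, 'p, 'm) mstruct \<Rightarrow> 'm list \<Rightarrow> 'm list \<Rightarrow> bool" where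
  "same_type L M bs cs \<longleftrightarrow> length bs = length cs \<and>
     (\<forall>\<phi>. wf_fm L \<phi> \<and> fv \<phi> \<subseteq> {..<length bs} \<longrightarrow> eval M \<phi> (nth bs) = eval M \<phi> (nth cs))"

text \<open>
  A condition with parameters is a pair \<open>(\<phi>, s)\<close>: the variables below \<open>n\<close> are the variables of
  the partial type, and a free variable \<open>i \<ge> n\<close> is a name for the parameter \<open>s i\<close>.
\<close>

definition satisfies_upto ::
  "('f, 'p, 'm) mstruct \<Rightarrow> real \<Rightarrow> (('f, 'p) fm \<times> (nat \<Rightarrow> 'm)) set \<Rightarrow> 'm list \<Rightarrow> bool" where
  "satisfies_upto M \<epsilon> \<Sigma> xs \<longleftrightarrow>
     (\<forall>(\<phi>, s)\<in>\<Sigma>. \<bar>eval M \<phi> (\<lambda>i. if i < length xs then xs ! i else s i)\<bar> \<le> \<epsilon>)"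

definition partial_type ::
  "('f, 'p) signature \<Rightarrow> ('f, 'p, 'm) mstruct \<Rightarrow> 'm set \<Rightarrow> nat \<Rightarrow>
   (('f, 'p) fm \<times> (nat \<Rightarrow> 'm)) set \<Rightarrow> bool" where
  "partial_type L M A n \<Sigma> \<longleftrightarrow>
     (\<forall>(\<phi>, s)\<in>\<Sigma>. wf_fm L \<phi> \<and> (\<forall>i\<in>fv \<phi>. n \<le> i \<longrightarrow> s i \<in> A)) \<and>
     (\<forall>\<Sigma>0 \<epsilon>. finite \<Sigma>0 \<and> \<Sigma>0 \<subseteq> \<Sigma> \<and> 0 < \<epsilon> \<longrightarrow>
        (\<exists>xs\<in>tuples (universe M) n. satisfies_upto M \<epsilon> \<Sigma>0 xs))"

definition realizations ::
  "('f, 'p, 'm) mstruct \<Rightarrow> nat \<Rightarrow> (('f, 'p) fm \<times> (nat \<Rightarrow> 'm)) set \<Rightarrow> 'm list set" where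
  "realizations M n \<Sigma> = {xs \<in> tuples (universe M) n. satisfies_upto M 0 \<Sigma> xs}"

definition solution_set ::
  "('f, 'p, 'm) mstruct \<Rightarrow> (('f, 'p) fm \<times> (nat \<Rightarrow> 'm)) set \<Rightarrow> 'm set" where
  "solution_set M \<Sigma> = {x. [x] \<in> realizations M 1 \<Sigma>}"

definition saturated ::
  "('f, 'p) signature \<Rightarrow> 'k rel \<Rightarrow> ('f, 'p, 'm) mstruct \<Rightarrow> bool" where
  "saturated L \<kappa> M \<longleftrightarrow>
     (\<forall>A n \<Sigma>. A \<subseteq> universe M \<and> |A| <o \<kappa> \<and> partial_type L M A n \<Sigma> \<longrightarrow>
        realizations M n \<Sigma> \<noteq> {})"

definition elementary_on ::
  "('f, 'p) signature \<Rightarrow> ('f, 'p, 'm) mstruct \<Rightarrow> 'm set \<Rightarrow> ('m \<Rightarrow> 'm) \<Rightarrow> bool" where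
  "elementary_on L M A f \<longleftrightarrow> f ` A \<subseteq> universe M \<and>
     (\<forall>\<phi> s. wf_fm L \<phi> \<and> s ` fv \<phi> \<subseteq> A \<longrightarrow> eval M \<phi> (f \<circ> s) = eval M \<phi> s)"

definition strongly_homogeneous ::
  "('f, 'p) signature \<Rightarrow> 'k rel \<Rightarrow> ('f, 'p, 'm) mstruct \<Rightarrow> bool" where
  "strongly_homogeneous L \<kappa> M \<longleftrightarrow>
     (\<forall>A f. A \<subseteq> universe M \<and> |A| <o \<kappa> \<and> elementary_on L M A f \<longrightarrow>
        (\<exists>h. isomorphism L M M h \<and> (\<forall>a\<in>A. h a = f a)))"

text \<open>
  Here \<open>\<kappa>\<close> is the degree of saturation; a set is small if its cardinality is less than \<open>\<kappa>\<close>.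
  Any uncountable \<open>\<kappa>\<close> is accepted as sufficiently large.
\<close>

definition monster_model ::
  "('f, 'p) signature \<Rightarrow> ('f, 'p) fm set \<Rightarrow> 'k rel \<Rightarrow> ('f, 'p, 'm) mstruct \<Rightarrow> bool" where
  "monster_model L T \<kappa> M \<longleftrightarrow> Card_order \<kappa> \<and> natLeq <o \<kappa> \<and>
     model_of L T M \<and> saturated L \<kappa> M \<and> strongly_homogeneous L \<kappa> M"


section \<open>Complex Banach and Hilbert spaces\<close>

class complex_banach = banach +
  fixes scaleC :: "complex \<Rightarrow> 'a \<Rightarrow> 'a"  (infixr \<open>*\<^sub>C\<close> 75)
  assumes scaleC_add_right: "a *\<^sub>C (x + y) = a *\<^sub>C x + a *\<^sub>C y"
    and scaleC_add_left: "(a + b) *\<^sub>C x = a *\<^sub>C x + b *\<^sub>C x"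
    and scaleC_scaleC: "a *\<^sub>C (b *\<^sub>C x) = (a * b) *\<^sub>C x"
    and scaleC_of_real: "complex_of_real r *\<^sub>C x = r *\<^sub>R x"
    and norm_scaleC: "norm (a *\<^sub>C x) = cmod a * norm x"

class complex_hilbert = complex_banach +
  fixes cinner :: "'a \<Rightarrow> 'a \<Rightarrow> complex"
  assumes cinner_commute: "cinner x y = cnj (cinner y x)"
    and cinner_add_left: "cinner (x + y) z = cinner x z + cinner y z"
    and cinner_scaleC_left: "cinner (a *\<^sub>C x) y = a * cinner x y"
    and cinner_self: "cinner x x = complex_of_real ((norm x)\<^sup>2)"

definition infinite_dimensional_space :: "'a::complex_banach itself \<Rightarrow> bool" where
  "infinite_dimensional_space _ \<longleftrightarrow>
     \<not> (\<exists>B :: 'a set. finite B \<and> module.span scaleC B = UNIV)"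


section \<open>The unit ball as a metric structure\<close>

datatype ball_fun = Zero | Sigma "complex list"
datatype ball_pred = NormComb "complex list"

definition lincomb :: "complex list \<Rightarrow> 'a::complex_banach list \<Rightarrow> 'a" where
  "lincomb a xs = sum_list (map2 scaleC a xs)"

definition ball_retract :: "'a::complex_banach \<Rightarrow> 'a" where
  "ball_retract v = (if norm v \<le> 1 then v else v /\<^sub>R norm v)"

primrec ball_fun_arity :: "ball_fun \<Rightarrow> nat" where
  "ball_fun_arity Zero = 0"
| "ball_fun_arity (Sigma a) = length a"

primrec ball_fun_modulus :: "ball_fun \<Rightarrow> real \<Rightarrow> real" where
  "ball_fun_modulus Zero \<epsilon> = \<epsilon>"
| "ball_fun_modulus (Sigma a) \<epsilon> = \<epsilon> / (1 + 2 * (\<Sum>c\<leftarrow>a. cmod c))"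

primrec ball_pred_arity :: "ball_pred \<Rightarrow> nat" where
  "ball_pred_arity (NormComb a) = length a"

primrec ball_pred_modulus :: "ball_pred \<Rightarrow> real \<Rightarrow> real" where
  "ball_pred_modulus (NormComb a) \<epsilon> = \<epsilon> / (1 + (\<Sum>c\<leftarrow>a. cmod c))"

primrec ball_pred_bound :: "ball_pred \<Rightarrow> real" where
  "ball_pred_bound (NormComb a) = (\<Sum>c\<leftarrow>a. cmod c)"

text \<open>The factor 2 in the modulus of \<open>Sigma a\<close> is the Lipschitz constant of the radial retraction.\<close>

definition banach_signature :: "(ball_fun, ball_pred) signature" where
  "banach_signature =
     \<lparr>farity = ball_fun_arity, fmodulus = ball_fun_modulus,
      parity = ball_pred_arity, pmodulus = ball_pred_modulus,
      pbound = ball_pred_bound, dbound = 2\<rparr>"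

primrec ball_fint :: "ball_fun \<Rightarrow> 'a::complex_banach list \<Rightarrow> 'a" where
  "ball_fint Zero xs = 0"
| "ball_fint (Sigma a) xs = ball_retract (lincomb a xs)"

primrec ball_pint :: "ball_pred \<Rightarrow> 'a::complex_banach list \<Rightarrow> real" where
  "ball_pint (NormComb a) xs = norm (lincomb a xs)"

definition unit_ball :: "'a::complex_banach itself \<Rightarrow> (ball_fun, ball_pred, 'a) mstruct" where
  "unit_ball _ =
     \<lparr>universe = cball 0 1, mdst = dist, fint = ball_fint, pint = ball_pint\<rparr>"


section \<open>Indiscernible subspaces\<close>

definition congruent_tuples :: "'a::complex_banach list \<Rightarrow> 'a list \<Rightarrow> bool" where
  "congruent_tuples bs cs \<longleftrightarrow> length bs = length cs \<and>
     (\<forall>i\<le>length bs. \<forall>j\<le>length bs.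
        norm ((bs @ [0]) ! i - (bs @ [0]) ! j) = norm ((cs @ [0]) ! i - (cs @ [0]) ! j))"

definition real_subspace :: "'a::complex_banach set \<Rightarrow> bool" where
  "real_subspace V \<longleftrightarrow> (\<exists>W. subspace W \<and> closed W \<and> V = cball 0 1 \<inter> W)"

definition indiscernible_subspace :: "'a::complex_banach set \<Rightarrow> bool" where
  "indiscernible_subspace V \<longleftrightarrow> real_subspace V \<and>
     (\<forall>n. \<forall>bs\<in>tuples V n. \<forall>cs\<in>tuples V n.
        same_type banach_signature (unit_ball TYPE('a)) bs cs \<longleftrightarrow> congruent_tuples bs cs)"

definition infinite_dimensional_subset :: "'a::complex_banach set \<Rightarrow> bool" where
  "infinite_dimensional_subset V \<longleftrightarrow> \<not> (\<exists>B. finite B \<and> V \<subseteq> span B)"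

end

theory Submission
  imports Defs
begin

text \<open>
  Polarization expresses the inner product by the norm predicates, and the universal sentences
  saying that it is one belong to \<open>T\<close>; so every model of \<open>T\<close> is the unit ball of a Hilbert space.
  An orthonormal basis then determines a model up to isomorphism, and its cardinality is the
  density character whenever one of them is uncountable. In infinite dimension a tuple can be
  extended by a point in such a way that any Gram matrix realized elsewhere is reached, hence by
  back-and-forth the Gram matrix of a tuple determines its type.

  Suppose now that \<open>\<Sigma>\<close>, over a small set \<open>A\<close>, defines an infinite-dimensional indiscernible
  subspace \<open>V\<close>. Finitely many points impose finitely many linear conditions, so \<open>V\<close> contains unit
  vectors orthogonal to any given finite subset of \<open>A\<close>, and by saturation a unit vector \<open>b\<close>
  orthogonal to \<open>A\<close>. As \<open>\<i>b\<close> has the same Gram matrix with \<open>A\<close>, it has the same type over \<open>A\<close> and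
  lies in \<open>V\<close>. But the pairs \<open>(b, \<i>b)\<close> and \<open>(\<i>b, b)\<close> are congruent, whereas the predicate
  \<open>\<parallel>x + \<i>y\<parallel>\<close> distinguishes them.
\<close>

section \<open>Formal linear combinations\<close>

text \<open>Everything is phrased through a Gram function \<open>G\<close> on a structure: a model
  of \<open>T\<close> is a mere ball, whose only linear operations are the truncated
  \<open>Sigma\<close>. The locale \<open>gram_ball\<close> covers three sources of
  \<open>G\<close>: \<open>cinner\<close> on the given Hilbert space, \<open>ip\<close> on coded
  square summable families, and \<open>polar\<close>, defined from the predicates of an arbitrary
  model. Its identities must be expressible by formulas in the norm predicates, which is why the
  axiom for \<open>Sigma\<close> is multiplied out instead of containing a quotient. Two obstacles
  shape the rest. A model of each uncountable density character has to be found on the type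
  \<open>nat \<Rightarrow> 'k\<close>, so the points of an l2 ball are coded by sequences;
  countability of supports makes this possible. And the space carrying the monster model is only a
  Banach space, with a subspace that is only real linear: complex orthogonality to a parameter
  becomes two real linear conditions, built from the norm alone. The subspace is not assumed to be
  closed under \<i>; it is orthogonality to all parameters that makes the type over \<open>A\<close>
  forget the phase of a vector.\<close>

definition gform :: "('m \<Rightarrow> 'm \<Rightarrow> complex) \<Rightarrow> (complex \<times> 'm) list \<Rightarrow> (complex \<times> 'm) list \<Rightarrow> complex" where
  "gform G u v = (\<Sum>(a, x)\<leftarrow>u. \<Sum>(b, y)\<leftarrow>v. a * cnj b * G x y)"

definition vscale :: "complex \<Rightarrow> (complex \<times> 'm) list \<Rightarrow> (complex \<times> 'm) list" where
  "vscale c u = map (\<lambda>(a, x). (c * a, x)) u"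

text \<open>A sum is a concatenation, and lists are not normalized: two lists count as the same
  vector when \<open>gform\<close> cannot separate them.\<close>

definition vdiff :: "(complex \<times> 'm) list \<Rightarrow> (complex \<times> 'm) list \<Rightarrow> (complex \<times> 'm) list" where
  "vdiff u v = u @ vscale (-1) v"

lemma gform_Nil_left [simp]: "gform G [] v = 0"
  by (simp add: gform_def)

lemma gform_Nil_right [simp]: "gform G u [] = 0"
  by (induction u) (auto simp: gform_def)

lemma gform_append_left [simp]: "gform G (u @ u') v = gform G u v + gform G u' v"
  by (simp add: gform_def)

lemma gform_append_right [simp]: "gform G u (v @ v') = gform G u v + gform G u v'"
  by (induction u) (auto simp: gform_def)

lemma gform_scale_left [simp]: "gform G (vscale c u) v = c * gform G u v"
proof (induction u)
  case (Cons p u)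
  obtain a x where p: "p = (a, x)" by force
  have "(\<Sum>(b, y)\<leftarrow>v. c * a * cnj b * G x y) = c * (\<Sum>(b, y)\<leftarrow>v. a * cnj b * G x y)"
    by (induction v) (auto simp: algebra_simps)
  with Cons show ?case
    by (simp add: gform_def vscale_def p algebra_simps)
qed (simp add: vscale_def)

lemma gform_scale_right [simp]: "gform G u (vscale c v) = cnj c * gform G u v"
proof (induction v)
  case (Cons p v)
  have "gform G u (vscale c [p]) = cnj c * gform G u [p]"
    by (induction u) (auto simp: gform_def vscale_def algebra_simps split: prod.splits)
  then show ?case
    using Cons gform_append_right[of G u "[p]" v]
      gform_append_right[of G u "vscale c [p]" "vscale c v"]
    by (simp add: vscale_def algebra_simps)
qed (simp add: vscale_def)

lemma gform_single [simp]: "gform G [(a, x)] [(b, y)] = a * cnj b * G x y"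
  by (simp add: gform_def)

lemma gform_diff_left [simp]: "gform G (vdiff u v) w = gform G u w - gform G v w"
  by (simp add: vdiff_def)

lemma gform_diff_right [simp]: "gform G w (vdiff u v) = gform G w u - gform G w v"
  by (simp add: vdiff_def)

lemma gform_left_sum: "gform G u v = (\<Sum>(a, x)\<leftarrow>u. a * gform G [(1, x)] v)"
proof (induction u)
  case (Cons p u)
  obtain a x where p: "p = (a, x)" by force
  have "gform G [(a, x)] v = a * gform G [(1, x)] v"
    using gform_scale_left[of G a "[(1, x)]" v] by (simp add: vscale_def)
  then show ?case
    using Cons gform_append_left[of G "[p]" u v] by (simp add: p)
qed simp

lemma gform_right_sum: "gform G u v = (\<Sum>(b, y)\<leftarrow>v. cnj b * gform G u [(1, y)])"
proof (induction v)
  case (Cons p v)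
  obtain a x where p: "p = (a, x)" by force
  have "gform G u [(a, x)] = cnj a * gform G u [(1, x)]"
    using gform_scale_right[of G u a "[(1, x)]"] by (simp add: vscale_def)
  then show ?case
    using Cons gform_append_right[of G u "[p]" v] by (simp add: p)
qed simp

text \<open>
  A list \<open>[(a\<^sub>1, x\<^sub>1), \<dots>]\<close> is a formal linear combination of points of the structure, and \<open>gform G\<close>
  is the semi-inner product on formal combinations induced by \<open>G\<close>. Thus linear algebra is possible
  although the universe is only a ball, and although an abstract model has no ambient space.
\<close>

locale gram_ball =
  fixes M :: "(ball_fun, ball_pred, 'm) mstruct" and G :: "'m \<Rightarrow> 'm \<Rightarrow> complex"
  assumes herm: "\<lbrakk>x \<in> universe M; y \<in> universe M\<rbrakk> \<Longrightarrow> G y x = cnj (G x y)"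
    and gform_pos: "u \<in> lists (UNIV \<times> universe M) \<Longrightarrow> 0 \<le> Re (gform G u u)"
    and pint_eq: "\<lbrakk>length a = length xs; set xs \<subseteq> universe M\<rbrakk> \<Longrightarrow>
      pint M (NormComb a) xs = sqrt (Re (gform G (zip a xs) (zip a xs)))"
    and mdst_eq: "\<lbrakk>x \<in> universe M; y \<in> universe M\<rbrakk> \<Longrightarrow>
      mdst M x y = pint M (NormComb [1, -1]) [x, y]"
    and mdst_nonneg: "0 \<le> mdst M x y"
    and mdst_commute: "mdst M x y = mdst M y x"
    and mdst_zero: "\<lbrakk>x \<in> universe M; y \<in> universe M; mdst M x y = 0\<rbrakk> \<Longrightarrow> x = y"
    and norm_le_1: "x \<in> universe M \<Longrightarrow> Re (G x x) \<le> 1"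
    and zero_in: "fint M Zero [] \<in> universe M"
    and G_zero: "y \<in> universe M \<Longrightarrow> G (fint M Zero []) y = 0"
    and sigma_in: "\<lbrakk>length a = length xs; set xs \<subseteq> universe M\<rbrakk> \<Longrightarrow> fint M (Sigma a) xs \<in> universe M"
    and G_sigma: "\<lbrakk>length a = length xs; set xs \<subseteq> universe M; y \<in> universe M\<rbrakk> \<Longrightarrow>
      G (fint M (Sigma a) xs) y * max 1 (pint M (NormComb a) xs) = gform G (zip a xs) [(1, y)]"
begin

abbreviation "U \<equiv> universe M"
abbreviation "vecs \<equiv> lists (UNIV \<times> U)"
abbreviation "B \<equiv> gform G"

definition vnorm :: "(complex \<times> 'm) list \<Rightarrow> real" where
  "vnorm u = sqrt (Re (B u u))"

lemma zip_vecs [simp]: "set xs \<subseteq> U \<Longrightarrow> zip a xs \<in> vecs"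
  by (auto dest: set_zip_rightD)

lemma vscale_vecs [simp]: "u \<in> vecs \<Longrightarrow> vscale c u \<in> vecs"
  by (auto simp: vscale_def)

lemma vdiff_vecs [simp]: "\<lbrakk>u \<in> vecs; v \<in> vecs\<rbrakk> \<Longrightarrow> vdiff u v \<in> vecs"
  by (simp add: vdiff_def)

lemma gform_herm:
  assumes "u \<in> vecs" "v \<in> vecs" shows "B v u = cnj (B u v)"
proof -
  have *: "B v [(1, x)] = cnj (B [(1, x)] v)" if "x \<in> U" for x
    using \<open>v \<in> vecs\<close>
  proof (induction v)
    case (Cons p v)
    obtain b y where p: "p = (b, y)" by force
    with Cons have "y \<in> U" by auto
    with Cons herm[OF that \<open>y \<in> U\<close>] show ?case
      using gform_append_left[of G "[p]" v] gform_append_right[of G _ "[p]" v] by (simp add: p)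
  qed simp
  show ?thesis using \<open>u \<in> vecs\<close>
  proof (induction u)
    case (Cons p u)
    obtain a x where p: "p = (a, x)" by force
    with Cons have "x \<in> U" by auto
    have "B v [p] = cnj (B [p] v)"
      using *[OF \<open>x \<in> U\<close>] gform_left_sum[of G "[p]"] gform_right_sum[of G v "[p]"] by (simp add: p)
    with Cons show ?case
      using gform_append_left[of G "[p]" u] gform_append_right[of G _ "[p]" u] by simp
  qed simp
qed

lemma Im_gform_self: "u \<in> vecs \<Longrightarrow> Im (B u u) = 0"
  using gform_herm[of u u] by (simp add: complex_eq_iff)

lemma gform_self: "u \<in> vecs \<Longrightarrow> B u u = of_real ((vnorm u)\<^sup>2)"
  using Im_gform_self[of u] gform_pos[of u] by (simp add: vnorm_def complex_eq_iff)

lemma vnorm_nonneg [simp]: "u \<in> vecs \<Longrightarrow> 0 \<le> vnorm u"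
  using gform_pos by (simp add: vnorm_def)

lemma vnorm_scale [simp]: "vnorm (vscale c u) = cmod c * vnorm u"
proof -
  have "Re (c * (cnj c * B u u)) = Re (of_real ((cmod c)\<^sup>2) * B u u)"
    by (simp only: mult.assoc[symmetric] complex_norm_square)
  then have "Re (c * (cnj c * B u u)) = (cmod c)\<^sup>2 * Re (B u u)"
    by (simp only: Re_complex_of_real Im_complex_of_real times_complex.simps mult_zero_left diff_zero)
  moreover have "B (vscale c u) (vscale c u) = c * (cnj c * B u u)"
    by simp
  ultimately show ?thesis
    unfolding vnorm_def by (metis norm_ge_zero real_sqrt_mult real_sqrt_unique)
qed

text \<open>The discriminant argument for a form that is only semi-definite: null vectors are
  allowed, so \<open>vnorm v = 0\<close> is a case of its own.\<close>

lemma cauchy_schwarz: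
  assumes u: "u \<in> vecs" and v: "v \<in> vecs"
  shows "cmod (B u v) \<le> vnorm u * vnorm v"
proof -
  define b where "b = B u v"
  have b': "B v u = cnj b" using gform_herm[OF u v] by (simp add: b_def)
  have key: "0 \<le> (vnorm u)\<^sup>2 - 2 * t * (cmod b)\<^sup>2 + t\<^sup>2 * (cmod b)\<^sup>2 * (vnorm v)\<^sup>2" for t
  proof -
    \<comment> \<open>The factor \<open>b\<close> turns both cross terms into
      \<open>t * (cmod b)\<^sup>2\<close>, so that a real parameter suffices.\<close>
    define w where "w = vdiff u (vscale (of_real t * b) v)"
    have w: "w \<in> vecs" using u v by (simp add: w_def)
    have bb: "b * cnj b = of_real ((cmod b)\<^sup>2)" by (simp only: complex_norm_square)
    have "B w w = B u u - of_real t * (b * cnj b) - of_real t * (b * cnj b)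
         + of_real t * of_real t * (b * cnj b) * B v v"
      by (simp add: w_def b' b_def[symmetric] algebra_simps)
    also have "\<dots> = of_real ((vnorm u)\<^sup>2 - 2 * t * (cmod b)\<^sup>2 + t\<^sup>2 * (cmod b)\<^sup>2 * (vnorm v)\<^sup>2)"
      unfolding bb gform_self[OF u] gform_self[OF v] by (simp add: power2_eq_square)
    finally show ?thesis using gform_pos[OF w] by (simp only: Re_complex_of_real)
  qed
  show ?thesis
  proof (cases "vnorm v = 0")
    case True
    have "cmod b = 0"
    proof (rule ccontr)
      assume nz: "cmod b \<noteq> 0"
      \<comment> \<open>With \<open>vnorm v = 0\<close> the expression in \<open>key\<close> is
        affine in \<open>t\<close>; at this value it equals -1.\<close>
      define t where "t = ((vnorm u)\<^sup>2 + 1) / (2 * (cmod b)\<^sup>2)"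
      have "2 * t * (cmod b)\<^sup>2 = (vnorm u)\<^sup>2 + 1" using nz by (simp add: t_def)
      then show False using key[of t] True by simp
    qed
    then show ?thesis using True by (simp add: b_def)
  next
    case False
    define t where "t = 1 / (vnorm v)\<^sup>2"
    have "t\<^sup>2 * (cmod b)\<^sup>2 * (vnorm v)\<^sup>2 = t * (cmod b)\<^sup>2"
      using False by (simp add: t_def power2_eq_square)
    then have "t * (cmod b)\<^sup>2 \<le> (vnorm u)\<^sup>2" using key[of t] by linarith
    then have "(cmod b)\<^sup>2 \<le> (vnorm u * vnorm v)\<^sup>2"
      using False by (simp add: t_def field_simps)
    then show ?thesis
      unfolding b_def[symmetric] using u v power2_le_imp_le by (metis mult_nonneg_nonneg vnorm_nonneg)
  qed
qed

lemma vnorm_append_le: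
  assumes u: "u \<in> vecs" and v: "v \<in> vecs"
  shows "vnorm (u @ v) \<le> vnorm u + vnorm v"
proof -
  have "Re (B (u @ v) (u @ v)) = (vnorm u)\<^sup>2 + (vnorm v)\<^sup>2 + 2 * Re (B u v)"
    using gform_herm[OF u v] gform_self[OF u] gform_self[OF v] by simp
  also have "\<dots> \<le> (vnorm u)\<^sup>2 + (vnorm v)\<^sup>2 + 2 * (vnorm u * vnorm v)"
    using cauchy_schwarz[OF u v] complex_Re_le_cmod[of "B u v"] by linarith
  also have "\<dots> = (vnorm u + vnorm v)\<^sup>2" by (simp add: power2_sum)
  finally show ?thesis
    unfolding vnorm_def[of "u @ v"] using u v by (simp add: real_le_lsqrt)
qed

lemma vnorm_single: "vnorm [(a, x)] = cmod a * sqrt (Re (G x x))"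
proof -
  have "vnorm [(a, x)] = vnorm (vscale a [(1, x)])" by (simp add: vscale_def)
  then show ?thesis by (simp only: vnorm_scale) (simp add: vnorm_def)
qed

lemma vnorm_point_le_1: "x \<in> U \<Longrightarrow> vnorm [(1, x)] \<le> 1"
  using norm_le_1 by (simp add: vnorm_def)

lemma pint_vnorm: "\<lbrakk>length a = length xs; set xs \<subseteq> U\<rbrakk> \<Longrightarrow> pint M (NormComb a) xs = vnorm (zip a xs)"
  by (simp add: vnorm_def pint_eq)

lemma mdst_vnorm: "\<lbrakk>x \<in> U; y \<in> U\<rbrakk> \<Longrightarrow> mdst M x y = vnorm (vdiff [(1, x)] [(1, y)])"
  by (simp add: mdst_eq pint_vnorm vdiff_def vscale_def)

text \<open>By linearity, pairings with single points determine those with all lists, so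
  \<open>B u u = B u' u\<close>; conjugation then gives access to the other argument. This replaces
  rewriting by equality of vectors, which lists do not have.\<close>

lemma vnorm_cong:
  assumes "u \<in> vecs" "u' \<in> vecs" and "\<And>y. y \<in> U \<Longrightarrow> B u [(1, y)] = B u' [(1, y)]"
  shows "vnorm u = vnorm u'"
proof -
  have *: "B u w = B u' w" if "w \<in> vecs" for w
    unfolding gform_right_sum[of G _ w] using that assms(3) by (induction w) auto
  have "B u u = B u' u" using * assms by blast
  also have "\<dots> = cnj (B u u')" using assms by (intro gform_herm)
  also have "\<dots> = cnj (B u' u')" using * assms by simp
  also have "\<dots> = B u' u'" using assms gform_herm[of u' u'] by simp
  finally show ?thesis by (simp add: vnorm_def)
qed

lemma vnorm_vdiff_commute: "vnorm (vdiff u v) = vnorm (vdiff v u)"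
  by (simp add: vnorm_def algebra_simps)

lemma vnorm_triangle:
  assumes "u \<in> vecs" "v \<in> vecs" "w \<in> vecs"
  shows "vnorm (vdiff u w) \<le> vnorm (vdiff u v) + vnorm (vdiff v w)"
proof -
  have "vnorm (vdiff u w) = vnorm (vdiff u v @ vdiff v w)"
    by (rule vnorm_cong) (use assms in auto)
  also have "\<dots> \<le> vnorm (vdiff u v) + vnorm (vdiff v w)"
    using assms by (intro vnorm_append_le) auto
  finally show ?thesis .
qed

lemma vnorm_reverse_triangle:
  assumes "u \<in> vecs" "v \<in> vecs"
  shows "\<bar>vnorm u - vnorm v\<bar> \<le> vnorm (vdiff u v)"
proof -
  have [simp]: "vnorm (vdiff w []) = vnorm w" for w by (simp add: vdiff_def vscale_def)
  show ?thesis
    using vnorm_triangle[of u v "[]"] vnorm_triangle[of v u "[]"] assms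
      vnorm_vdiff_commute[of u v] by auto
qed

section \<open>Metric, extensionality and moduli of continuity of a Gram structure\<close>

lemma Metric_space_ball: "Metric_space U (mdst M)"
proof
  fix x y assume "x \<in> U" "y \<in> U"
  then show "mdst M x y = 0 \<longleftrightarrow> x = y"
    using mdst_zero by (auto simp: mdst_vnorm vnorm_def)
next
  fix x y z assume "x \<in> U" "y \<in> U" "z \<in> U"
  then show "mdst M x z \<le> mdst M x y + mdst M y z"
    using vnorm_triangle by (simp add: mdst_vnorm)
qed (use mdst_nonneg mdst_commute in auto)

sublocale Metric_space U "mdst M"
  by (rule Metric_space_ball)

text \<open>The difference pairs to 0 with every point, hence is null, and \<open>mdst\<close>
  separates points. Function values are later compared in this way.\<close>

lemma point_eqI:
  assumes "x \<in> U" "y \<in> U" "\<And>z. z \<in> U \<Longrightarrow> G x z = G y z" shows "x = y"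
proof -
  have "vnorm (vdiff [(1, x)] [(1, y)]) = vnorm []"
    by (rule vnorm_cong) (use assms in auto)
  then show ?thesis using assms(1,2) mdst_zero by (simp add: mdst_vnorm vnorm_def)
qed

lemma G_sigma':
  assumes "length a = length xs" "set xs \<subseteq> U" "y \<in> U"
  shows "G (fint M (Sigma a) xs) y = B (zip a xs) [(1, y)] / of_real (max 1 (vnorm (zip a xs)))"
proof -
  have "max 1 (vnorm (zip a xs)) \<noteq> 0" by simp
  then show ?thesis using G_sigma[OF assms] assms
    by (simp add: pint_vnorm field_simps )
qed

lemma G_sigma_ball:
  assumes "length a = length xs" "set xs \<subseteq> U" "y \<in> U" "vnorm (zip a xs) \<le> 1"
  shows "G (fint M (Sigma a) xs) y = B (zip a xs) [(1, y)]"
  using assms by (simp add: G_sigma' max_absorb1)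

lemma mdst_as_vnorm:
  assumes "x \<in> U" "y \<in> U" "u \<in> vecs" "v \<in> vecs"
    and "\<And>z. z \<in> U \<Longrightarrow> G x z = B u [(1, z)]" "\<And>z. z \<in> U \<Longrightarrow> G y z = B v [(1, z)]"
  shows "mdst M x y = vnorm (vdiff u v)"
  unfolding mdst_vnorm[OF assms(1,2)]
  by (rule vnorm_cong) (use assms in auto)

lemma vnorm_zip_le:
  "\<lbrakk>length a = length xs; set xs \<subseteq> U\<rbrakk> \<Longrightarrow> vnorm (zip a xs) \<le> (\<Sum>c\<leftarrow>a. cmod c)"
proof (induction a xs rule: list_induct2)
  case (Cons c a x xs)
  have "vnorm (zip (c # a) (x # xs)) \<le> vnorm [(c, x)] + vnorm (zip a xs)"
    using vnorm_append_le[of "[(c, x)]" "zip a xs"] Cons by simp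
  moreover have "vnorm [(c, x)] \<le> cmod c"
    using Cons norm_le_1[of x] by (simp add: vnorm_single mult_left_le)
  ultimately show ?case using Cons by simp
qed (simp add: vnorm_def)

lemma vnorm_zip_diff_le:
  assumes "length xs = length a" "length ys = length a" "set xs \<subseteq> U" "set ys \<subseteq> U"
    and "\<And>i. i < length a \<Longrightarrow> mdst M (xs ! i) (ys ! i) < \<delta>"
  shows "vnorm (vdiff (zip a xs) (zip a ys)) \<le> (\<Sum>c\<leftarrow>a. cmod c) * \<delta>"
  using assms
proof (induction a arbitrary: xs ys)
  case Nil
  then show ?case by (simp add: vdiff_def vscale_def vnorm_def)
next
  case (Cons c a)
  obtain x xs' y ys' where xy: "xs = x # xs'" "ys = y # ys'"
    using Cons.prems by (metis length_Suc_conv)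
  have IH: "vnorm (vdiff (zip a xs') (zip a ys')) \<le> (\<Sum>c\<leftarrow>a. cmod c) * \<delta>"
    using Cons.prems by (intro Cons.IH) (auto simp: xy dest: Cons.prems(5)[of "Suc _", unfolded xy, simplified])
  have xU: "x \<in> U" "y \<in> U" "set xs' \<subseteq> U" "set ys' \<subseteq> U" using Cons.prems by (auto simp: xy)
  have "mdst M x y < \<delta>" using Cons.prems(5)[of 0] by (simp add: xy)
  then have "cmod c * vnorm (vdiff [(1, x)] [(1, y)]) \<le> cmod c * \<delta>"
    using xU by (intro mult_left_mono) (auto simp: mdst_vnorm)
  moreover have "vnorm (vdiff (zip (c # a) xs) (zip (c # a) ys))
      = vnorm (vscale c (vdiff [(1, x)] [(1, y)]) @ vdiff (zip a xs') (zip a ys'))"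
    using xU by (intro vnorm_cong)
      (auto simp: xy gform_append_left[of G "[(c, _)]" "zip a _", simplified] algebra_simps)
  moreover have "\<dots> \<le> vnorm (vscale c (vdiff [(1, x)] [(1, y)])) + vnorm (vdiff (zip a xs') (zip a ys'))"
    using xU by (intro vnorm_append_le) auto
  ultimately show ?case using IH by (simp add: algebra_simps)
qed

text \<open>Write \<open>u / \<alpha> - v / \<beta>\<close> as \<open>(u - v) / \<alpha>\<close>
  plus \<open>(1 / \<alpha> - 1 / \<beta>) v\<close>. Each summand has norm at most
  \<open>vnorm (vdiff u v)\<close>: the second because \<open>vnorm v \<le> \<beta>\<close> and
  \<open>1 \<le> \<alpha>\<close>, while \<alpha> and \<beta> differ by at most that norm. Hence the
  constant 2.\<close>

lemma vnorm_retract_lipschitz: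
  assumes u: "u \<in> vecs" and v: "v \<in> vecs"
  shows "vnorm (vdiff (vscale (1 / of_real (max 1 (vnorm u))) u)
      (vscale (1 / of_real (max 1 (vnorm v))) v)) \<le> 2 * vnorm (vdiff u v)"
proof -
  define \<alpha> \<beta> where ab: "\<alpha> = max 1 (vnorm u)" "\<beta> = max 1 (vnorm v)"
  have pos: "1 \<le> \<alpha>" "1 \<le> \<beta>" by (auto simp: ab)
  have "\<bar>\<alpha> - \<beta>\<bar> \<le> vnorm (vdiff u v)"
    using vnorm_reverse_triangle[OF u v] by (auto simp: ab)
  have "vnorm (vdiff (vscale (1 / of_real \<alpha>) u) (vscale (1 / of_real \<beta>) v))
      = vnorm (vscale (1 / of_real \<alpha>) (vdiff u v) @ vscale (of_real (1 / \<alpha> - 1 / \<beta>)) v)"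
    using u v by (intro vnorm_cong) (auto simp: algebra_simps)
  also have "\<dots> \<le> vnorm (vscale (1 / of_real \<alpha>) (vdiff u v)) + vnorm (vscale (of_real (1 / \<alpha> - 1 / \<beta>)) v)"
    using u v by (intro vnorm_append_le) auto
  also have "vnorm (vscale (1 / of_real \<alpha>) (vdiff u v)) \<le> vnorm (vdiff u v)"
    using pos u v mult_right_mono[of "1 / \<alpha>" 1 "vnorm (vdiff u v)"] by (simp add: norm_divide)
  also have "vnorm (vscale (of_real (1 / \<alpha> - 1 / \<beta>)) v) \<le> vnorm (vdiff u v)"
  proof -
    have "1 / \<alpha> - 1 / \<beta> = (\<beta> - \<alpha>) / (\<alpha> * \<beta>)" using pos by (simp add: field_simps)
    then have "\<bar>1 / \<alpha> - 1 / \<beta>\<bar> * vnorm v = \<bar>\<alpha> - \<beta>\<bar> * ((vnorm v / \<beta>) / \<alpha>)"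
      using pos by (simp add: abs_mult abs_minus_commute)
    also have "\<dots> \<le> \<bar>\<alpha> - \<beta>\<bar> * 1"
    proof (rule mult_left_mono)
      have "vnorm v \<le> 1 * \<beta>" by (simp add: ab)
      also have "\<dots> \<le> \<alpha> * \<beta>" using pos by (intro mult_right_mono) auto
      finally show "vnorm v / \<beta> / \<alpha> \<le> 1"
        using pos by (simp add: field_simps)
    qed simp
    finally show ?thesis
      using \<open>\<bar>\<alpha> - \<beta>\<bar> \<le> vnorm (vdiff u v)\<close> by (simp del: of_real_diff of_real_divide)
  qed
  finally show ?thesis by (simp add: ab)
qed

lemma metric_structure_ball:
  assumes "mcomplete" shows "metric_structure banach_signature M"
proof -
  have d2: "mdst M x y \<le> 2" if "x \<in> U" "y \<in> U" for x y
    using vnorm_zip_le[of "[1, -1]" "[x, y]"] that by (simp add: mdst_eq pint_vnorm)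
  have fin: "fint M F xs \<in> U" if "xs \<in> tuples U (ball_fun_arity F)" for F xs
    using that zero_in sigma_in by (cases F) (auto simp: tuples_def)
  have fcont: "mdst M (fint M F xs) (fint M F ys) \<le> \<epsilon>"
    if "0 < \<epsilon>" and xs: "xs \<in> tuples U (ball_fun_arity F)" and ys: "ys \<in> tuples U (ball_fun_arity F)"
      and close: "\<forall>i<ball_fun_arity F. mdst M (xs ! i) (ys ! i) < ball_fun_modulus F \<epsilon>" for F \<epsilon> xs ys
  proof (cases F)
    case Zero
    then show ?thesis using xs ys \<open>0 < \<epsilon>\<close> zero_in by (simp add: tuples_def)
  next
    case (Sigma a)
    define S where "S = (\<Sum>c\<leftarrow>a. cmod c)"
    have "0 \<le> S" by (auto simp: S_def intro!: sum_list_nonneg)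
    have l: "length xs = length a" "length ys = length a" "set xs \<subseteq> U" "set ys \<subseteq> U"
      using xs ys Sigma by (auto simp: tuples_def)
    let ?r = "\<lambda>zs. vscale (1 / of_real (max 1 (vnorm (zip a zs)))) (zip a zs)"
    have "mdst M (fint M F xs) (fint M F ys) = vnorm (vdiff (?r xs) (?r ys))"
      using l by (intro mdst_as_vnorm) (auto simp: Sigma sigma_in G_sigma')
    also have "\<dots> \<le> 2 * vnorm (vdiff (zip a xs) (zip a ys))"
      using l by (intro vnorm_retract_lipschitz) auto
    also have "\<dots> \<le> 2 * (S * (\<epsilon> / (1 + 2 * S)))"
      using vnorm_zip_diff_le[of xs a ys "\<epsilon> / (1 + 2 * S)"] l close by (auto simp: Sigma S_def)
    also have "\<dots> \<le> \<epsilon>" using \<open>0 \<le> S\<close> \<open>0 < \<epsilon>\<close> by (simp add: field_simps)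
    finally show ?thesis .
  qed
  have pin: "pint M P xs \<in> {0..ball_pred_bound P}" if "xs \<in> tuples U (ball_pred_arity P)" for P xs
    using that vnorm_zip_le by (cases P) (auto simp: tuples_def pint_vnorm)
  have pcont: "\<bar>pint M P xs - pint M P ys\<bar> \<le> \<epsilon>"
    if "0 < \<epsilon>" and xs: "xs \<in> tuples U (ball_pred_arity P)" and ys: "ys \<in> tuples U (ball_pred_arity P)"
      and close: "\<forall>i<ball_pred_arity P. mdst M (xs ! i) (ys ! i) < ball_pred_modulus P \<epsilon>" for P \<epsilon> xs ys
  proof (cases P)
    case (NormComb a)
    define S where "S = (\<Sum>c\<leftarrow>a. cmod c)"
    have "0 \<le> S" by (auto simp: S_def intro!: sum_list_nonneg)
    have l: "length xs = length a" "length ys = length a" "set xs \<subseteq> U" "set ys \<subseteq> U"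
      using xs ys NormComb by (auto simp: tuples_def)
    have "\<bar>pint M P xs - pint M P ys\<bar> \<le> vnorm (vdiff (zip a xs) (zip a ys))"
      using l vnorm_reverse_triangle by (simp add: NormComb pint_vnorm)
    also have "\<dots> \<le> S * (\<epsilon> / (1 + S))"
      using vnorm_zip_diff_le[of xs a ys "\<epsilon> / (1 + S)"] l close by (auto simp: NormComb S_def)
    also have "\<dots> \<le> \<epsilon>" using \<open>0 \<le> S\<close> \<open>0 < \<epsilon>\<close> by (simp add: field_simps)
    finally show ?thesis .
  qed
  show ?thesis
    unfolding metric_structure_def banach_signature_def
    using zero_in Metric_space_ball assms d2 fin fcont pin pcont by auto
qed

end

locale hilbert_ball = gram_ball M G
  for M :: "(ball_fun, ball_pred, 'm) mstruct" and G :: "'m \<Rightarrow> 'm \<Rightarrow> complex" +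
  assumes complete: "mcomplete"

section \<open>Back-and-forth\<close>

lemma gform_map: "gform G (map (apsnd s) u) (map (apsnd s) v) = gform (\<lambda>i j. G (s i) (s j)) u v"
  by (simp add: gform_def apsnd_def map_prod_def comp_def split_def)

lemma gform_cong:
  assumes "u \<in> lists (UNIV \<times> X)" "v \<in> lists (UNIV \<times> X)"
    and "\<And>x y. \<lbrakk>x \<in> X; y \<in> X\<rbrakk> \<Longrightarrow> G x y = G' x y"
  shows "gform G u v = gform G' u v"
proof -
  have "map (\<lambda>(b, y). a * cnj b * G x y) v = map (\<lambda>(b, y). a * cnj b * G' x y) v" if "x \<in> X" for a x
    using assms(2,3) that by (intro map_cong) auto
  then have "map (\<lambda>(a, x). \<Sum>(b, y)\<leftarrow>v. a * cnj b * G x y) u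
      = map (\<lambda>(a, x). \<Sum>(b, y)\<leftarrow>v. a * cnj b * G' x y) u"
    using assms(1) by (intro map_cong) (force simp del: map_eq_conv)+
  then show ?thesis unfolding gform_def by (rule arg_cong)
qed

lemma map_apsnd_lists: "v \<in> lists (UNIV \<times> I) \<Longrightarrow> s ` I \<subseteq> X \<Longrightarrow> map (apsnd s) v \<in> lists (UNIV \<times> X)"
  by force

lemma vscale_lists_iff: "vscale c v \<in> lists (UNIV \<times> X) \<longleftrightarrow> v \<in> lists (UNIV \<times> X)"
  by (auto simp: vscale_def)

lemma map_apsnd_vscale: "map (apsnd s) (vscale c v) = vscale c (map (apsnd s) v)"
  by (auto simp: vscale_def)

section \<open>Realization and orthogonal projection of formal combinations\<close>

context gram_ball
begin

text \<open>A way to say, inside a ball, that finitely many points never exhaust the space, in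
  exactly the form in which \<open>extend\<close> consumes it.\<close>

definition inf_dim :: bool where
  "inf_dim \<longleftrightarrow> (\<forall>F. finite F \<and> F \<subseteq> U \<longrightarrow> (\<exists>e\<in>U. G e e = 1 \<and> (\<forall>f\<in>F. G e f = 0)))"

text \<open>\<open>Sigma\<close> with the coefficients of \<open>w\<close> provides the point; the
  norm bound keeps the retraction idle.\<close>

lemma realize:
  assumes "w \<in> vecs" "vnorm w \<le> 1"
  obtains y where "y \<in> U" "\<And>z. z \<in> U \<Longrightarrow> G y z = B w [(1, z)]"
proof -
  have *: "set (map snd w) \<subseteq> U" "zip (map fst w) (map snd w) = w"
    using assms(1) by (auto simp: zip_map_fst_snd)
  then have "G (fint M (Sigma (map fst w)) (map snd w)) z = B w [(1, z)]" if "z \<in> U" for z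
    using G_sigma_ball[of "map fst w" "map snd w" z] that assms(2) by simp
  moreover have "fint M (Sigma (map fst w)) (map snd w) \<in> U"
    using * by (intro sigma_in) auto
  ultimately show ?thesis using that by blast
qed

lemma G_self_realized:
  assumes "y \<in> U" "w \<in> vecs" "\<And>z. z \<in> U \<Longrightarrow> G y z = B w [(1, z)]"
  shows "G y y = of_real ((vnorm w)\<^sup>2)"
proof -
  have "vnorm [(1, y)] = vnorm w"
    by (rule vnorm_cong) (use assms in auto)
  then show ?thesis using gform_self[of "[(1, y)]"] assms by simp
qed

lemma gform_orth:
  assumes "u \<in> lists (UNIV \<times> F)" "\<And>f. f \<in> F \<Longrightarrow> B w [(1, f)] = 0"
  shows "B w u = 0"
  using assms(1) by (subst gform_right_sum, induction u) (auto simp: assms(2))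

text \<open>Induction over \<open>F\<close> for all \<open>x\<close> at once, because the new point
  \<open>g\<close> is itself projected first and its remainder \<open>w\<close> is the new
  orthogonal direction. \<open>F\<close> may be linearly dependent, so \<open>w\<close> may be
  null.\<close>

lemma projection:
  assumes "finite F" "F \<subseteq> U" "x \<in> vecs"
  obtains u where "u \<in> lists (UNIV \<times> F)" "\<And>f. f \<in> F \<Longrightarrow> B (vdiff x u) [(1, f)] = 0"
proof -
  have "\<exists>u\<in>lists (UNIV \<times> F). \<forall>f\<in>F. B (vdiff x u) [(1, f)] = 0"
    using assms
  proof (induction F arbitrary: x rule: finite_induct)
    case empty
    then show ?case by (intro bexI[of _ "[]"]) auto
  next
    case (insert g F)
    have "[(1, g)] \<in> vecs" using insert.prems by auto
    then obtain ug where ug: "ug \<in> lists (UNIV \<times> F)"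
      and ug0: "\<And>f. f \<in> F \<Longrightarrow> B (vdiff [(1, g)] ug) [(1, f)] = 0"
      using insert.IH[of "[(1, g)]"] insert.prems by auto
    obtain u where u: "u \<in> lists (UNIV \<times> F)"
      and u0: "\<And>f. f \<in> F \<Longrightarrow> B (vdiff x u) [(1, f)] = 0"
      using insert.IH[of x] insert.prems by auto
    define w where "w = vdiff [(1, g)] ug"
    have sub: "lists (UNIV \<times> F) \<subseteq> vecs" using insert.prems by (intro lists_mono) auto
    have uv: "u \<in> vecs" "ug \<in> vecs" using sub u ug by blast+
    have w: "w \<in> vecs" unfolding w_def using uv insert.prems by (intro vdiff_vecs) auto
    have w_g: "B y [(1, g)] = B y w + B y ug" for y
      by (simp only: w_def gform_diff_right diff_add_cancel)
    have wu: "B w u = 0" unfolding w_def using u ug0 by (rule gform_orth)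
    have wug: "B w ug = 0" unfolding w_def using ug ug0 by (rule gform_orth)
    have xug: "B (vdiff x u) ug = 0" using ug u0 by (rule gform_orth)
    have uw: "B u w = 0" using gform_herm[OF w uv(1)] wu by simp
    \<comment> \<open>Gram-Schmidt step; if \<open>w\<close> is null, then so is \<open>B x w\<close>, and \<open>c = 0\<close> serves (\<open>x / 0 = 0\<close>).\<close>
    define c where "c = B x w / B w w"
    have c: "c * B w w = B x w"
    proof (cases "B w w = 0")
      case True
      then have "vnorm w = 0" by (simp add: vnorm_def)
      then have "B x w = 0" using cauchy_schwarz[OF insert.prems(2) w] by simp
      then show ?thesis by (simp add: c_def)
    qed (simp add: c_def)
    define u' where "u' = u @ vscale c w"
    have "u' \<in> lists (UNIV \<times> insert g F)"
      using u ug by (force simp: u'_def w_def vdiff_def vscale_def)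
    moreover have "B (vdiff x u') [(1, f)] = 0" if "f \<in> insert g F" for f
    proof (cases "f = g")
      case True
      have "B (vdiff x u') [(1, g)] = B x w - B u w - c * B w w + B (vdiff x u) ug - c * B w ug"
        unfolding w_g by (simp add: u'_def)
      then show ?thesis using True c uw xug wug by simp
    next
      case False
      then have "f \<in> F" using that by auto
      then show ?thesis using u0[of f] ug0[of f] by (simp add: u'_def w_def)
    qed
    ultimately show ?case by auto
  qed
  then show ?thesis using that by auto
qed

end

text \<open>A position of the back-and-forth game. \<open>I\<close> is a set of variables, in
  practice the free variables of a formula, and the values of \<open>s\<close> and \<open>s'\<close>
  outside \<open>I\<close> are arbitrary.\<close>

locale gram_pair = A: gram_ball M G + A': gram_ball M' G'
  for M :: "(ball_fun, ball_pred, 'm) mstruct" and G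
  and M' :: "(ball_fun, ball_pred, 'n) mstruct" and G' +
  fixes I :: "nat set" and s :: "nat \<Rightarrow> 'm" and s' :: "nat \<Rightarrow> 'n"
  assumes s: "s ` I \<subseteq> universe M" and s': "s' ` I \<subseteq> universe M'"
    and same: "\<lbrakk>i \<in> I; j \<in> I\<rbrakk> \<Longrightarrow> G (s i) (s j) = G' (s' i) (s' j)"
begin

lemma push_vecs [simp]:
  assumes "v \<in> lists (UNIV \<times> I)"
  shows "map (apsnd s) v \<in> lists (UNIV \<times> universe M)"
    "map (apsnd s') v \<in> lists (UNIV \<times> universe M')"
  using map_apsnd_lists[OF assms s] map_apsnd_lists[OF assms s'] .

lemma gform_push:
  assumes "u \<in> lists (UNIV \<times> I)" "v \<in> lists (UNIV \<times> I)"
  shows "gform G (map (apsnd s) u) (map (apsnd s) v) = gform G' (map (apsnd s') u) (map (apsnd s') v)"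
  unfolding gform_map using assms same by (rule gform_cong)

lemma vnorm_push:
  "u \<in> lists (UNIV \<times> I) \<Longrightarrow> A.vnorm (map (apsnd s) u) = A'.vnorm (map (apsnd s') u)"
  by (simp add: A.vnorm_def A'.vnorm_def gform_push)

text \<open>The vectors \<open>u\<close> and \<open>u'\<close> have one common list \<open>v\<close>
  of coefficients over the variables. Sharing \<open>v\<close> is what makes norms, and with them
  the truncation factors, agree in the two structures.\<close>

definition represents :: "(complex \<times> nat) list \<Rightarrow> (complex \<times> 'm) list \<Rightarrow> (complex \<times> 'n) list \<Rightarrow> bool" where
  "represents v u u' \<longleftrightarrow> v \<in> lists (UNIV \<times> I)
     \<and> u \<in> lists (UNIV \<times> universe M) \<and> u' \<in> lists (UNIV \<times> universe M')
     \<and> (\<forall>y\<in>universe M. gform G u [(1, y)] = gform G (map (apsnd s) v) [(1, y)])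
     \<and> (\<forall>y\<in>universe M'. gform G' u' [(1, y)] = gform G' (map (apsnd s') v) [(1, y)])"

lemma represents_vnorm:
  assumes "represents v u u'" shows "A.vnorm u = A'.vnorm u'"
proof -
  have "A.vnorm u = A.vnorm (map (apsnd s) v)" and "A'.vnorm u' = A'.vnorm (map (apsnd s') v)"
    using assms unfolding represents_def by (intro A.vnorm_cong A'.vnorm_cong; simp del: in_lists_conv_set)+
  then show ?thesis using assms by (simp add: represents_def vnorm_push)
qed

lemma represents_zip:
  assumes "length a = length ts"
    and "\<And>t. t \<in> set ts \<Longrightarrow> \<exists>v. represents v [(1, f t)] [(1, f' t)]"
  shows "\<exists>v. represents v (zip a (map f ts)) (zip a (map f' ts))"
  using assms
proof (induction a ts rule: list_induct2)
  case Nil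
  then show ?case by (auto simp: represents_def intro!: exI[of _ "[]"])
next
  case (Cons c a t ts)
  obtain v where v: "represents v (zip a (map f ts)) (zip a (map f' ts))"
    using Cons by auto
  obtain vt where vt: "represents vt [(1, f t)] [(1, f' t)]"
    using Cons.prems by auto
  have 1: "gform K [(c, x)] w = c * gform K [(1, x)] w" for K :: "'k \<Rightarrow> 'k \<Rightarrow> complex" and x w
    using gform_left_sum[of K "[(c, x)]"] by simp
  have 2: "gform K ((c, x) # u) w = c * gform K [(1, x)] w + gform K u w"
    for K :: "'k \<Rightarrow> 'k \<Rightarrow> complex" and x u w
    using gform_append_left[of K "[(c, x)]" u] 1[of K] by simp
  have "represents (vscale c vt @ v) (zip (c # a) (map f (t # ts))) (zip (c # a) (map f' (t # ts)))"
    using v vt unfolding represents_def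
    by (auto simp: map_apsnd_vscale 2 vscale_lists_iff Cons_in_lists_iff simp del: in_lists_conv_set)
  then show ?case by blast
qed

lemma represents_term:
  assumes "wf_tm banach_signature t" "fv_tm t \<subseteq> I"
  shows "\<exists>v. represents v [(1, eval_tm M t s)] [(1, eval_tm M' t s')]"
  using assms
proof (induction t)
  case (Var i)
  have "represents [(1, i)] [(1, s i)] [(1, s' i)]"
    using Var s s' by (auto simp: represents_def)
  then show ?case by auto
next
  case (App F ts)
  show ?case
  proof (cases F)
    case Zero
    then have "ts = []" using App.prems by (simp add: banach_signature_def)
    then have "represents [] [(1, eval_tm M (App F ts) s)] [(1, eval_tm M' (App F ts) s')]"
      using Zero A.zero_in A'.zero_in A.G_zero A'.G_zero by (auto simp: represents_def)
    then show ?thesis by blast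
  next
    case (Sigma a)
    define xs xs' where "xs = map (\<lambda>t. eval_tm M t s) ts" and "xs' = map (\<lambda>t. eval_tm M' t s') ts"
    have la: "length a = length ts" using App.prems Sigma by (simp add: banach_signature_def)
    have IH: "\<exists>v. represents v [(1, eval_tm M t s)] [(1, eval_tm M' t s')]" if "t \<in> set ts" for t
      using App that by auto
    then have xs: "set xs \<subseteq> universe M" "set xs' \<subseteq> universe M'"
      by (fastforce simp: xs_def xs'_def represents_def)+
    obtain v where v: "represents v (zip a xs) (zip a xs')"
      using represents_zip[OF la, of "\<lambda>t. eval_tm M t s" "\<lambda>t. eval_tm M' t s'"] IH
      by (auto simp: xs_def xs'_def)
    note N = represents_vnorm[OF v]
    \<comment> \<open>By \<open>N\<close> this scalar, computed in \<open>M\<close>, is also the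
      truncation factor in \<open>M'\<close>, so \<open>vscale ?c v\<close> serves both
      sides.\<close>
    let ?c = "1 / of_real (max 1 (A.vnorm (zip a xs)))"
    have la': "length a = length xs" "length a = length xs'" by (simp_all add: la xs_def xs'_def)
    have "gform G (zip a xs) [(1, y)] = gform G (map (apsnd s) v) [(1, y)]" if "y \<in> universe M" for y
      using v that unfolding represents_def by blast
    then have G1: "G (fint M F xs) y = gform G (map (apsnd s) (vscale ?c v)) [(1, y)]" if "y \<in> universe M" for y
      using that by (simp add: Sigma map_apsnd_vscale A.G_sigma'[OF la'(1) xs(1)])
    have "gform G' (zip a xs') [(1, y)] = gform G' (map (apsnd s') v) [(1, y)]" if "y \<in> universe M'" for y
      using v that unfolding represents_def by blast
    then have G2: "G' (fint M' F xs') y = gform G' (map (apsnd s') (vscale ?c v)) [(1, y)]" if "y \<in> universe M'" for y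
      using that by (simp add: Sigma map_apsnd_vscale A'.G_sigma'[OF la'(2) xs(2)] N)
    have "represents (vscale ?c v) [(1, fint M F xs)] [(1, fint M' F xs')]"
      using v A.sigma_in[OF la'(1) xs(1)] A'.sigma_in[OF la'(2) xs(2)] G1 G2
      by (auto simp: represents_def Sigma vscale_lists_iff Cons_in_lists_iff simp del: in_lists_conv_set)
    then show ?thesis by (auto simp: xs_def xs'_def)
  qed
qed

lemma eval_pred_eq:
  assumes "length a = length ts" "\<And>t. t \<in> set ts \<Longrightarrow> wf_tm banach_signature t \<and> fv_tm t \<subseteq> I"
  shows "pint M (NormComb a) (map (\<lambda>t. eval_tm M t s) ts)
    = pint M' (NormComb a) (map (\<lambda>t. eval_tm M' t s') ts)"
proof -
  have IH: "\<exists>v. represents v [(1, eval_tm M t s)] [(1, eval_tm M' t s')]" if "t \<in> set ts" for t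
    using assms represents_term that by auto
  then have xs: "(\<lambda>t. eval_tm M t s) ` set ts \<subseteq> universe M" "(\<lambda>t. eval_tm M' t s') ` set ts \<subseteq> universe M'"
    by (fastforce simp: represents_def)+
  obtain v where v: "represents v (zip a (map (\<lambda>t. eval_tm M t s) ts)) (zip a (map (\<lambda>t. eval_tm M' t s') ts))"
    using represents_zip[OF assms(1), of "\<lambda>t. eval_tm M t s" "\<lambda>t. eval_tm M' t s'"] IH by auto
  then show ?thesis using represents_vnorm[OF v] xs assms(1) by (simp add: A.pint_vnorm A'.pint_vnorm)
qed

text \<open>The forth step. Only the pairings of the new point with the tuple and its own length
  have to be matched; infinite dimension of the target provides a direction \<open>e\<close> for the
  part of the length outside the span.\<close>

lemma extend:
  assumes "finite I" "A'.inf_dim" "x \<in> universe M"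
  obtains y where "y \<in> universe M'" "G' y y = G x x" "\<And>j. j \<in> I \<Longrightarrow> G' y (s' j) = G x (s j)"
proof -
  obtain u where u: "u \<in> lists (UNIV \<times> s ` I)"
    and u0: "\<And>f. f \<in> s ` I \<Longrightarrow> gform G (vdiff [(1, x)] u) [(1, f)] = 0"
    using A.projection[of "s ` I" "[(1, x)]"] assms s by auto
  have "lists (UNIV \<times> s ` I) = map (apsnd s) ` lists (UNIV \<times> I)"
    by (subst lists_image[symmetric], rule arg_cong[where f = lists]) force
  then obtain v where v: "v \<in> lists (UNIV \<times> I)" "u = map (apsnd s) v" using u by blast
  have ru: "gform G (vdiff [(1, x)] u) u = 0" using u u0 by (rule A.gform_orth)
  obtain e where e: "e \<in> universe M'" "G' e e = 1" "\<And>j. j \<in> I \<Longrightarrow> G' e (s' j) = 0"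
    using assms(1,2) s' unfolding A'.inf_dim_def
    by (metis (no_types, lifting) finite_imageI image_eqI)
  define r where "r = vdiff [(1, x)] u"
  define \<rho> where "\<rho> = A.vnorm r"
  have vs: "u \<in> A.vecs" "r \<in> A.vecs" using v assms(3) unfolding r_def by (auto simp del: in_lists_conv_set)
  \<comment> \<open>Copy the component of \<open>x\<close> in the span of the tuple, and its orthogonal component along \<open>e\<close>.\<close>
  define w where "w = map (apsnd s') v @ [(of_real \<rho>, e)]"
  have w: "w \<in> A'.vecs" using v e by (auto simp: w_def)
  have ev: "gform G' [(1, e)] (map (apsnd s') v) = 0"
  proof (rule A'.gform_orth)
    show "map (apsnd s') v \<in> lists (UNIV \<times> s' ` I)" using v(1) by (rule map_apsnd_lists) simp
    show "gform G' [(1, e)] [(1, f)] = 0" if "f \<in> s' ` I" for f using that e(3) by auto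
  qed
  have ve: "gform G' (map (apsnd s') v) [(1, e)] = 0"
    using A'.gform_herm[of "[(1, e)]" "map (apsnd s') v"] ev e(1) v(1) by simp
  have "gform G' w w = gform G u u + gform G r r"
  proof -
    have "gform G r r = of_real \<rho> * of_real \<rho>"
      using A.gform_self[OF vs(2)] by (simp add: \<rho>_def power2_eq_square)
    moreover have "gform G' [(of_real \<rho>, e)] z = of_real \<rho> * gform G' [(1, e)] z"
      "gform G' z [(of_real \<rho>, e)] = of_real \<rho> * gform G' z [(1, e)]" for z
      using gform_left_sum[of G' "[(of_real \<rho>, e)]"] gform_right_sum[of G' z "[(of_real \<rho>, e)]"] by simp_all
    ultimately show ?thesis
      using gform_push[of v v] v e ev ve by (simp add: w_def)
  qed
  also have "\<dots> = G x x"
  proof -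
    have "gform G u r = 0" using A.gform_herm[of r u] vs ru by (simp add: r_def)
    then show ?thesis using ru by (simp add: r_def)
  qed
  finally have ww: "gform G' w w = G x x" .
  \<comment> \<open>The copy is as long as \<open>x\<close>, so it is realized in the ball without
    truncation.\<close>
  then have "A'.vnorm w \<le> 1" using A.norm_le_1[OF assms(3)] by (simp add: A'.vnorm_def)
  then obtain y where y: "y \<in> universe M'" "\<And>z. z \<in> universe M' \<Longrightarrow> G' y z = gform G' w [(1, z)]"
    using A'.realize[OF w] by auto
  show ?thesis
  proof
    show "G' y y = G x x"
      using A'.G_self_realized[OF y(1) w y(2)] A'.gform_self[OF w] ww by simp
    fix j assume j: "j \<in> I"
    have "gform G' [(of_real \<rho>, e)] [(1, s' j)] = 0" using e(3)[OF j] by simp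
    moreover have "gform G' (map (apsnd s') v) [(1, s' j)] = gform G u [(1, s j)]"
      using gform_push[of v "[(1, j)]"] v j by simp
    moreover have "gform G u [(1, s j)] = G x (s j)" using u0[of "s j"] j by simp
    ultimately show "G' y (s' j) = G x (s j)" using y(2)[of "s' j"] s' j by (auto simp: w_def)
  qed (rule y(1))
qed

end

lemma finite_fv_tm: "finite (fv_tm t)"
  by (induction t) auto

lemma finite_fv: "finite (fv \<phi>)"
  by (induction \<phi>) (auto simp: finite_fv_tm)

text \<open>Matching points are found exactly, not up to an error, so the sets of values themselves
  can be compared; this serves supremum and infimum alike, bounded or not.\<close>

lemma eval_image_subset:
  fixes M :: "(ball_fun, ball_pred, 'm) mstruct" and M' :: "(ball_fun, ball_pred, 'n) mstruct"
  assumes P: "gram_pair M G M' G' (fv \<phi> - {i}) s s'" and inf: "gram_ball.inf_dim M' G'"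
    and IH: "\<And>s s'. gram_pair M G M' G' (fv \<phi>) s s' \<Longrightarrow> eval M \<phi> s = eval M' \<phi> s'"
  shows "(\<lambda>x. eval M \<phi> (s(i := x))) ` universe M \<subseteq> (\<lambda>x. eval M' \<phi> (s'(i := x))) ` universe M'"
proof safe
  interpret gram_pair M G M' G' "fv \<phi> - {i}" s s' by (rule P)
  fix x assume x: "x \<in> universe M"
  obtain y where y: "y \<in> universe M'" "G' y y = G x x" "\<And>j. j \<in> fv \<phi> - {i} \<Longrightarrow> G' y (s' j) = G x (s j)"
    using extend[OF _ inf x] finite_fv[of \<phi>] by auto
  have "gram_pair M G M' G' (fv \<phi>) (s(i := x)) (s'(i := y))"
  proof
    fix j k assume jk: "j \<in> fv \<phi>" "k \<in> fv \<phi>"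
    have swap: "G (s j) x = G' (s' j) y" if "j \<in> fv \<phi> - {i}" for j
    proof -
      have "s j \<in> universe M" "s' j \<in> universe M'" using that s s' by auto
      then show ?thesis using A.herm[OF x] A'.herm[OF y(1)] y(3)[OF that] by simp
    qed
    show "G ((s(i := x)) j) ((s(i := x)) k) = G' ((s'(i := y)) j) ((s'(i := y)) k)"
      using jk same[of j k] swap[of j] y(2) y(3)[of k] by auto
  qed (use s s' x y in auto)
  then show "eval M \<phi> (s(i := x)) \<in> (\<lambda>x. eval M' \<phi> (s'(i := x))) ` universe M'"
    using IH y(1) by blast
qed

lemma gram_pair_flip: "gram_pair M G M' G' I s s' \<Longrightarrow> gram_pair M' G' M G I s' s"
  unfolding gram_pair_def gram_pair_axioms_def by auto

lemma eval_image_eq: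
  fixes M :: "(ball_fun, ball_pred, 'm) mstruct" and M' :: "(ball_fun, ball_pred, 'n) mstruct"
  assumes "gram_pair M G M' G' (fv \<phi> - {i}) s s'"
    and "gram_ball.inf_dim M G" "gram_ball.inf_dim M' G'"
    and "\<And>s s'. gram_pair M G M' G' (fv \<phi>) s s' \<Longrightarrow> eval M \<phi> s = eval M' \<phi> s'"
  shows "(\<lambda>x. eval M \<phi> (s(i := x))) ` universe M = (\<lambda>x. eval M' \<phi> (s'(i := x))) ` universe M'"
proof (rule antisym)
  show "(\<lambda>x. eval M \<phi> (s(i := x))) ` universe M \<subseteq> (\<lambda>x. eval M' \<phi> (s'(i := x))) ` universe M'"
    using assms(1,3,4) by (rule eval_image_subset)
  show "(\<lambda>x. eval M' \<phi> (s'(i := x))) ` universe M' \<subseteq> (\<lambda>x. eval M \<phi> (s(i := x))) ` universe M"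
    using gram_pair_flip[OF assms(1)] assms(2)
    by (rule eval_image_subset) (rule assms(4)[OF gram_pair_flip, symmetric])
qed

text \<open>Applied within one structure it says that Gram matrices determine types; applied to
  sentences, where no variable is constrained, that any two infinite-dimensional structures of this
  kind are elementarily equivalent.\<close>

theorem eval_eq_of_same_gram:
  fixes M :: "(ball_fun, ball_pred, 'm) mstruct" and M' :: "(ball_fun, ball_pred, 'n) mstruct"
  assumes "gram_pair M G M' G' (fv \<phi>) s s'"
    and inf: "gram_ball.inf_dim M G" "gram_ball.inf_dim M' G'"
    and "wf_fm banach_signature \<phi>"
  shows "eval M \<phi> s = eval M' \<phi> s'"
  using assms(1,4)
proof (induction \<phi> arbitrary: s s')
  case (Dist t t')
  interpret gram_pair M G M' G' "fv_tm t \<union> fv_tm t'" s s'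
    using Dist.prems(1) by simp
  have *: "\<exists>v. represents v [(1, eval_tm M t s)] [(1, eval_tm M' t s')]"
     "\<exists>v. represents v [(1, eval_tm M t' s)] [(1, eval_tm M' t' s')]"
    using Dist.prems(2) by (auto intro!: represents_term)
  then have "eval_tm M t s \<in> universe M" "eval_tm M t' s \<in> universe M"
     "eval_tm M' t s' \<in> universe M'" "eval_tm M' t' s' \<in> universe M'"
    by (auto simp: represents_def)
  then show ?case
    using eval_pred_eq[of "[1, -1]" "[t, t']"] Dist.prems(2) by (auto simp: A.mdst_eq A'.mdst_eq)
next
  case (Pred P ts)
  interpret gram_pair M G M' G' "fv (Pred P ts)" s s' by (rule Pred.prems)
  obtain a where a: "P = NormComb a" by (cases P)
  then have "length a = length ts" using Pred.prems by (simp add: banach_signature_def)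
  then show ?case unfolding a using Pred.prems(2) by (simp, intro eval_pred_eq) auto
next
  case (Conn u \<phi>s)
  interpret gram_pair M G M' G' "fv (Conn u \<phi>s)" s s' by (rule Conn.prems)
  have "gram_pair M G M' G' (fv \<phi>) s s'" if "\<phi> \<in> set \<phi>s" for \<phi>
    using that s s' by unfold_locales (auto intro!: same)
  then have "map (\<lambda>\<phi>. eval M \<phi> s) \<phi>s = map (\<lambda>\<phi>. eval M' \<phi> s') \<phi>s"
    using Conn by (intro map_cong) auto
  then show ?case by (simp del: map_eq_conv)
next
  case (QSup i \<phi>)
  have "(\<lambda>x. eval M \<phi> (s(i := x))) ` universe M = (\<lambda>x. eval M' \<phi> (s'(i := x))) ` universe M'"
    using QSup inf by (intro eval_image_eq) auto
  then show ?case by simp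
next
  case (QInf i \<phi>)
  have "(\<lambda>x. eval M \<phi> (s(i := x))) ` universe M = (\<lambda>x. eval M' \<phi> (s'(i := x))) ` universe M'"
    using QInf inf by (intro eval_image_eq) auto
  then show ?case by simp
qed

section \<open>Inner products in models of the theory\<close>

type_synonym ball_fm = "(ball_fun, ball_pred) fm"

abbreviation fconst :: "real \<Rightarrow> ball_fm" where
  "fconst c \<equiv> Conn (\<lambda>_. c) []"

abbreviation fadd :: "ball_fm \<Rightarrow> ball_fm \<Rightarrow> ball_fm" where
  "fadd \<phi> \<psi> \<equiv> Conn (\<lambda>x. x 0 + x 1) [\<phi>, \<psi>]"

abbreviation fsub :: "ball_fm \<Rightarrow> ball_fm \<Rightarrow> ball_fm" where
  "fsub \<phi> \<psi> \<equiv> Conn (\<lambda>x. x 0 - x 1) [\<phi>, \<psi>]"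

abbreviation fmul :: "ball_fm \<Rightarrow> ball_fm \<Rightarrow> ball_fm" where
  "fmul \<phi> \<psi> \<equiv> Conn (\<lambda>x. x 0 * x 1) [\<phi>, \<psi>]"

abbreviation fmax1 :: "ball_fm \<Rightarrow> ball_fm" where
  "fmax1 \<phi> \<equiv> Conn (\<lambda>x. max 1 (x 0)) [\<phi>]"

abbreviation fclamp :: "ball_fm \<Rightarrow> ball_fm" where
  "fclamp \<phi> \<equiv> Conn (\<lambda>x. min 1 \<bar>x 0\<bar>) [\<phi>]"

definition fsum :: "ball_fm list \<Rightarrow> ball_fm" where
  "fsum \<phi>s = foldr fadd \<phi>s (fconst 0)"

text \<open>For \<open>c = 1\<close> this is the real part, and for \<open>c = \<i>\<close> the
  imaginary part, of the inner product of the values of the terms.\<close>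

definition fdiffsq :: "complex \<Rightarrow> ball_fun tm \<Rightarrow> ball_fun tm \<Rightarrow> ball_fm" where
  "fdiffsq c t t' = fmul (fconst (1 / 4))
     (fsub (fmul (Pred (NormComb [1, c]) [t, t']) (Pred (NormComb [1, c]) [t, t']))
        (fmul (Pred (NormComb [1, -c]) [t, t']) (Pred (NormComb [1, -c]) [t, t'])))"

text \<open>The inner product is recovered from the norm predicates by polarization.\<close>

definition polar :: "(ball_fun, ball_pred, 'm) mstruct \<Rightarrow> 'm \<Rightarrow> 'm \<Rightarrow> complex" where
  "polar M x y = Complex
     (((pint M (NormComb [1, 1]) [x, y])\<^sup>2 - (pint M (NormComb [1, -1]) [x, y])\<^sup>2) / 4)
     (((pint M (NormComb [1, \<i>]) [x, y])\<^sup>2 - (pint M (NormComb [1, -\<i>]) [x, y])\<^sup>2) / 4)"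

text \<open>Formulas are real-valued, so \<open>gform\<close> is split by
  \<open>Re (z * w) = Re z * Re w - Im z * Im w\<close> with \<open>z = a * cnj b\<close>;
  \<open>fIm\<close> is its companion.\<close>

definition fRe :: "(complex \<times> ball_fun tm) list \<Rightarrow> (complex \<times> ball_fun tm) list \<Rightarrow> ball_fm" where
  "fRe u v = fsum (map (\<lambda>(a, t). fsum (map (\<lambda>(b, t').
     fsub (fmul (fconst (Re (a * cnj b))) (fdiffsq 1 t t'))
       (fmul (fconst (Im (a * cnj b))) (fdiffsq \<i> t t'))) v)) u)"

definition fIm :: "(complex \<times> ball_fun tm) list \<Rightarrow> (complex \<times> ball_fun tm) list \<Rightarrow> ball_fm" where
  "fIm u v = fsum (map (\<lambda>(a, t). fsum (map (\<lambda>(b, t').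
     fadd (fmul (fconst (Re (a * cnj b))) (fdiffsq \<i> t t'))
       (fmul (fconst (Im (a * cnj b))) (fdiffsq 1 t t'))) v)) u)"

lemma arity_banach_signature [simp]:
  "farity banach_signature = ball_fun_arity" "parity banach_signature = ball_pred_arity"
  by (simp_all add: banach_signature_def)

lemma continuous_on_coordinate [continuous_intros]:
  "continuous_on UNIV (\<lambda>x :: nat \<Rightarrow> real. x i)"
  by (rule continuous_on_product_coordinates)

lemma eval_fsum [simp]: "eval M (fsum \<phi>s) s = (\<Sum>\<phi>\<leftarrow>\<phi>s. eval M \<phi> s)"
  by (induction \<phi>s) (auto simp: fsum_def)

lemma wf_fsum [simp]: "wf_fm L (fsum \<phi>s) \<longleftrightarrow> (\<forall>\<phi>\<in>set \<phi>s. wf_fm L \<phi>)"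
  by (induction \<phi>s) (auto simp: fsum_def intro!: continuous_intros)

lemma fv_fsum [simp]: "fv (fsum \<phi>s) = (\<Union>\<phi>\<in>set \<phi>s. fv \<phi>)"
  by (induction \<phi>s) (auto simp: fsum_def)

lemma eval_fdiffsq [simp]:
  "eval M (fdiffsq 1 t t') s = Re (polar M (eval_tm M t s) (eval_tm M t' s))"
  "eval M (fdiffsq \<i> t t') s = Im (polar M (eval_tm M t s) (eval_tm M t' s))"
  by (simp_all add: fdiffsq_def polar_def power2_eq_square)

lemma wf_fdiffsq [simp]:
  "wf_fm banach_signature (fdiffsq c t t') \<longleftrightarrow> wf_tm banach_signature t \<and> wf_tm banach_signature t'"
  by (auto simp: fdiffsq_def intro!: continuous_intros)

lemma fv_fdiffsq [simp]: "fv (fdiffsq c t t') = fv_tm t \<union> fv_tm t'"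
  by (auto simp: fdiffsq_def)

lemma eval_fRe: "eval M (fRe u v) s =
    Re (gform (polar M) (map (apsnd (\<lambda>t. eval_tm M t s)) u) (map (apsnd (\<lambda>t. eval_tm M t s)) v))"
  unfolding gform_map
proof (induction u)
  case (Cons p u)
  have "Re (\<Sum>(b, y)\<leftarrow>v. a * cnj b * polar M x (eval_tm M y s)) =
     (\<Sum>(b, y)\<leftarrow>v. Re (a * cnj b * polar M x (eval_tm M y s)))" for a x
    by (induction v) auto
  with Cons show ?case
    by (cases p) (simp add: fRe_def gform_def comp_def split_def)
qed (simp add: fRe_def)

lemma eval_fIm: "eval M (fIm u v) s =
    Im (gform (polar M) (map (apsnd (\<lambda>t. eval_tm M t s)) u) (map (apsnd (\<lambda>t. eval_tm M t s)) v))"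
  unfolding gform_map
proof (induction u)
  case (Cons p u)
  have "Im (\<Sum>(b, y)\<leftarrow>v. a * cnj b * polar M x (eval_tm M y s)) =
     (\<Sum>(b, y)\<leftarrow>v. Im (a * cnj b * polar M x (eval_tm M y s)))" for a x
    by (induction v) auto
  with Cons show ?case
    by (cases p) (simp add: fIm_def gform_def comp_def split_def)
qed (simp add: fIm_def)

lemma wf_fRe_fIm [simp]:
  assumes "\<forall>p\<in>set u. wf_tm banach_signature (snd p)" "\<forall>p\<in>set v. wf_tm banach_signature (snd p)"
  shows "wf_fm banach_signature (fRe u v)" "wf_fm banach_signature (fIm u v)"
proof -
  have "wf_tm banach_signature t" if "(a, t) \<in> set u" for a t using assms that by auto
  moreover have "wf_tm banach_signature t" if "(a, t) \<in> set v" for a t using assms that by auto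
  ultimately show "wf_fm banach_signature (fRe u v)" "wf_fm banach_signature (fIm u v)"
    by (auto simp: fRe_def fIm_def intro!: continuous_intros)
qed

lemma fv_fRe_fIm [simp]:
  assumes "\<forall>p\<in>set u. fv_tm (snd p) \<subseteq> X" "\<forall>p\<in>set v. fv_tm (snd p) \<subseteq> X"
  shows "fv (fRe u v) \<subseteq> X" "fv (fIm u v) \<subseteq> X"
  using assms by (fastforce simp: fRe_def fIm_def)+

text \<open>
  The clamp keeps all suprema in \<open>uclose\<close> bounded in every structure, even in one which is not yet
  known to be a model; the supremum of an unbounded set would have an arbitrary value.
\<close>

definition uclose :: "nat \<Rightarrow> ball_fm \<Rightarrow> ball_fm" where
  "uclose n \<phi> = foldr QSup [0..<n] (fclamp \<phi>)"

text \<open>The bounds belong to the induction: the upper one makes each supremum genuine, the lower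
  one turns a vanishing supremum into vanishing values.\<close>

lemma eval_foldr_QSup:
  assumes U: "universe M \<noteq> {}" and bd: "\<And>t. 0 \<le> eval M \<phi> t \<and> eval M \<phi> t \<le> 1"
  shows "0 \<le> eval M (foldr QSup is \<phi>) s \<and> eval M (foldr QSup is \<phi>) s \<le> 1
    \<and> (eval M (foldr QSup is \<phi>) s = 0 \<longleftrightarrow>
       (\<forall>t. (\<forall>i\<in>set is. t i \<in> universe M) \<and> (\<forall>i. i \<notin> set is \<longrightarrow> t i = s i) \<longrightarrow> eval M \<phi> t = 0))"
proof (induction "is" arbitrary: s)
  case Nil
  have "(\<forall>i. t i = s i) \<longleftrightarrow> t = s" for t by auto
  then show ?case using bd by auto
next
  case (Cons i "is")
  let ?f = "\<lambda>x. eval M (foldr QSup is \<phi>) (s(i := x))"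
  have f: "0 \<le> ?f x" "?f x \<le> 1" for x using Cons[of "s(i := x)"] by blast+
  have bdd: "bdd_above (?f ` universe M)" using f by (auto simp: bdd_above_def)
  have "eval M (foldr QSup (i # is) \<phi>) s = 0 \<longleftrightarrow> (\<forall>x\<in>universe M. ?f x = 0)"
  proof
    assume *: "eval M (foldr QSup (i # is) \<phi>) s = 0"
    show "\<forall>x\<in>universe M. ?f x = 0"
    proof
      fix x assume "x \<in> universe M"
      then have "?f x \<le> 0" using cSUP_upper[OF _ bdd, of x] * by simp
      then show "?f x = 0" using f[of x] by simp
    qed
  next
    assume "\<forall>x\<in>universe M. ?f x = 0"
    then have "?f ` universe M = {0}" using U by auto
    then show "eval M (foldr QSup (i # is) \<phi>) s = 0" by simp
  qed
  also have "\<dots> \<longleftrightarrow> (\<forall>t. (\<forall>j\<in>set (i # is). t j \<in> universe M) \<and> (\<forall>j. j \<notin> set (i # is) \<longrightarrow> t j = s j)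
      \<longrightarrow> eval M \<phi> t = 0)" (is "?L \<longleftrightarrow> ?R")
  proof
    assume L: ?L
    show ?R
    proof (intro allI impI)
      fix t assume t: "(\<forall>j\<in>set (i # is). t j \<in> universe M) \<and> (\<forall>j. j \<notin> set (i # is) \<longrightarrow> t j = s j)"
      then have "?f (t i) = 0" using L by auto
      then show "eval M \<phi> t = 0" using Cons[of "s(i := t i)"] t by auto
    qed
  next
    assume R: ?R
    show ?L
    proof
      fix x assume x: "x \<in> universe M"
      have "eval M \<phi> t = 0"
        if "\<forall>j\<in>set is. t j \<in> universe M" "\<forall>j. j \<notin> set is \<longrightarrow> t j = (s(i := x)) j" for t
        using that x R by (metis fun_upd_other fun_upd_same set_ConsD list.set_intros)
      then show "?f x = 0" using Cons[of "s(i := x)"] by blast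
    qed
  qed
  finally have "eval M (foldr QSup (i # is) \<phi>) s = 0 \<longleftrightarrow>
    (\<forall>t. (\<forall>j\<in>set (i # is). t j \<in> universe M) \<and> (\<forall>j. j \<notin> set (i # is) \<longrightarrow> t j = s j) \<longrightarrow> eval M \<phi> t = 0)" .
  moreover have "0 \<le> eval M (foldr QSup (i # is) \<phi>) s" "eval M (foldr QSup (i # is) \<phi>) s \<le> 1"
    using U f bdd by (auto intro: cSUP_least cSUP_upper2)
  ultimately show ?case by blast
qed

lemma eval_uclose:
  assumes "universe M \<noteq> {}"
  shows "eval M (uclose n \<phi>) s = 0 \<longleftrightarrow>
    (\<forall>t. (\<forall>i<n. t i \<in> universe M) \<and> (\<forall>i\<ge>n. t i = s i) \<longrightarrow> eval M \<phi> t = 0)"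
proof -
  have "min 1 \<bar>x\<bar> = 0 \<longleftrightarrow> x = 0" for x :: real by (auto simp: min_def)
  then show ?thesis
    using eval_foldr_QSup[of M "fclamp \<phi>" "[0..<n]" s] assms
    by (simp add: uclose_def not_less Ball_def)
qed

lemma wf_uclose: "wf_fm L \<phi> \<Longrightarrow> wf_fm L (uclose n \<phi>)"
proof -
  assume "wf_fm L \<phi>"
  then have "wf_fm L (fclamp \<phi>)" by (auto intro!: continuous_intros)
  moreover have "wf_fm L \<psi> \<Longrightarrow> wf_fm L (foldr QSup is \<psi>)" for "is" and \<psi> :: ball_fm
    by (induction "is") auto
  ultimately show ?thesis by (simp add: uclose_def)
qed

lemma fv_uclose: "fv (uclose n \<phi>) = fv \<phi> - {..<n}"
proof -
  have "fv (foldr QSup is \<psi>) = fv \<psi> - set is" for "is" and \<psi> :: ball_fm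
    by (induction "is") auto
  then show ?thesis by (auto simp: uclose_def)
qed

text \<open>Closing the clamp of \<phi> by suprema gives a sentence of the theory, so an identity
  that holds throughout the universe of \<open>H\<close> is inherited by every model.\<close>

lemma theory_transfer:
  assumes model: "model_of banach_signature (theory_of banach_signature H) M"
    and ne: "universe H \<noteq> {}"
    and wf: "wf_fm banach_signature \<phi>" "fv \<phi> \<subseteq> {..<n}"
    and H: "\<And>t. (\<And>i. i < n \<Longrightarrow> t i \<in> universe H) \<Longrightarrow> eval H \<phi> t = 0"
    and t: "\<And>i. i < n \<Longrightarrow> t i \<in> universe M"
  shows "eval M \<phi> t = 0"
proof -
  have "uclose n \<phi> \<in> theory_of banach_signature H"
    using wf H eval_uclose[OF ne] unfolding theory_of_def by (auto simp: wf_uclose fv_uclose)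
  then have "eval M (uclose n \<phi>) t = 0"
    using model by (simp add: model_of_def)
  moreover have "universe M \<noteq> {}"
    using model by (simp add: model_of_def metric_structure_def)
  ultimately show ?thesis using t by (auto simp: eval_uclose)
qed

text \<open>When the squared norms are expanded, the terms even in \<open>c\<close> cancel and
  \<open>G\<close> is left. So all Gram functions of a structure agree on its universe.\<close>

lemma (in gram_ball) polar_eq:
  assumes "x \<in> U" "y \<in> U" shows "polar M x y = G x y"
proof -
  have 1: "gform G [(1, x), (c, y)] w = gform G [(1, x)] w + c * gform G [(1, y)] w" for c w
    using gform_append_left[of G "[(1, x)]" "vscale c [(1, y)]"] by (simp only: gform_scale_left) (simp add: vscale_def)
  have 2: "gform G w [(1, x), (c, y)] = gform G w [(1, x)] + cnj c * gform G w [(1, y)]" for c w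
    using gform_append_right[of G w "[(1, x)]" "vscale c [(1, y)]"] by (simp only: gform_scale_right) (simp add: vscale_def)
  have "(pint M (NormComb [1, c]) [x, y])\<^sup>2 = Re (G x x + cnj c * G x y + c * (cnj (G x y)) + c * cnj c * G y y)" for c
  proof -
    have "(pint M (NormComb [1, c]) [x, y])\<^sup>2 = Re (gform G [(1, x), (c, y)] [(1, x), (c, y)])"
      using assms gform_pos[of "[(1, x), (c, y)]"] by (simp add: pint_eq)
    then show ?thesis unfolding 1 2 using herm[OF assms] by (simp add: algebra_simps)
  qed
  then show ?thesis by (simp add: polar_def complex_eq_iff)
qed

lemma (in gram_ball) gform_polar:
  assumes "u \<in> vecs" "v \<in> vecs" shows "gform (polar M) u v = B u v"
  using assms polar_eq by (intro gform_cong)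

lemma metric_structure_banachD:
  assumes "metric_structure banach_signature M"
  shows "universe M \<noteq> {}" "Metric_space (universe M) (mdst M)"
    "Metric_space.mcomplete (universe M) (mdst M)"
    "fint M Zero [] \<in> universe M"
    "\<lbrakk>length a = length xs; set xs \<subseteq> universe M\<rbrakk> \<Longrightarrow> fint M (Sigma a) xs \<in> universe M"
    "\<lbrakk>length a = length xs; set xs \<subseteq> universe M\<rbrakk> \<Longrightarrow>
      0 \<le> pint M (NormComb a) xs \<and> pint M (NormComb a) xs \<le> (\<Sum>c\<leftarrow>a. cmod c)"
proof -
  have f: "\<forall>F. \<forall>xs\<in>tuples (universe M) (ball_fun_arity F). fint M F xs \<in> universe M"
    and p: "\<forall>P. \<forall>xs\<in>tuples (universe M) (ball_pred_arity P). pint M P xs \<in> {0..ball_pred_bound P}"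
    using assms unfolding metric_structure_def banach_signature_def by auto
  show "fint M Zero [] \<in> universe M" using f[rule_format, of "[]" Zero] by (simp add: tuples_def)
  show "fint M (Sigma a) xs \<in> universe M" if "length a = length xs" "set xs \<subseteq> universe M"
    using f[rule_format, of xs "Sigma a"] that by (simp add: tuples_def)
  show "0 \<le> pint M (NormComb a) xs \<and> pint M (NormComb a) xs \<le> (\<Sum>c\<leftarrow>a. cmod c)"
    if "length a = length xs" "set xs \<subseteq> universe M"
    using p[rule_format, of xs "NormComb a"] that by (simp add: tuples_def)
qed (use assms in \<open>auto simp: metric_structure_def\<close>)

lemma map_apsnd_zip: "map (apsnd f) (zip a xs) = zip a (map f xs)"
  by (induction a xs rule: list_induct2') auto

lemma map_Var_assign:
  assumes "set xs \<subseteq> X"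
  obtains t where "\<And>i. i < length xs \<Longrightarrow> t i \<in> X" "map t [0..<length xs] = xs"
  using that[of "\<lambda>i. xs ! i"] assms by (simp add: map_nth subset_code(1))

text \<open>The identities among the axioms are transferred from \<open>H\<close>, where needed
  split into real and imaginary part; metric, completeness and closure under the functions are part
  of being a metric structure.\<close>

lemma hilbert_ball_polar:
  fixes H :: "(ball_fun, ball_pred, 'h) mstruct" and M :: "(ball_fun, ball_pred, 'm) mstruct"
  assumes H: "gram_ball H GH" and model: "model_of banach_signature (theory_of banach_signature H) M"
  shows "hilbert_ball M (polar M)"
proof -
  interpret H: gram_ball H GH by (rule H)
  have ms: "metric_structure banach_signature M" using model by (simp add: model_of_def)
  note D = metric_structure_banachD[OF ms]
  have ne: "universe H \<noteq> {}" using H.zero_in by auto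
  note transfer = theory_transfer[OF model ne]
  interpret Metric_space "universe M" "mdst M" by (rule D)
  let ?L = banach_signature
  let ?V = "\<lambda>n. map Var [0..<n] :: ball_fun tm list"
  have zipV: "map (apsnd (\<lambda>t. eval_tm K t s)) (zip a (?V (length a))) = zip a (map s [0..<length a])"
    for K :: "(ball_fun, ball_pred, 'k) mstruct" and s a
    by (simp add: map_apsnd_zip comp_def)
  have wfV: "wf_tm ?L t \<and> fv_tm t \<subseteq> {..<n}" if "t \<in> set (?V n)" for t n
    using that by auto
  have herm: "polar M y x = cnj (polar M x y)" if "x \<in> universe M" "y \<in> universe M" for x y
  proof -
    let ?s = "\<lambda>i. if i = 0 then x else y"
    have "eval M (fsub (fdiffsq 1 (Var 0) (Var 1)) (fdiffsq 1 (Var 1) (Var 0))) ?s = 0"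
    proof (rule transfer[where n = 2])
      fix t :: "nat \<Rightarrow> 'h" assume "\<And>i. i < 2 \<Longrightarrow> t i \<in> universe H"
      then show "eval H (fsub (fdiffsq 1 (Var 0) (Var 1)) (fdiffsq 1 (Var 1) (Var 0))) t = 0"
        using H.herm[of "t 0" "t 1"] by (simp add: H.polar_eq)
    qed (use that in \<open>auto intro!: continuous_intros\<close>)
    moreover have "eval M (fadd (fdiffsq \<i> (Var 0) (Var 1)) (fdiffsq \<i> (Var 1) (Var 0))) ?s = 0"
    proof (rule transfer[where n = 2])
      fix t :: "nat \<Rightarrow> 'h" assume "\<And>i. i < 2 \<Longrightarrow> t i \<in> universe H"
      then show "eval H (fadd (fdiffsq \<i> (Var 0) (Var 1)) (fdiffsq \<i> (Var 1) (Var 0))) t = 0"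
        using H.herm[of "t 0" "t 1"] by (simp add: H.polar_eq)
    qed (use that in \<open>auto intro!: continuous_intros\<close>)
    ultimately show ?thesis by (simp add: complex_eq_iff)
  qed
  have dist: "mdst M x y = pint M (NormComb [1, -1]) [x, y]" if "x \<in> universe M" "y \<in> universe M" for x y
  proof -
    have "eval M (fsub (Dist (Var 0) (Var 1)) (Pred (NormComb [1, -1]) [Var 0, Var 1])) (\<lambda>i. if i = 0 then x else y) = 0"
      by (rule transfer[where n = 2])
        (use that in \<open>auto simp: H.mdst_eq intro!: continuous_intros\<close>)
    then show ?thesis by simp
  qed
  have norm_sq: "(pint M (NormComb a) xs)\<^sup>2 = Re (gform (polar M) (zip a xs) (zip a xs))"
    if xs: "length a = length xs" "set xs \<subseteq> universe M" for a xs
  proof -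
    let ?n = "length a"
    define \<phi> where "\<phi> = fsub (fmul (Pred (NormComb a) (?V ?n)) (Pred (NormComb a) (?V ?n)))
      (fRe (zip a (?V ?n)) (zip a (?V ?n)))"
    have ev: "eval K \<phi> s = (pint K (NormComb a) (map s [0..<?n]))\<^sup>2
        - Re (gform (polar K) (zip a (map s [0..<?n])) (zip a (map s [0..<?n])))"
      for K :: "(ball_fun, ball_pred, 'k) mstruct" and s
      by (simp add: \<phi>_def eval_fRe zipV comp_def power2_eq_square)
    obtain t where t: "\<And>i. i < ?n \<Longrightarrow> t i \<in> universe M" "map t [0..<?n] = xs"
      using map_Var_assign[OF xs(2)] xs(1) by metis
    have "eval M \<phi> t = 0"
    proof (rule transfer[where n = ?n])
      show "wf_fm ?L \<phi>" unfolding \<phi>_def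
        by (auto intro!: continuous_intros wf_fRe_fIm dest!: set_zip_rightD)
      show "fv \<phi> \<subseteq> {..<?n}" unfolding \<phi>_def
        using fv_fRe_fIm(1)[of "zip a (?V ?n)" "{..<?n}" "zip a (?V ?n)"] by (fastforce dest!: set_zip_rightD)
      fix s assume "\<And>i. i < ?n \<Longrightarrow> s i \<in> universe H"
      then have "set (map s [0..<?n]) \<subseteq> universe H" by auto
      then show "eval H \<phi> s = 0"
        using H.gform_pos[of "zip a (map s [0..<?n])"] by (simp add: ev H.gform_polar H.pint_eq)
    qed (use t in auto)
    then show ?thesis using t by (simp add: ev)
  qed
  have sigma: "polar M (fint M (Sigma a) xs) y * max 1 (pint M (NormComb a) xs) = gform (polar M) (zip a xs) [(1, y)]"
    if xs: "length a = length xs" "set xs \<subseteq> universe M" and y: "y \<in> universe M" for a xs y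
  proof -
    let ?n = "length a"
    let ?S = "App (Sigma a) (?V ?n)"
    \<comment> \<open>Variables below \<open>?n\<close> hold \<open>xs\<close> and variable
      \<open>?n\<close> holds \<open>y\<close>; \<open>F\<close> and \<open>F'\<close> choose
      between real and imaginary part.\<close>
    define \<phi> where "\<phi> F F' = fsub (fmul (F ?S (Var ?n)) (fmax1 (Pred (NormComb a) (?V ?n))))
      (F' (zip a (?V ?n)) [(1, Var ?n)])" for F :: "_ \<Rightarrow> ball_fun tm \<Rightarrow> ball_fm" and F' :: "_ \<Rightarrow> (complex \<times> ball_fun tm) list \<Rightarrow> ball_fm"
    let ?\<phi>r = "\<phi> (fdiffsq 1) fRe" and ?\<phi>i = "\<phi> (fdiffsq \<i>) fIm"
    have ev: "eval K ?\<phi>r s = Re (polar K (fint K (Sigma a) (map s [0..<?n])) (s ?n)) * max 1 (pint K (NormComb a) (map s [0..<?n]))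
        - Re (gform (polar K) (zip a (map s [0..<?n])) [(1, s ?n)])"
      "eval K ?\<phi>i s = Im (polar K (fint K (Sigma a) (map s [0..<?n])) (s ?n)) * max 1 (pint K (NormComb a) (map s [0..<?n]))
        - Im (gform (polar K) (zip a (map s [0..<?n])) [(1, s ?n)])"
      for K :: "(ball_fun, ball_pred, 'k) mstruct" and s
      by (simp_all add: \<phi>_def eval_fRe eval_fIm zipV comp_def)
    have wfS: "wf_tm ?L ?S" "fv_tm ?S \<subseteq> {..<Suc ?n}"
      by auto
    have wf: "wf_fm ?L ?\<phi>r" "wf_fm ?L ?\<phi>i" unfolding \<phi>_def using wfS(1)
      by (auto intro!: continuous_intros wf_fRe_fIm
          dest!: set_zip_rightD simp del: wf_tm.simps(2)) 
    have fv: "fv ?\<phi>r \<subseteq> {..<Suc ?n}" "fv ?\<phi>i \<subseteq> {..<Suc ?n}" unfolding \<phi>_def using wfS(2)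
        fv_fRe_fIm[of "zip a (?V ?n)" "{..<Suc ?n}" "[(1, Var ?n)]"] by (fastforce dest!: set_zip_rightD)+
    obtain t where t: "\<And>i. i < Suc ?n \<Longrightarrow> t i \<in> universe M" "map t [0..<Suc ?n] = xs @ [y]"
      using map_Var_assign[of "xs @ [y]" "universe M"] xs y by (metis length_append_singleton empty_set
        insert_subset le_sup_iff empty_subsetI list.simps(15) set_append)
    then have t': "map t [0..<?n] = xs" "t ?n = y" by auto
    have z: "Re (polar H (fint H (Sigma a) (map s [0..<?n])) (s ?n) * max 1 (pint H (NormComb a) (map s [0..<?n])))
        = Re (gform (polar H) (zip a (map s [0..<?n])) [(1, s ?n)])"
      "Im (polar H (fint H (Sigma a) (map s [0..<?n])) (s ?n) * max 1 (pint H (NormComb a) (map s [0..<?n])))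
        = Im (gform (polar H) (zip a (map s [0..<?n])) [(1, s ?n)])"
      if "\<And>i. i < Suc ?n \<Longrightarrow> s i \<in> universe H" for s
    proof -
      have s: "set (map s [0..<?n]) \<subseteq> universe H" "s ?n \<in> universe H" using that by auto
      have "polar H (fint H (Sigma a) (map s [0..<?n])) (s ?n) * max 1 (pint H (NormComb a) (map s [0..<?n]))
        = gform (polar H) (zip a (map s [0..<?n])) [(1, s ?n)]"
        using H.G_sigma[of a "map s [0..<?n]" "s ?n"] H.sigma_in[of a "map s [0..<?n]"] s
        by (simp add: H.gform_polar H.polar_eq del: set_map)
      then show "Re (polar H (fint H (Sigma a) (map s [0..<?n])) (s ?n) * max 1 (pint H (NormComb a) (map s [0..<?n])))
        = Re (gform (polar H) (zip a (map s [0..<?n])) [(1, s ?n)])"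
      "Im (polar H (fint H (Sigma a) (map s [0..<?n])) (s ?n) * max 1 (pint H (NormComb a) (map s [0..<?n])))
        = Im (gform (polar H) (zip a (map s [0..<?n])) [(1, s ?n)])" by simp_all
    qed
    have "eval M ?\<phi>r t = 0"
      by (rule transfer[OF wf(1) fv(1) _ t(1)]) (use z in \<open>simp_all add: ev\<close>)
    moreover have "eval M ?\<phi>i t = 0"
      by (rule transfer[OF wf(2) fv(2) _ t(1)]) (use z in \<open>simp_all add: ev\<close>)
    ultimately show ?thesis by (simp add: ev t' complex_eq_iff)
  qed
  have zero: "polar M (fint M Zero []) y = 0" if "y \<in> universe M" for y
  proof -
    have "eval M (fdiffsq 1 (App Zero []) (Var 0)) (\<lambda>i. y) = 0"
      by (rule transfer[where n = 1]) (use that H.zero_in in \<open>auto simp: H.polar_eq H.G_zero\<close>)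
    moreover have "eval M (fdiffsq \<i> (App Zero []) (Var 0)) (\<lambda>i. y) = 0"
      by (rule transfer[where n = 1]) (use that H.zero_in in \<open>auto simp: H.polar_eq H.G_zero\<close>)
    ultimately show ?thesis by (simp add: complex_eq_iff)
  qed
  \<comment> \<open>By \<open>norm_sq\<close> the form is the square of a norm predicate, so
    positivity requires no further sentence.\<close>
  have pos: "0 \<le> Re (gform (polar M) u u)" if "u \<in> lists (UNIV \<times> universe M)" for u
  proof -
    have "u = zip (map fst u) (map snd u)" "set (map snd u) \<subseteq> universe M"
      using that by (auto simp: zip_map_fst_snd)
    then show ?thesis
      using norm_sq[of "map fst u" "map snd u"] by (metis length_map zero_le_power2)
  qed
  \<comment> \<open>The unit bound comes from the range that the signature prescribes for
    \<open>NormComb [1]\<close>.\<close>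
  have le1: "Re (polar M x x) \<le> 1" if "x \<in> universe M" for x
  proof -
    have "0 \<le> pint M (NormComb [1]) [x] \<and> pint M (NormComb [1]) [x] \<le> 1"
      using D(6)[of "[1]" "[x]"] that by simp
    then have "(pint M (NormComb [1]) [x])\<^sup>2 \<le> 1" by (simp add: power_le_one)
    then show ?thesis using norm_sq[of "[1]" "[x]"] that by simp
  qed
  show ?thesis
  proof
    show "pint M (NormComb a) xs = sqrt (Re (gform (polar M) (zip a xs) (zip a xs)))"
      if "length a = length xs" "set xs \<subseteq> universe M" for a xs
      using norm_sq[OF that] D(6)[OF that] by (metis real_sqrt_unique)
    show "x = y" if "x \<in> universe M" "y \<in> universe M" "mdst M x y = 0" for x y
      using that by simp
    show "mcomplete" by (rule D)
    show "mdst M x y = mdst M y x" for x y by (rule commute)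
  qed ((rule herm pos dist nonneg D(4,5) le1 zero sigma; assumption)+)
qed

text \<open>Sentences constrain no variable, so back-and-forth identifies their values in
  \<open>M\<close> and \<open>H\<close>, whatever the assignments.\<close>

lemma model_of_theory_of:
  fixes H :: "(ball_fun, ball_pred, 'h) mstruct" and M :: "(ball_fun, ball_pred, 'm) mstruct"
  assumes "hilbert_ball M G" "gram_ball.inf_dim M G" "gram_ball H GH" "gram_ball.inf_dim H GH"
  shows "model_of banach_signature (theory_of banach_signature H) M"
proof -
  interpret hilbert_ball M G by fact
  interpret H: gram_ball H GH by fact
  have "eval M \<phi> s = 0" if "\<phi> \<in> theory_of banach_signature H" for \<phi> s
  proof -
    have "gram_pair M G H GH (fv \<phi>) s (\<lambda>_. fint H Zero [])"
      by unfold_locales (use that in \<open>auto simp: theory_of_def\<close>)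
    then have "eval M \<phi> s = eval H \<phi> (\<lambda>_. fint H Zero [])"
      using assms that by (intro eval_eq_of_same_gram) (auto simp: theory_of_def)
    then show ?thesis using that by (simp add: theory_of_def)
  qed
  then show ?thesis using metric_structure_ball complete by (simp add: model_of_def)
qed

section \<open>The unit ball of a Hilbert space\<close>

lemma cinner_add_right: "cinner z (x + y) = cinner z x + cinner z (y :: 'a::complex_hilbert)"
  by (subst (1 2 3) cinner_commute) (simp add: cinner_add_left)

lemma cinner_scaleC_right: "cinner x (a *\<^sub>C y) = cnj a * cinner x (y :: 'a::complex_hilbert)"
  by (subst (1 2) cinner_commute) (simp add: cinner_scaleC_left)

lemma cinner_zero_left [simp]: "cinner 0 (y :: 'a::complex_hilbert) = 0"
  using cinner_add_left[of 0 0 y] by simp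

lemma cinner_zero_right [simp]: "cinner (y :: 'a::complex_hilbert) 0 = 0"
  using cinner_add_right[of y 0 0] by simp

lemma gform_cinner:
  "gform cinner u v = cinner (\<Sum>(a, x)\<leftarrow>u. a *\<^sub>C x) (\<Sum>(b, y)\<leftarrow>v. b *\<^sub>C (y :: 'a::complex_hilbert))"
proof (induction u)
  case (Cons p u)
  obtain a x where p: "p = (a, x)" by force
  have "gform cinner [(a, x)] v = cinner (a *\<^sub>C x) (\<Sum>(b, y)\<leftarrow>v. b *\<^sub>C y)"
    by (induction v) (auto simp: gform_def cinner_add_right cinner_scaleC_right cinner_scaleC_left algebra_simps)
  then show ?case
    using Cons gform_append_left[of cinner "[p]" u v] by (simp add: p cinner_add_left)
qed simp

lemma lincomb_zip: "lincomb a xs = (\<Sum>(a, x)\<leftarrow>zip a xs. a *\<^sub>C x)"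
  by (simp add: lincomb_def)

lemma scaleC_one [simp]: "(1 :: complex) *\<^sub>C (x :: 'a::complex_banach) = x"
  using scaleC_of_real[of 1 x] by simp

lemma scaleC_minus_one [simp]: "(-1 :: complex) *\<^sub>C (x :: 'a::complex_banach) = - x"
  using scaleC_of_real[of "-1" x] by simp

lemma norm_ball_retract: "norm (ball_retract v) \<le> 1"
  by (auto simp: ball_retract_def field_simps)

lemma ball_retract_eq: "ball_retract v = (1 / max 1 (norm v)) *\<^sub>R v"
  by (auto simp: ball_retract_def max_def inverse_eq_divide)

lemma gram_ball_unit_ball: "gram_ball (unit_ball TYPE('a::complex_hilbert)) cinner"
proof
  fix x y :: 'a
  show "cinner y x = cnj (cinner x y)" by (rule cinner_commute)
next
  fix u :: "(complex \<times> 'a) list"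
  show "0 \<le> Re (gform cinner u u)" by (simp add: gform_cinner cinner_self)
next
  fix a and xs :: "'a list"
  show "pint (unit_ball TYPE('a)) (NormComb a) xs = sqrt (Re (gform cinner (zip a xs) (zip a xs)))"
    by (simp add: unit_ball_def gform_cinner cinner_self lincomb_zip)
next
  fix a and xs :: "'a list" and y
  show "cinner (fint (unit_ball TYPE('a)) (Sigma a) xs) y *
      complex_of_real (max 1 (pint (unit_ball TYPE('a)) (NormComb a) xs)) = gform cinner (zip a xs) [(1, y)]"
  proof -
    define v where "v = lincomb a xs"
    define m where "m = max 1 (norm v)"
    have "1 \<le> m" by (simp add: m_def)
    have "cinner (ball_retract v) y = of_real (1 / m) * cinner v y"
      by (simp only: ball_retract_eq m_def scaleC_of_real[symmetric] cinner_scaleC_left)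
    then have "cinner (ball_retract v) y * of_real m = cinner v y"
      using \<open>1 \<le> m\<close> by simp
    then show ?thesis by (simp only: unit_ball_def gform_cinner lincomb_zip[symmetric])
      (simp add: m_def v_def lincomb_def)
  qed
next
  fix x :: 'a assume "x \<in> universe (unit_ball TYPE('a))"
  then show "Re (cinner x x) \<le> 1" by (simp add: unit_ball_def cinner_self power_le_one)
qed (auto simp: unit_ball_def lincomb_def dist_norm norm_ball_retract dist_commute norm_minus_commute)

section \<open>Orthonormal bases\<close>

text \<open>Preservation of \<open>G\<close> forces compatibility with \<open>Zero\<close> and
  \<open>Sigma\<close>: both candidates for a value have the same pairings with all points of
  \<open>M'\<close>, since each of these is some \<open>h y\<close>.\<close>

lemma isomorphismI:
  fixes M :: "(ball_fun, ball_pred, 'm) mstruct" and M' :: "(ball_fun, ball_pred, 'n) mstruct"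
  assumes "gram_ball M G" "gram_ball M' G'" and bij: "bij_betw h (universe M) (universe M')"
    and pres: "\<And>x y. \<lbrakk>x \<in> universe M; y \<in> universe M\<rbrakk> \<Longrightarrow> G' (h x) (h y) = G x y"
  shows "isomorphism banach_signature M M' h"
proof -
  interpret A: gram_ball M G by fact
  interpret A': gram_ball M' G' by fact
  have h: "h x \<in> universe M'" if "x \<in> universe M" for x
    using bij that by (rule bij_betw_apply)
  then have hs: "set (map h xs) \<subseteq> universe M'" if "set xs \<subseteq> universe M" for xs
    using that by auto
  have gf: "gform G' (zip a (map h xs)) (zip b (map h ys)) = gform G (zip a xs) (zip b ys)"
    if "set xs \<subseteq> universe M" "set ys \<subseteq> universe M" for a b xs ys
    unfolding map_apsnd_zip[symmetric] gform_map
    by (rule gform_cong[where X = "universe M"]) (use that pres in \<open>auto dest: set_zip_rightD\<close>)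
  have p: "pint M' (NormComb a) (map h xs) = pint M (NormComb a) xs"
    if "length a = length xs" "set xs \<subseteq> universe M" for a xs
    using that hs[OF that(2)] gf by (simp add: A.pint_eq A'.pint_eq del: set_map)
  have d: "mdst M' (h x) (h y) = mdst M x y" if "x \<in> universe M" "y \<in> universe M" for x y
    using p[of "[1, -1]" "[x, y]"] that h by (simp add: A.mdst_eq A'.mdst_eq)
  have surj: "\<exists>y\<in>universe M. z = h y" if "z \<in> universe M'" for z
    using bij that by (auto simp: bij_betw_def)
  have f: "fint M' F (map h xs) = h (fint M F xs)" if xs: "xs \<in> tuples (universe M) (ball_fun_arity F)" for F xs
  proof (cases F)
    case Zero
    then have "xs = []" using xs by (simp add: tuples_def)
    moreover have "fint M' Zero [] = h (fint M Zero [])"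
    proof (rule A'.point_eqI)
      fix z assume z: "z \<in> universe M'"
      then obtain y where "y \<in> universe M" "z = h y" using surj by blast
      then show "G' (fint M' Zero []) z = G' (h (fint M Zero [])) z"
        using A'.G_zero[OF z] A.G_zero[of y] pres A.zero_in by simp
    qed (use A'.zero_in A.zero_in h in auto)
    ultimately show ?thesis by (simp add: Zero)
  next
    case (Sigma a)
    then have l: "length a = length xs" "set xs \<subseteq> universe M" using xs by (auto simp: tuples_def)
    have "fint M' (Sigma a) (map h xs) = h (fint M (Sigma a) xs)"
    proof (rule A'.point_eqI)
      fix z assume z: "z \<in> universe M'"
      then obtain y where y: "y \<in> universe M" "z = h y" using surj by blast
      have "G' (fint M' (Sigma a) (map h xs)) z = G (fint M (Sigma a) xs) y"
        using l hs[OF l(2)] y z gf[of xs "[y]" a "[1]"] gf[of xs xs a a]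
        by (simp add: A.G_sigma' A'.G_sigma' A.vnorm_def A'.vnorm_def del: set_map)
      then show "G' (fint M' (Sigma a) (map h xs)) z = G' (h (fint M (Sigma a) xs)) z"
        using pres A.sigma_in[OF l] y by simp
    qed (use l hs[OF l(2)] A'.sigma_in A.sigma_in h in \<open>auto simp del: set_map\<close>)
    then show ?thesis by (simp add: Sigma)
  qed
  show ?thesis
    unfolding isomorphism_def
  proof (intro conjI ballI allI)
    fix P xs assume "xs \<in> tuples (universe M) (parity banach_signature P)"
    then show "pint M' P (map h xs) = pint M P xs"
      using p by (cases P) (auto simp: tuples_def)
  qed (use bij d f in auto)
qed

definition enum_list :: "'m set \<Rightarrow> 'm list" where
  "enum_list F = (SOME l. set l = F \<and> distinct l)"

lemma enum_list: "finite F \<Longrightarrow> set (enum_list F) = F \<and> distinct (enum_list F)"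
  unfolding enum_list_def by (rule someI_ex) (rule finite_distinct_list)

text \<open>The order chosen by \<open>enum_list\<close> is immaterial: pairings become sums over
  the set \<open>F\<close>.\<close>

definition comb :: "('m \<Rightarrow> complex) \<Rightarrow> 'm set \<Rightarrow> (complex \<times> 'm) list" where
  "comb f F = map (\<lambda>e. (f e, e)) (enum_list F)"

lemma gform_comb_left: "finite F \<Longrightarrow> gform G (comb f F) v = (\<Sum>e\<in>F. f e * gform G [(1, e)] v)"
  using enum_list[of F] by (subst gform_left_sum) (simp add: comb_def comp_def sum_list_distinct_conv_sum_set)

lemma gform_comb_right: "finite F \<Longrightarrow> gform G u (comb f F) = (\<Sum>e\<in>F. cnj (f e) * gform G u [(1, e)])"
  using enum_list[of F] by (subst gform_right_sum) (simp add: comb_def comp_def sum_list_distinct_conv_sum_set)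

lemma comb_lists: "finite F \<Longrightarrow> f ` F \<subseteq> Q \<Longrightarrow> F \<subseteq> E \<Longrightarrow> comb f F \<in> lists (Q \<times> E)"
  using enum_list[of F] by (auto simp: comb_def image_subset_iff)

section \<open>Maximal orthonormal sets and Bessel's inequality\<close>

context gram_ball
begin

definition orthonormal :: "'m set \<Rightarrow> bool" where
  "orthonormal E \<longleftrightarrow> E \<subseteq> U \<and> (\<forall>e\<in>E. \<forall>f\<in>E. G e f = (if e = f then 1 else 0))"

text \<open>Maximality, which Zorn's lemma provides, replaces density of the span; completeness
  gives density back in \<open>basis_approx\<close>.\<close>

definition orthonormal_basis :: "'m set \<Rightarrow> bool" where
  "orthonormal_basis E \<longleftrightarrow> orthonormal E \<and> \<not> (\<exists>x\<in>U. G x x = 1 \<and> (\<forall>e\<in>E. G x e = 0))"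

lemma ex_orthonormal_basis: "\<exists>E. orthonormal_basis E"
proof -
  have "\<exists>E\<in>Collect orthonormal. \<forall>X\<in>Collect orthonormal. E \<subseteq> X \<longrightarrow> X = E"
  proof (rule subset_Zorn')
    fix C assume C: "subset.chain (Collect orthonormal) C"
    have "G e f = (if e = f then 1 else 0)" if ef: "e \<in> \<Union>C" "f \<in> \<Union>C" for e f
    proof -
      obtain X Y where "X \<in> C" "e \<in> X" "Y \<in> C" "f \<in> Y" using ef by auto
      moreover have "X \<subseteq> Y \<or> Y \<subseteq> X" using C calculation by (auto simp: subset.chain_def)
      ultimately obtain Z where "Z \<in> C" "e \<in> Z" "f \<in> Z" by blast
      then have "orthonormal Z" using C by (auto simp: subset.chain_def)
      then show ?thesis using \<open>e \<in> Z\<close> \<open>f \<in> Z\<close> by (auto simp: orthonormal_def)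
    qed
    then show "\<Union>C \<in> Collect orthonormal"
      using C by (fastforce simp: orthonormal_def subset.chain_def)
  qed
  then obtain E where E: "orthonormal E" "\<And>X. orthonormal X \<Longrightarrow> E \<subseteq> X \<Longrightarrow> X = E" by auto
  have False if x: "x \<in> U" "G x x = 1" "\<And>e. e \<in> E \<Longrightarrow> G x e = 0" for x
  proof -
    have "G e x = 0" if "e \<in> E" for e
      using herm[of x e] x that E(1) by (auto simp: orthonormal_def)
    then have "orthonormal (insert x E)"
      using E(1) x by (auto simp: orthonormal_def)
    then have "x \<in> E" using E(2) by blast
    then show False using x(2) x(3)[of x] by simp
  qed
  then show ?thesis using E(1) unfolding orthonormal_basis_def by blast
qed

lemma comb_vecs [simp]: "finite F \<Longrightarrow> F \<subseteq> U \<Longrightarrow> comb f F \<in> vecs"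
  by (rule comb_lists) auto

lemma vnorm_sq: "u \<in> vecs \<Longrightarrow> (vnorm u)\<^sup>2 = Re (B u u)"
  using gform_pos by (simp add: vnorm_def)

lemma vnorm_le_iff: "u \<in> vecs \<Longrightarrow> 0 \<le> c \<Longrightarrow> vnorm u \<le> c \<longleftrightarrow> Re (B u u) \<le> c\<^sup>2"
  using vnorm_sq[of u] abs_le_square_iff[of "vnorm u" c] by simp

context
  fixes E assumes E: "orthonormal E"
begin

lemma E_U: "E \<subseteq> U"
  using E by (simp add: orthonormal_def)

lemma gform_comb_point:
  assumes "finite F" "F \<subseteq> E" "e \<in> E"
  shows "B (comb f F) [(1, e)] = (if e \<in> F then f e else 0)"
proof -
  have "B (comb f F) [(1, e)] = (\<Sum>e'\<in>F. if e' = e then f e' else 0)"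
    unfolding gform_comb_left[OF assms(1)]
    by (rule sum.cong) (use E assms in \<open>auto simp: orthonormal_def\<close>)
  then show ?thesis using assms(1) by simp
qed

lemma gform_comb_comb:
  assumes "finite F" "F \<subseteq> E" "finite F'" "F' \<subseteq> E"
  shows "B (comb f F) (comb g F') = (\<Sum>e\<in>F \<inter> F'. f e * cnj (g e))"
proof -
  have "B (comb f F) (comb g F') = (\<Sum>e\<in>F'. if e \<in> F then cnj (g e) * f e else 0)"
    unfolding gform_comb_right[OF assms(3)]
    by (rule sum.cong) (use assms in \<open>auto simp: gform_comb_point subsetD\<close>)
  also have "\<dots> = (\<Sum>e\<in>F' \<inter> F. cnj (g e) * f e)"
    using assms(3) by (rule sum.inter_restrict[symmetric])
  finally show ?thesis by (simp add: mult.commute Int_commute)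
qed

lemma gform_comb_self:
  assumes "finite F" "F \<subseteq> E"
  shows "B (comb f F) (comb f F) = of_real (\<Sum>e\<in>F. (cmod (f e))\<^sup>2)"
  using gform_comb_comb[OF assms assms] by (simp add: complex_norm_square del: of_real_power)

text \<open>Pythagoras for \<open>x\<close> and a finite Fourier sum; Bessel's inequality and, in
  \<open>basis_approx\<close>, monotonicity in \<open>F\<close> are read off from it.\<close>

lemma vnorm_diff_comb_point:
  assumes x: "x \<in> U" and F: "finite F" "F \<subseteq> E"
  shows "(vnorm (vdiff [(1, x)] (comb (G x) F)))\<^sup>2 = Re (G x x) - (\<Sum>e\<in>F. (cmod (G x e))\<^sup>2)"
proof -
  have v: "comb (G x) F \<in> vecs" using F E_U by auto
  have "B [(1, x)] (comb (G x) F) = of_real (\<Sum>e\<in>F. (cmod (G x e))\<^sup>2)"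
    unfolding gform_comb_right[OF F(1)] by (simp add: complex_norm_square mult.commute del: of_real_power)
  moreover from this have "B (comb (G x) F) [(1, x)] = of_real (\<Sum>e\<in>F. (cmod (G x e))\<^sup>2)"
    using gform_herm[of "[(1, x)]" "comb (G x) F"] x v by simp
  ultimately show ?thesis
    using x v gform_comb_self[OF F, of "G x"] by (simp add: vnorm_sq)
qed

lemma bessel:
  assumes "x \<in> U" "finite F" "F \<subseteq> E" shows "(\<Sum>e\<in>F. (cmod (G x e))\<^sup>2) \<le> Re (G x x)"
  using vnorm_diff_comb_point[OF assms] zero_le_power2[of "vnorm (vdiff [(1, x)] (comb (G x) F))"] by linarith

end

end

section \<open>Riesz-Fischer and Parseval\<close>

context hilbert_ball
begin

text \<open>Riesz-Fischer. The bound 1 keeps the partial sums in the ball, where points realize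
  them, and \<open>p\<close> is a limit of such points. The last conclusion records that finite
  combinations approximate \<open>p\<close>; \<open>basis_approx\<close> draws totality from
  it.\<close>

lemma synthesis:
  assumes E: "orthonormal E"
    and bd: "\<And>F. finite F \<Longrightarrow> F \<subseteq> E \<Longrightarrow> (\<Sum>e\<in>F. (cmod (f e))\<^sup>2) \<le> 1"
  obtains p where "p \<in> U" "\<And>e. e \<in> E \<Longrightarrow> G p e = f e"
    "\<And>\<epsilon>. 0 < \<epsilon> \<Longrightarrow> \<exists>F. finite F \<and> F \<subseteq> E \<and> vnorm (vdiff [(1, p)] (comb f F)) < \<epsilon>"
proof -
  note EU = E_U[OF E]
  define a where "a e = (cmod (f e))\<^sup>2" for e
  have "a summable_on E"
    using bd by (intro nonneg_bdd_above_summable_on) (auto simp: a_def bdd_above_def)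
  then obtain S where S: "(a has_sum S) E" by (auto simp: summable_on_def)
  have le: "sum a F \<le> S" if "finite F" "F \<subseteq> E" for F
    using finite_sum_le_has_sum[OF S that] by (simp add: a_def)
  \<comment> \<open>The sets obtained here need not increase with \<open>n\<close>, so two of them
    are compared below through their union, whose sum is also at most \<open>S\<close>.\<close>
  have "\<exists>F. finite F \<and> F \<subseteq> E \<and> S - sum a F < 1 / real (Suc n)" for n
  proof -
    have "eventually (\<lambda>F. dist (sum a F) S < 1 / real (Suc n)) (finite_subsets_at_top E)"
      using S unfolding has_sum_def tendsto_iff by simp
    then obtain F where "finite F" "F \<subseteq> E" "dist (sum a F) S < 1 / real (Suc n)"
      unfolding eventually_finite_subsets_at_top by blast
    then show ?thesis using le[of F] by (auto simp: dist_real_def)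
  qed
  then obtain F where F: "\<And>n. finite (F n)" "\<And>n. F n \<subseteq> E" "\<And>n. S - sum a (F n) < 1 / real (Suc n)"
    by metis
  have Fv: "comb f (F n) \<in> vecs" for n by (rule comb_vecs) (use F(1,2)[of n] EU in auto)
  have nrm: "vnorm (comb f (F n)) \<le> 1" for n
    using bd[of "F n"] F gform_comb_self[OF E F(1) F(2)] Fv by (simp add: vnorm_le_iff)
  have "\<exists>y. y \<in> U \<and> (\<forall>z\<in>U. G y z = B (comb f (F n)) [(1, z)])" for n
    using realize[OF Fv nrm] by metis
  then obtain y where y: "\<And>n. y n \<in> U" "\<And>n z. z \<in> U \<Longrightarrow> G (y n) z = B (comb f (F n)) [(1, z)]"
    by metis
  have dist_y: "mdst M (y n) (y m) = vnorm (vdiff (comb f (F n)) (comb f (F m)))" for n m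
    using y Fv by (intro mdst_as_vnorm) auto
  have near: "(vnorm (vdiff (comb f (F n)) (comb f (F n \<union> F m))))\<^sup>2 < 1 / real (Suc n)" for n m
  proof -
    have 1: "finite (F n \<union> F m)" "F n \<union> F m \<subseteq> E" using F by auto
    have v: "comb f (F n \<union> F m) \<in> vecs" by (rule comb_vecs) (use 1 EU in auto)
    have "B (vdiff (comb f (F n)) (comb f (F n \<union> F m))) (vdiff (comb f (F n)) (comb f (F n \<union> F m)))
      = of_real (sum a (F n) - sum a (F n) - sum a (F n) + sum a (F n \<union> F m))"
      using F 1 by (simp add: gform_comb_comb[OF E] complex_norm_square[symmetric] a_def Int_absorb1 Int_absorb2)
    then show ?thesis using F(3)[of n] le[OF 1] v Fv by (simp add: vnorm_sq)
  qed
  \<comment> \<open>The threshold \<open>4 / \<epsilon>\<^sup>2\<close> makes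
    \<open>1 / (n + 1) \<le> (\<epsilon> / 2)\<^sup>2\<close>, which leaves
    \<open>\<epsilon> / 2\<close> for each of the two steps through the union.\<close>
  have cauchy: "mdst M (y n) (y m) < \<epsilon>" if "0 < \<epsilon>" "4 / \<epsilon>\<^sup>2 \<le> real n" "4 / \<epsilon>\<^sup>2 \<le> real m" for \<epsilon> n m
  proof -
    have half: "vnorm (vdiff (comb f (F n)) (comb f (F n \<union> F m))) < \<epsilon> / 2" if "4 / \<epsilon>\<^sup>2 \<le> real n" for n m
    proof -
      have "1 / real (Suc n) \<le> (\<epsilon> / 2)\<^sup>2"
        using that \<open>0 < \<epsilon>\<close> by (simp add: field_simps power2_eq_square add_increasing)
      then show ?thesis
        using near[of n m] \<open>0 < \<epsilon>\<close> by (intro power2_less_imp_less[of _ "\<epsilon> / 2"]) auto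
    qed
    have v: "comb f (F n \<union> F m) \<in> vecs"
      by (rule comb_vecs) (use F(1,2)[of n] F(1,2)[of m] EU in auto)
    have "mdst M (y n) (y m) \<le> vnorm (vdiff (comb f (F n)) (comb f (F n \<union> F m)))
        + vnorm (vdiff (comb f (F n \<union> F m)) (comb f (F m)))"
      unfolding dist_y using Fv v by (intro vnorm_triangle)
    also have "vnorm (vdiff (comb f (F n \<union> F m)) (comb f (F m))) = vnorm (vdiff (comb f (F m)) (comb f (F m \<union> F n)))"
      by (subst vnorm_vdiff_commute) (simp add: Un_commute)
    finally show ?thesis using half[OF that(2), of m] half[OF that(3), of n] by linarith
  qed
  have "MCauchy y"
    unfolding MCauchy_def
  proof (intro conjI allI impI)
    fix \<epsilon> :: real assume "0 < \<epsilon>"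
    obtain N where "4 / \<epsilon>\<^sup>2 \<le> real N" using real_arch_simple by blast
    then have "\<forall>n m. N \<le> n \<longrightarrow> N \<le> m \<longrightarrow> mdst M (y n) (y m) < \<epsilon>"
      using cauchy[OF \<open>0 < \<epsilon>\<close>] by (meson of_nat_le_iff order_trans)
    then show "\<exists>N. \<forall>n m. N \<le> n \<longrightarrow> N \<le> m \<longrightarrow> mdst M (y n) (y m) < \<epsilon>" ..
  qed (use y in auto)
  then obtain p where "limitin mtopology y p sequentially"
    using complete unfolding mcomplete_def by blast
  then have p: "p \<in> U" "\<And>\<epsilon>. 0 < \<epsilon> \<Longrightarrow> \<exists>N. \<forall>n\<ge>N. mdst M (y n) p < \<epsilon>"
    unfolding limit_metric_sequentially by blast+
  have dp: "mdst M (y n) p = vnorm (vdiff [(1, p)] (comb f (F n)))" for n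
    unfolding commute[of "y n" p] using y p Fv by (intro mdst_as_vnorm) auto
  show ?thesis
  proof
    show "p \<in> U" by (rule p)
    fix \<epsilon> :: real assume "0 < \<epsilon>"
    then show "\<exists>F. finite F \<and> F \<subseteq> E \<and> vnorm (vdiff [(1, p)] (comb f F)) < \<epsilon>"
      using p(2)[of \<epsilon>] F unfolding dp by blast
  next
    fix e assume e: "e \<in> E"
    have "cmod (G p e - f e) \<le> \<epsilon> + \<epsilon>" if "0 < \<epsilon>" for \<epsilon>
    proof -
      obtain N where N: "\<And>n. N \<le> n \<Longrightarrow> mdst M (y n) p < \<epsilon>" using p(2)[OF \<open>0 < \<epsilon>\<close>] by blast
      \<comment> \<open>From \<open>N'\<close> on, a coordinate \<open>e\<close> missed by
        \<open>F n\<close> satisfies \<open>a e \<le> \<epsilon>\<^sup>2\<close>, since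
        \<open>a e\<close> must fit into what \<open>F n\<close> leaves of \<open>S\<close>.\<close>
      obtain N' where N': "1 / \<epsilon>\<^sup>2 \<le> real N'" using real_arch_simple by blast
      define n where "n = max N N'"
      have "B (vdiff [(1, p)] (comb f (F n))) [(1, e)] = G p e - (if e \<in> F n then f e else 0)"
        using gform_comb_point[OF E F(1) F(2) e] by simp
      then have "cmod (G p e - (if e \<in> F n then f e else 0))
        \<le> vnorm (vdiff [(1, p)] (comb f (F n))) * vnorm [(1, e)]"
        using cauchy_schwarz[of "vdiff [(1, p)] (comb f (F n))" "[(1, e)]"] p(1) Fv e EU by auto
      also have "\<dots> \<le> \<epsilon> * 1"
        using N[of n] dp[of n] e EU p(1) Fv vnorm_point_le_1[of e] \<open>0 < \<epsilon>\<close>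
        by (intro mult_mono) (auto simp: n_def)
      finally have 1: "cmod (G p e - (if e \<in> F n then f e else 0)) \<le> \<epsilon>" by simp
      have 2: "cmod ((if e \<in> F n then f e else 0) - f e) \<le> \<epsilon>"
      proof (cases "e \<in> F n")
        case False
        then have "a e + sum a (F n) = sum a (insert e (F n))" using F by simp
        also have "\<dots> \<le> S" using F e by (intro le) auto
        finally have "a e \<le> 1 / real (Suc n)" using F(3)[of n] by linarith
        also have "\<dots> \<le> \<epsilon>\<^sup>2"
        proof -
          have "1 / \<epsilon>\<^sup>2 \<le> real (Suc n)" using N' by (simp add: n_def)
          then show ?thesis using \<open>0 < \<epsilon>\<close> by (simp add: field_simps)
        qed
        finally have "cmod (f e) \<le> \<epsilon>"
          unfolding a_def by (rule power2_le_imp_le) (use \<open>0 < \<epsilon>\<close> in simp)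
        then show ?thesis using False by simp
      qed (use \<open>0 < \<epsilon>\<close> in simp)
      have "cmod (G p e - f e) \<le> cmod (G p e - g) + cmod (g - f e)" for g
        using norm_triangle_ineq[of "G p e - g" "g - f e"] by simp
      from this[of "if e \<in> F n then f e else 0"] show ?thesis using 1 2 by linarith
    qed
    from this[of "_ / 2"] have "cmod (G p e - f e) \<le> 0 + \<epsilon>" if "0 < \<epsilon>" for \<epsilon>
      using that by simp
    then have "cmod (G p e - f e) \<le> 0" by (rule field_le_epsilon)
    then show "G p e = f e" by simp
  qed
qed

text \<open>Otherwise the normalized difference would be a unit vector orthogonal to
  \<open>E\<close>. The difference itself may have norm up to 2 and need not be a point, hence the
  scaling before \<open>realize\<close>.\<close>

lemma basis_eqI:
  assumes E: "orthonormal_basis E" and "x \<in> U" "y \<in> U" and eq: "\<And>e. e \<in> E \<Longrightarrow> G x e = G y e"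
  shows "x = y"
proof (rule ccontr)
  assume "x \<noteq> y"
  define w where "w = vdiff [(1, x)] [(1, y)]"
  define d where "d = vnorm w"
  have w: "w \<in> vecs" using assms by (simp add: w_def)
  have d: "0 < d" using \<open>x \<noteq> y\<close> assms(2,3) mdist_pos_less[of x y] by (simp add: d_def w_def mdst_vnorm)
  then have n1: "vnorm (vscale (of_real (1 / d)) w) = 1" by (simp add: d_def[symmetric] norm_divide)
  have v: "vscale (of_real (1 / d)) w \<in> vecs" using w by simp
  obtain z where z: "z \<in> U" "\<And>u. u \<in> U \<Longrightarrow> G z u = B (vscale (of_real (1 / d)) w) [(1, u)]"
    using realize[OF v] n1 by auto
  have "G z z = 1" using G_self_realized[OF z(1) v z(2)] by (simp only: n1) simp
  moreover have "G z e = 0" if "e \<in> E" for e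
    using z(2)[of e] that eq E by (auto simp: w_def orthonormal_basis_def orthonormal_def)
  ultimately show False using E z(1) by (auto simp: orthonormal_basis_def)
qed

text \<open>The point synthesized from the coefficients of \<open>x\<close> is \<open>x\<close> by
  \<open>basis_eqI\<close>, so some finite Fourier sum is close; enlarging the set does not increase
  the distance.\<close>

lemma basis_approx:
  assumes E: "orthonormal_basis E" and x: "x \<in> U" and "0 < \<epsilon>"
  obtains F where "finite F" "F \<subseteq> E"
    "\<And>F'. finite F' \<Longrightarrow> F' \<subseteq> E \<Longrightarrow> F \<subseteq> F' \<Longrightarrow> vnorm (vdiff [(1, x)] (comb (G x) F')) < \<epsilon>"
proof -
  have E': "orthonormal E" using E by (simp add: orthonormal_basis_def)
  have bd: "(\<Sum>e\<in>F. (cmod (G x e))\<^sup>2) \<le> 1" if "finite F" "F \<subseteq> E" for F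
    using bessel[OF E' x that] norm_le_1[OF x] by linarith
  obtain p where p: "p \<in> U" "\<And>e. e \<in> E \<Longrightarrow> G p e = G x e"
    "\<And>\<epsilon>. 0 < \<epsilon> \<Longrightarrow> \<exists>F. finite F \<and> F \<subseteq> E \<and> vnorm (vdiff [(1, p)] (comb (G x) F)) < \<epsilon>"
    using synthesis[OF E' bd] by blast
  have "p = x" using basis_eqI[OF E p(1) x p(2)] .
  then obtain F where F: "finite F" "F \<subseteq> E" "vnorm (vdiff [(1, x)] (comb (G x) F)) < \<epsilon>"
    using p(3)[OF \<open>0 < \<epsilon>\<close>] by blast
  show ?thesis
  proof (rule that[OF F(1,2)])
    fix F' assume F': "finite F'" "F' \<subseteq> E" "F \<subseteq> F'"
    have v: "comb (G x) F \<in> vecs" "comb (G x) F' \<in> vecs" using F(1,2) F'(1,2) E_U[OF E'] by (auto intro!: comb_vecs simp del: in_lists_conv_set)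
    have "(\<Sum>e\<in>F. (cmod (G x e))\<^sup>2) \<le> (\<Sum>e\<in>F'. (cmod (G x e))\<^sup>2)"
      using F' by (intro sum_mono2) auto
    then have "(vnorm (vdiff [(1, x)] (comb (G x) F')))\<^sup>2 \<le> (vnorm (vdiff [(1, x)] (comb (G x) F)))\<^sup>2"
      using vnorm_diff_comb_point[OF E' x F(1,2)] vnorm_diff_comb_point[OF E' x F'(1,2)] by simp
    then have "vnorm (vdiff [(1, x)] (comb (G x) F')) \<le> vnorm (vdiff [(1, x)] (comb (G x) F))"
      by (rule power2_le_imp_le) (use v x in auto)
    then show "vnorm (vdiff [(1, x)] (comb (G x) F')) < \<epsilon>" using F(3) by simp
  qed
qed

lemma parseval:
  assumes E: "orthonormal_basis E" and x: "x \<in> U" and y: "y \<in> U"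
  shows "((\<lambda>e. G x e * cnj (G y e)) has_sum G x y) E"
  unfolding has_sum_def tendsto_iff
proof (intro allI impI)
  fix \<epsilon> :: real assume "0 < \<epsilon>"
  have E': "orthonormal E" using E by (simp add: orthonormal_basis_def)
  note EU = E_U[OF E']
  obtain F where F: "finite F" "F \<subseteq> E"
    "\<And>F'. finite F' \<Longrightarrow> F' \<subseteq> E \<Longrightarrow> F \<subseteq> F' \<Longrightarrow> vnorm (vdiff [(1, x)] (comb (G x) F')) < \<epsilon>"
    using basis_approx[OF E x \<open>0 < \<epsilon>\<close>] by blast
  have "dist (\<Sum>e\<in>F'. G x e * cnj (G y e)) (G x y) < \<epsilon>"
    if F': "finite F'" "F' \<subseteq> E" "F \<subseteq> F'" for F'
  proof -
    have v: "comb (G x) F' \<in> vecs" using F'(1,2) EU by (intro comb_vecs) auto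
    have "(\<Sum>e\<in>F'. G x e * cnj (G y e)) = B (comb (G x) F') [(1, y)]"
      unfolding gform_comb_left[OF F'(1)]
    proof (rule sum.cong)
      fix e assume "e \<in> F'"
      then have "e \<in> U" using F' EU by auto
      then show "G x e * cnj (G y e) = G x e * B [(1, e)] [(1, y)]" using herm[OF y] by simp
    qed simp
    then have "G x y - (\<Sum>e\<in>F'. G x e * cnj (G y e)) = B (vdiff [(1, x)] (comb (G x) F')) [(1, y)]"
      by simp
    then have "dist (G x y) (\<Sum>e\<in>F'. G x e * cnj (G y e)) \<le> vnorm (vdiff [(1, x)] (comb (G x) F')) * vnorm [(1, y)]"
      unfolding dist_norm using cauchy_schwarz[of "vdiff [(1, x)] (comb (G x) F')" "[(1, y)]"] v x y by auto
    also have "\<dots> \<le> vnorm (vdiff [(1, x)] (comb (G x) F')) * 1"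
      using vnorm_point_le_1[OF y] v x by (intro mult_left_mono) auto
    also have "\<dots> < \<epsilon>" using F(3) F' by simp
    finally show ?thesis by (simp add: dist_commute)
  qed
  then show "eventually (\<lambda>F. dist (\<Sum>e\<in>F. G x e * cnj (G y e)) (G x y) < \<epsilon>) (finite_subsets_at_top E)"
    unfolding eventually_finite_subsets_at_top using F(1,2) by blast
qed

end

text \<open>Coordinates are carried along \<open>b\<close>: Bessel's inequality permits
  \<open>synthesis\<close> in the other structure, Parseval's identity shows that \<open>G\<close>
  is preserved, and the same construction backwards gives surjectivity.\<close>

theorem isomorphism_of_bases:
  fixes M :: "(ball_fun, ball_pred, 'm) mstruct" and M' :: "(ball_fun, ball_pred, 'n) mstruct"
  assumes "hilbert_ball M G" "hilbert_ball M' G'"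
    and E: "gram_ball.orthonormal_basis M G E" and E': "gram_ball.orthonormal_basis M' G' E'"
    and b: "bij_betw b E E'"
  shows "\<exists>h. isomorphism banach_signature M M' h"
proof -
  interpret A: hilbert_ball M G by fact
  interpret A': hilbert_ball M' G' by fact
  have on: "A.orthonormal E" "A'.orthonormal E'"
    using E E' by (auto simp: A.orthonormal_basis_def A'.orthonormal_basis_def)
  define c where "c = inv_into E b"
  have c: "bij_betw c E' E" unfolding c_def using b by (rule bij_betw_inv_into)
  have cb: "c (b e) = e" if "e \<in> E" for e using b that by (simp add: c_def bij_betw_inv_into_left)
  have bE: "b e \<in> E'" if "e \<in> E" for e using b that by (rule bij_betw_apply)
  have cE: "c e \<in> E" if "e \<in> E'" for e using c that by (rule bij_betw_apply)
  have bc: "b (c e) = e" if "e \<in> E'" for e using b that by (simp add: c_def bij_betw_inv_into_right)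
  have "\<exists>y. y \<in> universe M' \<and> (\<forall>e\<in>E. G' y (b e) = G x e)" if x: "x \<in> universe M" for x
  proof -
    have bd: "(\<Sum>e\<in>F. (cmod (G x (c e)))\<^sup>2) \<le> 1" if F: "finite F" "F \<subseteq> E'" for F
    proof -
      have inj: "inj_on c F" using c F by (meson bij_betw_imp_inj_on inj_on_subset)
      have "(\<Sum>e\<in>F. (cmod (G x (c e)))\<^sup>2) = (\<Sum>e\<in>c ` F. (cmod (G x e))\<^sup>2)"
        by (simp add: sum.reindex[OF inj])
      also have "\<dots> \<le> Re (G x x)" using F cE by (intro A.bessel[OF on(1) x]) auto
      finally show ?thesis using A.norm_le_1[OF x] by linarith
    qed
    obtain y where "y \<in> universe M'" "\<And>e. e \<in> E' \<Longrightarrow> G' y e = G x (c e)"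
    proof -
      show ?thesis
        by (rule A'.synthesis[OF on(2) bd]) (assumption | rule that)+
    qed
    then show ?thesis using bE cb by (intro exI[of _ y]) auto
  qed
  then obtain h where h: "\<And>x. x \<in> universe M \<Longrightarrow> h x \<in> universe M'"
    "\<And>x e. x \<in> universe M \<Longrightarrow> e \<in> E \<Longrightarrow> G' (h x) (b e) = G x e"
    by metis
  have pres: "G' (h x) (h y) = G x y" if "x \<in> universe M" "y \<in> universe M" for x y
  proof -
    have "((\<lambda>e. G' (h x) (b e) * cnj (G' (h y) (b e))) has_sum G' (h x) (h y)) E"
      using A'.parseval[OF E' h(1) h(1), OF that] has_sum_reindex_bij_betw[OF b] by fast
    also have "?this \<longleftrightarrow> ((\<lambda>e. G x e * cnj (G y e)) has_sum G' (h x) (h y)) E"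
      by (rule has_sum_cong) (use h that in auto)
    finally show ?thesis using A.parseval[OF E that] by (rule has_sum_unique)
  qed
  have "inj_on h (universe M)"
  proof (rule inj_onI)
    fix x y assume xy: "x \<in> universe M" "y \<in> universe M" "h x = h y"
    then have "G x e = G y e" if "e \<in> E" for e using h(2)[of x e] h(2)[of y e] that by simp
    then show "x = y" using A.basis_eqI[OF E] xy by blast
  qed
  moreover have "z \<in> h ` universe M" if z: "z \<in> universe M'" for z
  proof -
    have bd: "(\<Sum>e\<in>F. (cmod (G' z (b e)))\<^sup>2) \<le> 1" if F: "finite F" "F \<subseteq> E" for F
    proof -
      have inj: "inj_on b F" using b F by (meson bij_betw_imp_inj_on inj_on_subset)
      have "(\<Sum>e\<in>F. (cmod (G' z (b e)))\<^sup>2) = (\<Sum>e\<in>b ` F. (cmod (G' z e))\<^sup>2)"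
        by (simp add: sum.reindex[OF inj])
      also have "\<dots> \<le> Re (G' z z)" using F bE by (intro A'.bessel[OF on(2) z]) auto
      finally show ?thesis using A'.norm_le_1[OF z] by linarith
    qed
    obtain x where x: "x \<in> universe M" "\<And>e. e \<in> E \<Longrightarrow> G x e = G' z (b e)"
    proof -
      show ?thesis
        by (rule A.synthesis[OF on(1) bd]) (assumption | rule that)+
    qed
    have "h x = z"
    proof (rule A'.basis_eqI[OF E' h(1)[OF x(1)] z])
      fix e assume "e \<in> E'"
      then show "G' (h x) e = G' z e" using h(2)[OF x(1) cE] x(2)[OF cE] bc by metis
    qed
    then show ?thesis using x(1) by blast
  qed
  ultimately have "bij_betw h (universe M) (universe M')"
    using h(1) by (auto simp: bij_betw_def)
  then have "isomorphism banach_signature M M' h"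
    using isomorphismI[OF A.gram_ball_axioms A'.gram_ball_axioms] pres by blast
  then show ?thesis by blast
qed

section \<open>Density characters\<close>

lemma card_of_lists_infinite:
  assumes "infinite A" shows "|lists A| \<le>o |A|"
proof -
  have n: "|{l \<in> lists A. length l = n}| \<le>o |A|" for n
  proof (induction n)
    case 0
    have "{l \<in> lists A. length l = 0} = {[]}" by auto
    moreover obtain x where "x \<in> A" using assms by fastforce
    ultimately show ?case by (intro card_of_ordLeq[THEN iffD1] exI[of _ "\<lambda>_. x"]) auto
  next
    case (Suc n)
    have eq: "{l \<in> lists A. length l = Suc n} = (\<lambda>(x, l). x # l) ` (A \<times> {l \<in> lists A. length l = n})"
      by (auto simp: length_Suc_conv image_iff)
    have "|A \<times> {l \<in> lists A. length l = n}| \<le>o |A|"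
    proof (rule ordLeq_transitive)
      show "|A \<times> {l \<in> lists A. length l = n}| \<le>o |A \<times> A|"
        using Suc by (rule card_of_Times_mono2)
      show "|A \<times> A| \<le>o |A|"
        using card_of_Times_same_infinite[OF assms] by (rule ordIso_imp_ordLeq)
    qed
    then show ?case unfolding eq by (rule ordLeq_transitive[OF card_of_image])
  qed
  have "lists A = (\<Union>n. {l \<in> lists A. length l = n})" by auto
  moreover have "|\<Union>n. {l \<in> lists A. length l = n}| \<le>o |A|"
    using assms n by (intro card_of_UNION_ordLeq_infinite) (auto simp: infinite_iff_card_of_nat)
  ultimately show ?thesis by simp
qed

lemma countable_iff_card_of_nat: "countable A \<longleftrightarrow> |A| \<le>o |UNIV :: nat set|"
  unfolding countable_def card_of_ordLeq[symmetric] by auto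

definition rational_complex :: "complex set" where
  "rational_complex = {z. Re z \<in> \<rat> \<and> Im z \<in> \<rat>}"

lemma countable_rational_complex: "countable rational_complex"
proof -
  have "rational_complex \<subseteq> (\<lambda>(x, y). Complex x y) ` (\<rat> \<times> \<rat>)"
  proof
    fix z assume "z \<in> rational_complex"
    then show "z \<in> (\<lambda>(x, y). Complex x y) ` (\<rat> \<times> \<rat>)"
      by (intro image_eqI[of _ _ "(Re z, Im z)"]) (auto simp: rational_complex_def)
  qed
  moreover have "countable ((\<lambda>(x, y). Complex x y) ` (\<rat> \<times> \<rat>))"
    by (intro countable_image countable_SIGMA countable_rat)
  ultimately show ?thesis by (rule countable_subset)
qed

text \<open>Approximation from below in absolute value, so that rounding the coefficients of an
  orthonormal combination does not increase its norm and it stays in the ball.\<close>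

lemma rational_approx_below:
  fixes t :: real assumes "0 < \<delta>" obtains q where "q \<in> \<rat>" "\<bar>q\<bar> \<le> \<bar>t\<bar>" "\<bar>q - t\<bar> < \<delta>"
proof (cases "t = 0")
  case True
  then show ?thesis using that[of 0] assms by simp
next
  case False
  then obtain q where q: "q \<in> \<rat>" "max 0 (\<bar>t\<bar> - \<delta>) < q" "q < \<bar>t\<bar>"
    using Rats_dense_in_real[of "max 0 (\<bar>t\<bar> - \<delta>)" "\<bar>t\<bar>"] assms by auto
  show ?thesis
  proof (cases "0 < t")
    case True then show ?thesis using that[of q] q by auto
  next
    case False then show ?thesis using that[of "- q"] q by auto
  qed
qed

lemma rational_complex_approx_below:
  assumes "0 < \<delta>" obtains q where "q \<in> rational_complex" "cmod q \<le> cmod c" "cmod (q - c) < \<delta>"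
proof -
  obtain a where a: "a \<in> \<rat>" "\<bar>a\<bar> \<le> \<bar>Re c\<bar>" "\<bar>a - Re c\<bar> < \<delta> / 2"
    using rational_approx_below[of "\<delta> / 2" "Re c"] assms by auto
  obtain b where b: "b \<in> \<rat>" "\<bar>b\<bar> \<le> \<bar>Im c\<bar>" "\<bar>b - Im c\<bar> < \<delta> / 2"
    using rational_approx_below[of "\<delta> / 2" "Im c"] assms by auto
  show ?thesis
  proof (rule that[of "Complex a b"])
    show "Complex a b \<in> rational_complex" using a b by (simp add: rational_complex_def)
    have "a\<^sup>2 \<le> (Re c)\<^sup>2" "b\<^sup>2 \<le> (Im c)\<^sup>2" using a b by (simp_all add: abs_le_square_iff)
    then show "cmod (Complex a b) \<le> cmod c" unfolding cmod_def by (intro real_sqrt_le_mono add_mono) auto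
    show "cmod (Complex a b - c) < \<delta>"
      using cmod_le[of "Complex a b - c"] a b by simp
  qed
qed

section \<open>Density character against cardinality of a basis\<close>

context hilbert_ball
begin

lemma dense_in_iff: "dense_in M D \<longleftrightarrow> D \<subseteq> U \<and> (\<forall>x\<in>U. \<forall>r>0. \<exists>y\<in>D. mdst M x y < r)"
  unfolding dense_in_def metric_closure_of by (auto simp: subset_iff set_eq_iff) blast+

text \<open>Distinct orthonormal points are at distance sqrt 2, hence at least 1, so points of
  \<open>D\<close> chosen within 1/2 of them are distinct.\<close>

lemma card_orthonormal_le_dense:
  assumes E: "orthonormal E" and D: "dense_in M D"
  shows "|E| \<le>o |D|"
proof -
  note EU = E_U[OF E]
  have far: "1 \<le> mdst M e e'" if "e \<in> E" "e' \<in> E" "e \<noteq> e'" for e e'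
  proof -
    have "G e e = 1" "G e' e' = 1" "G e e' = 0" "G e' e = 0" using E that by (auto simp: orthonormal_def)
    then have "Re (B (vdiff [(1, e)] [(1, e')]) (vdiff [(1, e)] [(1, e')])) = 2" by simp
    then show ?thesis using that EU by (simp add: subsetD mdst_vnorm vnorm_def)
  qed
  have "\<forall>e\<in>E. \<exists>y\<in>D. mdst M e y < 1 / 2" 
  proof
    fix e assume "e \<in> E"
    then have "e \<in> U" using EU by auto
    then show "\<exists>y\<in>D. mdst M e y < 1 / 2"
      using D unfolding dense_in_iff by (meson half_gt_zero_iff zero_less_one)
  qed
  then obtain g where g: "\<And>e. e \<in> E \<Longrightarrow> g e \<in> D" "\<And>e. e \<in> E \<Longrightarrow> mdst M e (g e) < 1 / 2" by metis
  have "inj_on g E"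
  proof (rule inj_onI, rule ccontr)
    fix e e' assume e: "e \<in> E" "e' \<in> E" "g e = g e'" "e \<noteq> e'"
    have "mdst M e e' \<le> mdst M e (g e) + mdst M (g e) e'"
      using e g(1) EU D by (intro triangle) (auto simp: dense_in_iff)
    then show False using g(2)[OF e(1)] g(2)[OF e(2)] far[OF e(1,2,4)] e(3) commute[of "g e" e'] by simp
  qed
  then show ?thesis using g(1) by (intro card_of_ordLeq[THEN iffD1]) auto
qed

definition rational_span :: "'m set \<Rightarrow> 'm set" where
  "rational_span E = (\<lambda>l. fint M (Sigma (map fst l)) (map snd l)) ` lists (rational_complex \<times> E)"

lemma dense_rational_span:
  assumes E: "orthonormal_basis E" shows "dense_in M (rational_span E)"
  unfolding dense_in_iff
proof (intro conjI ballI allI impI)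
  have E': "orthonormal E" using E by (simp add: orthonormal_basis_def)
  note EU = E_U[OF E']
  have sub: "set (map snd l) \<subseteq> U" if "l \<in> lists (rational_complex \<times> E)" for l
    using that EU by auto
  then show "rational_span E \<subseteq> U"
    unfolding rational_span_def by (auto intro!: sigma_in simp del: set_map)
  fix x r assume x: "x \<in> U" and r: "(0::real) < r"
  have "0 < r / 2" using r by simp
  from basis_approx[OF E x this] obtain F where F: "finite F" "F \<subseteq> E"
      "vnorm (vdiff [(1, x)] (comb (G x) F)) < r / 2"
    by (metis order_refl)
  \<comment> \<open>Chosen so that the squared error \<open>card F * \<delta>\<^sup>2\<close> is at
    most \<open>((card F + 1) * \<delta>)\<^sup>2 = (r / 2)\<^sup>2\<close>; the added 1 covers an
    empty \<open>F\<close>.\<close>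
  define \<delta> where "\<delta> = r / (2 * (real (card F) + 1))"
  have \<delta>: "0 < \<delta>" using r by (simp add: \<delta>_def)
  have "\<exists>q. q \<in> rational_complex \<and> cmod q \<le> cmod (G x e) \<and> cmod (q - G x e) < \<delta>" for e
    using rational_complex_approx_below[OF \<delta>, of "G x e"] by blast
  then obtain q where q: "\<And>e. q e \<in> rational_complex" "\<And>e. cmod (q e) \<le> cmod (G x e)" "\<And>e. cmod (q e - G x e) < \<delta>"
    by metis
  define l where "l = comb q F"
  have l: "l \<in> lists (rational_complex \<times> E)" unfolding l_def using F q(1) by (intro comb_lists) auto
  have lv: "l \<in> vecs" unfolding l_def using F(1,2) EU by (intro comb_vecs) auto
  have cv: "comb (G x) F \<in> vecs" using F(1,2) EU by (intro comb_vecs) auto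
  have "(\<Sum>e\<in>F. (cmod (q e))\<^sup>2) \<le> (\<Sum>e\<in>F. (cmod (G x e))\<^sup>2)"
    using q(2) by (intro sum_mono power_mono) auto
  also have "\<dots> \<le> 1" using bessel[OF E' x F(1,2)] norm_le_1[OF x] by linarith
  finally have n1: "vnorm l \<le> 1"
    using lv gform_comb_self[OF E' F(1,2)] by (simp add: vnorm_le_iff l_def)
  define y where "y = fint M (Sigma (map fst l)) (map snd l)"
  have yU: "y \<in> U" unfolding y_def using sub[OF l] by (intro sigma_in) auto
  have "G y z = B l [(1, z)]" if "z \<in> U" for z
    using G_sigma_ball[of "map fst l" "map snd l" z] sub[OF l] that n1 by (simp add: y_def zip_map_fst_snd)
  then have "mdst M x y = vnorm (vdiff [(1, x)] l)"
    using x yU lv by (intro mdst_as_vnorm) auto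
  also have "\<dots> \<le> vnorm (vdiff [(1, x)] (comb (G x) F)) + vnorm (vdiff (comb (G x) F) l)"
    using x lv cv by (intro vnorm_triangle) auto
  also have "vnorm (vdiff (comb (G x) F) l) \<le> r / 2"
  proof -
    have "vnorm (vdiff (comb (G x) F) l) = vnorm (comb (\<lambda>e. G x e - q e) F)"
      using F EU lv cv by (intro vnorm_cong)
        (auto simp: l_def gform_comb_left algebra_simps sum_subtractf)
    moreover have "(\<Sum>e\<in>F. (cmod (G x e - q e))\<^sup>2) \<le> (r / 2)\<^sup>2"
    proof -
      have "(\<Sum>e\<in>F. (cmod (G x e - q e))\<^sup>2) \<le> (\<Sum>e\<in>F. \<delta>\<^sup>2)"
        using q(3) by (intro sum_mono power_mono) (auto simp: norm_minus_commute less_imp_le)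
      also have "\<dots> = real (card F) * \<delta>\<^sup>2" by simp
      also have "\<dots> \<le> (real (card F) + 1)\<^sup>2 * \<delta>\<^sup>2"
        by (intro mult_right_mono) (auto simp: power2_eq_square algebra_simps)
      also have "\<dots> = (r / 2)\<^sup>2"
      proof -
        have "(real (card F) + 1) * \<delta> = r / 2" by (simp add: \<delta>_def field_simps)
        then show ?thesis by (metis power_mult_distrib)
      qed
      finally show ?thesis .
    qed
    moreover have "comb (\<lambda>e. G x e - q e) F \<in> vecs" using F(1,2) EU by (intro comb_vecs) auto
    ultimately show ?thesis
      using r gform_comb_self[OF E' F(1,2)] vnorm_le_iff[of "comb (\<lambda>e. G x e - q e) F" "r / 2"] by simp
  qed
  finally have "mdst M x y < r" using F(3) by linarith
  moreover have "y \<in> rational_span E" using l by (auto simp: rational_span_def y_def)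
  ultimately show "\<exists>y\<in>rational_span E. mdst M x y < r" by blast
qed

lemma countable_rational_span: "countable E \<Longrightarrow> countable (rational_span E)"
  unfolding rational_span_def
  by (intro countable_image countable_lists countable_SIGMA countable_rational_complex)

lemma card_rational_span:
  assumes "infinite E" shows "|rational_span E| \<le>o |E|"
proof -
  have ne: "rational_complex \<noteq> {}" by (auto simp: rational_complex_def intro!: exI[of _ 0])
  have "|rational_complex| \<le>o |E|"
    using countable_rational_complex assms ordLeq_transitive
    unfolding countable_iff_card_of_nat infinite_iff_card_of_nat by blast
  then have eq: "|rational_complex \<times> E| =o |E|"
    using card_of_Times_infinite[OF assms ne] by blast
  have "infinite (rational_complex \<times> E)" using assms ne by (auto dest: finite_cartesian_productD2)
  then have "|lists (rational_complex \<times> E)| \<le>o |rational_complex \<times> E|" by (rule card_of_lists_infinite)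
  then have "|lists (rational_complex \<times> E)| \<le>o |E|" using eq by (rule ordLeq_ordIso_trans)
  then show ?thesis unfolding rational_span_def by (rule ordLeq_transitive[OF card_of_image])
qed

lemma density_character_of_basis:
  fixes \<kappa> :: "'k rel"
  assumes E: "orthonormal_basis E" and "infinite E" and "|E| =o \<kappa>"
  shows "has_density_character M \<kappa>"
proof -
  have E': "orthonormal E" using E by (simp add: orthonormal_basis_def)
  have "|rational_span E| =o |E|"
    using card_rational_span[OF assms(2)] card_orthonormal_le_dense[OF E' dense_rational_span[OF E]]
    by (simp add: ordIso_iff_ordLeq)
  then have "|rational_span E| =o \<kappa>" using assms(3) by (rule ordIso_transitive)
  moreover have "\<kappa> \<le>o |D|" if "dense_in M D" for D
    using card_orthonormal_le_dense[OF E' that] assms(3) ordIso_symmetric ordIso_ordLeq_trans by blast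
  ultimately show ?thesis
    using dense_rational_span[OF E] unfolding has_density_character_def by blast
qed

text \<open>Uncountability excludes a finite basis, whose rational span would be a countable dense
  set; an infinite basis is as large as its rational span.\<close>

lemma basis_of_density_character:
  fixes \<kappa> :: "'k rel"
  assumes E: "orthonormal_basis E" and dc: "has_density_character M \<kappa>" and "natLeq <o \<kappa>"
  shows "|E| =o \<kappa>"
proof -
  have E': "orthonormal E" using E by (simp add: orthonormal_basis_def)
  obtain D where D: "dense_in M D" "|D| =o \<kappa>" and min: "\<And>D. dense_in M D \<Longrightarrow> \<kappa> \<le>o |D|"
    using dc unfolding has_density_character_def by blast
  have le: "|E| \<le>o \<kappa>" using card_orthonormal_le_dense[OF E' D(1)] D(2) by (rule ordLeq_ordIso_trans)
  have \<kappa>le: "\<kappa> \<le>o |rational_span E|" using min[OF dense_rational_span[OF E]] .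
  have "infinite E"
  proof
    assume "finite E"
    then have "countable (rational_span E)" by (intro countable_rational_span countable_finite)
    then have "|rational_span E| \<le>o natLeq"
      unfolding countable_iff_card_of_nat using card_of_nat by (rule ordLeq_ordIso_trans)
    then have "\<kappa> \<le>o natLeq" using \<kappa>le ordLeq_transitive by blast
    then show False using assms(3) not_ordLess_ordLeq by blast
  qed
  then have "\<kappa> \<le>o |E|" using \<kappa>le card_rational_span ordLeq_transitive by blast
  then show ?thesis using le by (simp add: ordIso_iff_ordLeq)
qed

end

section \<open>The Hilbert space of square summable families\<close>

text \<open>Bounds on finite sums express norm at most 1 without presupposing summability, and they
  survive coordinatewise limits.\<close>

definition l2_ball :: "'a set \<Rightarrow> ('a \<Rightarrow> complex) set" where
  "l2_ball S = {f. (\<forall>e. e \<notin> S \<longrightarrow> f e = 0) \<and> (\<forall>F. finite F \<longrightarrow> (\<Sum>e\<in>F. (cmod (f e))\<^sup>2) \<le> 1)}"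

lemma summable_mult_cnj:
  assumes "(\<lambda>e. (cmod (f e))\<^sup>2) summable_on A" "(\<lambda>e. (cmod (g e))\<^sup>2) summable_on A"
  shows "(\<lambda>e. f e * cnj (g e)) summable_on A"
proof -
  have "(\<lambda>e. norm ((cmod (f e))\<^sup>2 + (cmod (g e))\<^sup>2)) summable_on A"
    using summable_on_add[OF assms] by simp
  then have "(\<lambda>e. norm (f e * cnj (g e))) summable_on A"
  proof (rule Infinite_Sum.abs_summable_on_comparison_test)
    fix e
    have "2 * (cmod (f e) * cmod (g e)) \<le> (cmod (f e))\<^sup>2 + (cmod (g e))\<^sup>2"
      using sum_squares_bound[of "cmod (f e)" "cmod (g e)"] by simp
    moreover have "0 \<le> cmod (f e) * cmod (g e)" by simp
    ultimately have "cmod (f e) * cmod (g e) \<le> (cmod (f e))\<^sup>2 + (cmod (g e))\<^sup>2" by linarith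
    then show "norm (f e * cnj (g e)) \<le> norm ((cmod (f e))\<^sup>2 + (cmod (g e))\<^sup>2)"
      by (simp add: norm_mult)
  qed
  then show ?thesis by (rule abs_summable_summable)
qed

text \<open>
  The points of the ball of \<open>\<ell>\<^sup>2(S)\<close> are coded by elements of an arbitrary type \<open>'m\<close>; the map \<open>co\<close>
  decodes a point to its family of coordinates.
\<close>

locale l2_coords =
  fixes S :: "'a set" and Pt :: "'m set" and co :: "'m \<Rightarrow> 'a \<Rightarrow> complex"
  assumes bij: "bij_betw co Pt (l2_ball S)"
begin

definition point_of :: "('a \<Rightarrow> complex) \<Rightarrow> 'm" where
  "point_of = inv_into Pt co"

definition lin :: "(complex \<times> 'm) list \<Rightarrow> 'a \<Rightarrow> complex" where
  "lin u e = (\<Sum>(a, x)\<leftarrow>u. a * co x e)"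

text \<open>A sum of squares instead of an expression in \<open>ip\<close>: so \<open>mdst\<close>
  is nonnegative and symmetric even off \<open>Pt\<close>, as \<open>gram_ball\<close> asks of the
  distance.\<close>

definition nrm :: "(complex \<times> 'm) list \<Rightarrow> real" where
  "nrm u = sqrt (infsum (\<lambda>e. (cmod (lin u e))\<^sup>2) UNIV)"

definition ip :: "'m \<Rightarrow> 'm \<Rightarrow> complex" where
  "ip x y = infsum (\<lambda>e. co x e * cnj (co y e)) UNIV"

definition l2_structure :: "(ball_fun, ball_pred, 'm) mstruct" where
  "l2_structure = \<lparr>universe = Pt, mdst = (\<lambda>x y. nrm [(1, x), (-1, y)]),
     fint = (\<lambda>F xs. case F of Zero \<Rightarrow> point_of (\<lambda>_. 0)
        | Sigma a \<Rightarrow> point_of (\<lambda>e. lin (zip a xs) e / of_real (max 1 (nrm (zip a xs))))),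
     pint = (\<lambda>P xs. case P of NormComb a \<Rightarrow> nrm (zip a xs))\<rparr>"

lemma universe_l2 [simp]: "universe l2_structure = Pt"
  by (simp add: l2_structure_def)

lemma point_of: "f \<in> l2_ball S \<Longrightarrow> point_of f \<in> Pt" "f \<in> l2_ball S \<Longrightarrow> co (point_of f) = f"
  using bij unfolding point_of_def by (auto simp: bij_betw_inv_into_right bij_betw_def inv_into_into)

lemma co: "x \<in> Pt \<Longrightarrow> co x \<in> l2_ball S"
  using bij by (rule bij_betw_apply)

lemma co_inj: "\<lbrakk>x \<in> Pt; y \<in> Pt; co x = co y\<rbrakk> \<Longrightarrow> x = y"
  using bij by (auto simp: bij_betw_def inj_on_def)

lemma lin_simps [simp]: "lin [] e = 0" "lin ((a, x) # u) e = a * co x e + lin u e"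
  by (simp_all add: lin_def)

lemma summable_co: "x \<in> Pt \<Longrightarrow> (\<lambda>e. (cmod (co x e))\<^sup>2) summable_on UNIV"
  using co[of x] by (intro nonneg_bdd_above_summable_on) (auto simp: l2_ball_def bdd_above_def)

lemma has_sum_ip:
  assumes "x \<in> Pt" "y \<in> Pt" shows "((\<lambda>e. co x e * cnj (co y e)) has_sum ip x y) UNIV"
  unfolding ip_def using assms by (intro has_sum_infsum summable_mult_cnj summable_co)

lemma has_sum_gform:
  assumes u: "u \<in> lists (UNIV \<times> Pt)" and v: "v \<in> lists (UNIV \<times> Pt)"
  shows "((\<lambda>e. lin u e * cnj (lin v e)) has_sum gform ip u v) UNIV"
proof -
  have 1: "((\<lambda>e. co x e * cnj (lin v e)) has_sum gform ip [(1, x)] v) UNIV" if x: "x \<in> Pt" for x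
    using v
  proof (induction v)
    case (Cons p v)
    obtain b y where p: "p = (b, y)" by force
    have "((\<lambda>e. cnj b * (co x e * cnj (co y e)) + co x e * cnj (lin v e)) has_sum
        (cnj b * ip x y + gform ip [(1, x)] v)) UNIV"
      using Cons p x by (intro has_sum_add has_sum_cmult_right has_sum_ip) auto
    moreover have "gform ip [(1, x)] ((b, y) # v) = cnj b * ip x y + gform ip [(1, x)] v"
      using gform_append_right[of ip "[(1, x)]" "[(b, y)]" v] by simp
    ultimately show ?case by (simp add: p algebra_simps)
  qed simp
  show ?thesis using u
  proof (induction u)
    case (Cons p u)
    obtain a x where p: "p = (a, x)" by force
    have "((\<lambda>e. a * (co x e * cnj (lin v e)) + lin u e * cnj (lin v e)) has_sum
        (a * gform ip [(1, x)] v + gform ip u v)) UNIV"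
      using Cons p by (intro has_sum_add has_sum_cmult_right 1) auto
    moreover have "gform ip ((a, x) # u) v = a * gform ip [(1, x)] v + gform ip u v"
      using gform_append_left[of ip "[(a, x)]" u v] gform_left_sum[of ip "[(a, x)]" v] by simp
    ultimately show ?case by (simp add: p algebra_simps)
  qed simp
qed

lemma has_sum_norm_lin:
  assumes "u \<in> lists (UNIV \<times> Pt)"
  shows "((\<lambda>e. (cmod (lin u e))\<^sup>2) has_sum Re (gform ip u u)) UNIV"
proof -
  have "Re (z * cnj z) = (cmod z)\<^sup>2" for z by (simp only: complex_norm_square[symmetric] Re_complex_of_real)
  then show ?thesis using has_sum_Re[OF has_sum_gform[OF assms assms]] by simp
qed

lemma gform_ip_pos: "u \<in> lists (UNIV \<times> Pt) \<Longrightarrow> 0 \<le> Re (gform ip u u)"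
  using has_sum_nonneg[OF has_sum_norm_lin] by simp

lemma nrm_eq: "u \<in> lists (UNIV \<times> Pt) \<Longrightarrow> nrm u = sqrt (Re (gform ip u u))"
  using infsumI[OF has_sum_norm_lin] by (simp add: nrm_def)

lemma nrm_nonneg: "0 \<le> nrm u"
  by (simp add: nrm_def infsum_nonneg)

lemma sum_lin_le:
  assumes "u \<in> lists (UNIV \<times> Pt)" "finite F" shows "(\<Sum>e\<in>F. (cmod (lin u e))\<^sup>2) \<le> (nrm u)\<^sup>2"
  using finite_sum_le_has_sum[OF has_sum_norm_lin[OF assms(1)] assms(2)] assms(1)
  by (simp add: nrm_eq gform_ip_pos)

lemma cmod_lin_le: "u \<in> lists (UNIV \<times> Pt) \<Longrightarrow> cmod (lin u e) \<le> nrm u"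
  by (rule power2_le_imp_le[OF _ nrm_nonneg]) (use sum_lin_le[of u "{e}"] in simp)

lemma nrm_le:
  assumes "u \<in> lists (UNIV \<times> Pt)" "0 \<le> c" "\<And>F. finite F \<Longrightarrow> (\<Sum>e\<in>F. (cmod (lin u e))\<^sup>2) \<le> c\<^sup>2"
  shows "nrm u \<le> c"
proof -
  have "Re (gform ip u u) \<le> c\<^sup>2"
    using has_sum_norm_lin[OF assms(1)] assms(3) by (rule has_sum_le_finite_sums)
  then show ?thesis using assms by (simp add: nrm_eq real_le_lsqrt)
qed

lemma lin_outside: "u \<in> lists (UNIV \<times> Pt) \<Longrightarrow> e \<notin> S \<Longrightarrow> lin u e = 0"
proof (induction u)
  case (Cons p u)
  then show ?case using co by (cases p) (auto simp: l2_ball_def)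
qed simp

lemma normalized_in_l2:
  assumes "u \<in> lists (UNIV \<times> Pt)"
  shows "(\<lambda>e. lin u e / of_real (max 1 (nrm u))) \<in> l2_ball S"
proof -
  define m where "m = max 1 (nrm u)"
  have m: "1 \<le> m" "nrm u \<le> m" by (auto simp: m_def)
  have "(\<Sum>e\<in>F. (cmod (lin u e / of_real m))\<^sup>2) \<le> 1" if "finite F" for F
  proof -
    have "(\<Sum>e\<in>F. (cmod (lin u e / of_real m))\<^sup>2) = (\<Sum>e\<in>F. (cmod (lin u e))\<^sup>2) / m\<^sup>2"
      using m by (simp add: norm_divide power_divide sum_divide_distrib)
    also have "\<dots> \<le> 1"
      using sum_lin_le[OF assms that] power_mono[OF m(2) nrm_nonneg, of 2] m by simp
    finally show ?thesis .
  qed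
  then show ?thesis using lin_outside[OF assms] by (simp add: l2_ball_def m_def)
qed

lemma gram_ball_l2: "gram_ball l2_structure ip"
proof
  have zero: "(\<lambda>_. 0) \<in> l2_ball S" by (simp add: l2_ball_def)
  show "fint l2_structure Zero [] \<in> universe l2_structure"
    using point_of(1)[OF zero] by (simp add: l2_structure_def)
  show "ip (fint l2_structure Zero []) y = 0" for y
    using point_of(2)[OF zero] by (simp add: l2_structure_def ip_def)
  show "ip y x = cnj (ip x y)" if "x \<in> universe l2_structure" "y \<in> universe l2_structure" for x y
  proof -
    have "((\<lambda>e. cnj (co x e * cnj (co y e))) has_sum cnj (ip x y)) UNIV"
      using that by (simp only: has_sum_cnj_iff) (simp add: has_sum_ip)
    then have "((\<lambda>e. co y e * cnj (co x e)) has_sum cnj (ip x y)) UNIV"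
      by (simp add: mult.commute)
    then show ?thesis using has_sum_ip[of y x] that has_sum_unique by fastforce
  qed
  show "pint l2_structure (NormComb a) xs = sqrt (Re (gform ip (zip a xs) (zip a xs)))"
    if "length a = length xs" "set xs \<subseteq> universe l2_structure" for a xs
  proof -
    have "zip a xs \<in> lists (UNIV \<times> Pt)" using that by (auto dest: set_zip_rightD)
    then show ?thesis by (simp add: l2_structure_def nrm_eq)
  qed
  show "x = y" if "x \<in> universe l2_structure" "y \<in> universe l2_structure" "mdst l2_structure x y = 0" for x y
  proof (rule co_inj)
    show "co x = co y"
    proof
      fix e
      have "cmod (lin [(1, x), (-1, y)] e) \<le> nrm [(1, x), (-1, y)]" using that by (intro cmod_lin_le) auto
      then show "co x e = co y e" using that by (simp add: l2_structure_def)
    qed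
  qed (use that in auto)
  show "mdst l2_structure x y = mdst l2_structure y x" for x y
    by (simp add: l2_structure_def nrm_def norm_minus_commute)
  show "Re (ip x x) \<le> 1" if "x \<in> universe l2_structure" for x
  proof -
    have x: "x \<in> Pt" using that by simp
    have "nrm [(1, x)] \<le> 1" using x co[OF x] by (intro nrm_le) (auto simp: l2_ball_def)
    then show ?thesis using x by (simp add: nrm_eq)
  qed
  fix a :: "complex list" and xs assume *: "length a = length xs" "set xs \<subseteq> universe l2_structure"
  then have z: "zip a xs \<in> lists (UNIV \<times> Pt)" by (auto dest: set_zip_rightD)
  show "fint l2_structure (Sigma a) xs \<in> universe l2_structure"
    using point_of(1)[OF normalized_in_l2[OF z]] by (simp add: l2_structure_def)
  fix y assume y: "y \<in> universe l2_structure"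
  define m where "m = max 1 (nrm (zip a xs))"
  have m: "1 \<le> m" by (simp add: m_def)
  let ?s = "fint l2_structure (Sigma a) xs"
  have s: "?s \<in> Pt" "co ?s = (\<lambda>e. lin (zip a xs) e / of_real m)"
    using point_of[OF normalized_in_l2[OF z]] by (simp_all add: l2_structure_def m_def)
  have "((\<lambda>e. of_real m * (co ?s e * cnj (co y e))) has_sum of_real m * ip ?s y) UNIV"
    using s y by (intro has_sum_cmult_right has_sum_ip) auto
  then have "((\<lambda>e. lin (zip a xs) e * cnj (co y e)) has_sum of_real m * ip ?s y) UNIV"
    using m by (simp add: s(2))
  moreover have "((\<lambda>e. lin (zip a xs) e * cnj (co y e)) has_sum gform ip (zip a xs) [(1, y)]) UNIV"
    using has_sum_gform[OF z, of "[(1, y)]"] y by simp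
  ultimately have "of_real m * ip ?s y = gform ip (zip a xs) [(1, y)]" by (rule has_sum_unique)
  then show "ip ?s y * of_real (max 1 (pint l2_structure (NormComb a) xs)) = gform ip (zip a xs) [(1, y)]"
    by (simp add: l2_structure_def m_def mult.commute)
qed (auto simp: gform_ip_pos nrm_nonneg l2_structure_def)

sublocale gram_ball l2_structure ip
  by (rule gram_ball_l2)

lemma cmod_co_diff_le: "\<lbrakk>x \<in> Pt; y \<in> Pt\<rbrakk> \<Longrightarrow> cmod (co x e - co y e) \<le> mdst l2_structure x y"
  using cmod_lin_le[of "[(1, x), (-1, y)]" e] by (simp add: l2_structure_def)

text \<open>A Cauchy sequence converges in each coordinate; bounds on finite sums pass to the limit,
  both for membership in the ball and for the distance to the limit point.\<close>

lemma mcomplete_l2: "mcomplete"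
  unfolding mcomplete_def
proof (intro allI impI)
  fix \<sigma> assume "MCauchy \<sigma>"
  then have \<sigma>: "\<And>n. \<sigma> n \<in> Pt"
    and cauchy: "\<And>\<epsilon>. 0 < \<epsilon> \<Longrightarrow> \<exists>N. \<forall>n n'. N \<le> n \<longrightarrow> N \<le> n' \<longrightarrow> mdst l2_structure (\<sigma> n) (\<sigma> n') < \<epsilon>"
    unfolding MCauchy_def by auto
  have "Cauchy (\<lambda>n. co (\<sigma> n) e)" for e
    unfolding Cauchy_def
  proof (intro allI impI)
    fix \<epsilon> :: real assume "0 < \<epsilon>"
    then obtain N where N: "\<And>n n'. N \<le> n \<Longrightarrow> N \<le> n' \<Longrightarrow> mdst l2_structure (\<sigma> n) (\<sigma> n') < \<epsilon>"
      using cauchy by blast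
    show "\<exists>N. \<forall>m\<ge>N. \<forall>n\<ge>N. dist (co (\<sigma> m) e) (co (\<sigma> n) e) < \<epsilon>"
      unfolding dist_norm using cmod_co_diff_le[OF \<sigma> \<sigma>] N by (meson le_less_trans)
  qed
  then have "\<exists>l. (\<lambda>n. co (\<sigma> n) e) \<longlonglongrightarrow> l" for e
    by (simp add: Cauchy_convergent_iff convergent_def)
  then obtain f where f: "\<And>e. (\<lambda>n. co (\<sigma> n) e) \<longlonglongrightarrow> f e" by metis
  have fl: "f \<in> l2_ball S"
    unfolding l2_ball_def
  proof (intro CollectI conjI allI impI)
    fix e assume "e \<notin> S"
    then have "(\<lambda>n. co (\<sigma> n) e) = (\<lambda>n. 0)" using co[OF \<sigma>] by (auto simp: l2_ball_def)
    then show "f e = 0" using f[of e] LIMSEQ_unique tendsto_const by metis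
  next
    fix F :: "'a set" assume "finite F"
    have "(\<lambda>n. \<Sum>e\<in>F. (cmod (co (\<sigma> n) e))\<^sup>2) \<longlonglongrightarrow> (\<Sum>e\<in>F. (cmod (f e))\<^sup>2)"
      by (intro tendsto_sum tendsto_power tendsto_norm f)
    moreover have "(\<Sum>e\<in>F. (cmod (co (\<sigma> n) e))\<^sup>2) \<le> 1" for n
      using co[OF \<sigma>] \<open>finite F\<close> by (auto simp: l2_ball_def)
    ultimately show "(\<Sum>e\<in>F. (cmod (f e))\<^sup>2) \<le> 1" by (intro LIMSEQ_le_const2) auto
  qed
  note x = point_of(1)[OF fl] and cx = point_of(2)[OF fl]
  have "\<exists>N. \<forall>n\<ge>N. mdst l2_structure (\<sigma> n) (point_of f) < \<epsilon>" if "0 < \<epsilon>" for \<epsilon>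
  proof -
    have "0 < \<epsilon> / 2" using that by simp
    then obtain N where N: "\<And>n n'. N \<le> n \<Longrightarrow> N \<le> n' \<Longrightarrow> mdst l2_structure (\<sigma> n) (\<sigma> n') < \<epsilon> / 2"
      using cauchy by blast
    have "nrm [(1, \<sigma> n), (-1, point_of f)] \<le> \<epsilon> / 2" if n: "N \<le> n" for n
    proof (rule nrm_le)
      fix F :: "'a set" assume "finite F"
      have "(\<lambda>m. \<Sum>e\<in>F. (cmod (co (\<sigma> n) e - co (\<sigma> m) e))\<^sup>2) \<longlonglongrightarrow> (\<Sum>e\<in>F. (cmod (co (\<sigma> n) e - f e))\<^sup>2)"
        by (intro tendsto_sum tendsto_power tendsto_norm tendsto_diff f tendsto_const)
      moreover have "(\<Sum>e\<in>F. (cmod (co (\<sigma> n) e - co (\<sigma> m) e))\<^sup>2) \<le> (\<epsilon> / 2)\<^sup>2" if "N \<le> m" for m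
      proof -
        have "(\<Sum>e\<in>F. (cmod (co (\<sigma> n) e - co (\<sigma> m) e))\<^sup>2) \<le> (nrm [(1, \<sigma> n), (-1, \<sigma> m)])\<^sup>2"
          using sum_lin_le[of "[(1, \<sigma> n), (-1, \<sigma> m)]" F] \<sigma> \<open>finite F\<close> by simp
        also have "\<dots> \<le> (\<epsilon> / 2)\<^sup>2"
          using N[OF n that] nrm_nonneg by (intro power_mono) (auto simp: l2_structure_def)
        finally show ?thesis .
      qed
      ultimately have "(\<Sum>e\<in>F. (cmod (co (\<sigma> n) e - f e))\<^sup>2) \<le> (\<epsilon> / 2)\<^sup>2"
        by (intro LIMSEQ_le_const2) auto
      then show "(\<Sum>e\<in>F. (cmod (lin [(1, \<sigma> n), (-1, point_of f)] e))\<^sup>2) \<le> (\<epsilon> / 2)\<^sup>2"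
        by (simp add: cx)
    qed (use \<sigma> x that \<open>0 < \<epsilon>\<close> in auto)
    then show ?thesis using that by (intro exI[of _ N]) (fastforce simp: l2_structure_def)
  qed
  then show "\<exists>x. limitin mtopology \<sigma> x sequentially"
    unfolding limit_metric_sequentially using \<sigma> x by (intro exI[of _ "point_of f"]) auto
qed

sublocale hilbert_ball l2_structure ip
  by unfold_locales (rule mcomplete_l2)

definition unit :: "'a \<Rightarrow> 'm" where
  "unit s = point_of (\<lambda>e. if e = s then 1 else 0)"

lemma unit:
  assumes "s \<in> S" shows "unit s \<in> Pt" "co (unit s) = (\<lambda>e. if e = s then 1 else 0)"
proof -
  have "(\<Sum>e\<in>F. (cmod (if e = s then 1 else 0))\<^sup>2) \<le> 1" if "finite F" for F
  proof -
    have "(\<Sum>e\<in>F. (cmod (if e = s then 1 else 0))\<^sup>2) = (\<Sum>e\<in>F. if e = s then 1 else 0 :: real)"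
      by (rule sum.cong) auto
    then show ?thesis using that by simp
  qed
  then have "(\<lambda>e. if e = s then 1 else 0) \<in> l2_ball S" using assms by (auto simp: l2_ball_def)
  then show "unit s \<in> Pt" "co (unit s) = (\<lambda>e. if e = s then 1 else 0)"
    unfolding unit_def by (rule point_of)+
qed

lemma ip_unit: "s \<in> S \<Longrightarrow> ip (unit s) y = cnj (co y s)"
proof -
  assume "s \<in> S"
  have "((\<lambda>e. (if e = s then 1 else 0) * cnj (co y e)) has_sum cnj (co y s)) UNIV"
    by (rule has_sum_finite_neutralI[of "{s}"]) auto
  then show ?thesis unfolding ip_def unit(2)[OF \<open>s \<in> S\<close>] by (rule infsumI)
qed

lemma unit_eq_iff: "s \<in> S \<Longrightarrow> t \<in> S \<Longrightarrow> unit s = unit t \<longleftrightarrow> s = t"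
  by (metis unit(2) one_neq_zero)

lemma unit_basis: "orthonormal_basis (unit ` S)"
proof -
  have "orthonormal (unit ` S)"
    unfolding orthonormal_def using unit by (auto simp: ip_unit unit_eq_iff)
  moreover have "False" if x: "x \<in> Pt" "ip x x = 1" "\<And>e. e \<in> unit ` S \<Longrightarrow> ip x e = 0" for x
  proof -
    have "co x s = 0" for s
    proof (cases "s \<in> S")
      case True
      then have "ip x (unit s) = co x s" using ip_unit[OF True, of x] herm[of "unit s" x] unit(1) x(1) by simp
      then show ?thesis using x(3) True by simp
    qed (use co[OF x(1)] in \<open>auto simp: l2_ball_def\<close>)
    then show False using x(2) by (simp add: ip_def)
  qed
  ultimately show ?thesis by (auto simp: orthonormal_basis_def)
qed

lemma card_unit: "|unit ` S| =o |S|"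
proof -
  have "inj_on unit S" by (rule inj_onI) (simp add: unit_eq_iff)
  then have "bij_betw unit S (unit ` S)" by (simp add: bij_betw_def)
  then show ?thesis using card_of_ordIso ordIso_symmetric by blast
qed

lemma countable_support: "f \<in> l2_ball S \<Longrightarrow> countable {e. f e \<noteq> 0}"
  using summable_co[OF point_of(1), of f] point_of(2)[of f] summable_countable_real[of "\<lambda>e. (cmod (f e))\<^sup>2" UNIV] by simp

text \<open>Finitely many points have countable support together, so they all vanish at some
  coordinate in \<open>S\<close>, and its unit vector is orthogonal to them.\<close>

lemma inf_dim_l2:
  assumes "uncountable S" shows inf_dim
  unfolding inf_dim_def
proof (intro allI impI)
  fix F assume F: "finite F \<and> F \<subseteq> universe l2_structure"
  have "countable (\<Union>x\<in>F. {e. co x e \<noteq> 0})"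
    using F by (intro countable_UN countable_support co) (auto intro: countable_finite)
  then have "\<not> S \<subseteq> (\<Union>x\<in>F. {e. co x e \<noteq> 0})" using assms countable_subset by blast
  then obtain s where s: "s \<in> S" "\<And>x. x \<in> F \<Longrightarrow> co x s = 0" by blast
  then show "\<exists>e\<in>universe l2_structure. ip e e = 1 \<and> (\<forall>f\<in>F. ip e f = 0)"
    using unit[OF s(1)] by (intro bexI[of _ "unit s"]) (auto simp: ip_unit)
qed

end

text \<open>\<open>cut z\<close> interleaves the Dedekind cuts of the real and the imaginary part.\<close>

definition cut :: "complex \<Rightarrow> nat \<Rightarrow> bool" where
  "cut z j \<longleftrightarrow> (if even j then of_rat (from_nat (j div 2)) < Re z else of_rat (from_nat (j div 2)) < Im z)"

lemma cut_inj: assumes "cut z = cut w" shows "z = w"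
proof -
  have real: "x = y" if "\<And>q. of_rat q < x \<longleftrightarrow> of_rat q < y" for x y :: real
    using that of_rat_dense[of x y] of_rat_dense[of y x] by (metis linorder_cases order_less_asym)
  have "of_rat q < Re z \<longleftrightarrow> of_rat q < Re w" for q
    using fun_cong[OF assms, of "2 * to_nat q"] by (simp add: cut_def)
  moreover have "of_rat q < Im z \<longleftrightarrow> of_rat q < Im w" for q
    using fun_cong[OF assms, of "2 * to_nat q + 1"] by (simp add: cut_def)
  ultimately show ?thesis using real by (simp add: complex_eq_iff)
qed

text \<open>One sequence codes a family: it interleaves an enumeration of the support with the bit
  sequences \<open>cut\<close> of the values there, written with the letters \<open>k0\<close> and
  \<open>k1\<close>.\<close>

lemma ex_inj_countable_support:
  fixes X :: "('k \<Rightarrow> complex) set"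
  assumes k: "k0 \<noteq> (k1 :: 'k)" and X: "\<And>f. f \<in> X \<Longrightarrow> countable {e. f e \<noteq> 0}"
  shows "\<exists>J :: ('k \<Rightarrow> complex) \<Rightarrow> nat \<Rightarrow> 'k. inj_on J X"
proof -
  \<comment> \<open>Inserting \<open>k0\<close> keeps the enumerated set nonempty, so that it is the
    range of its enumeration even for the zero family.\<close>
  define p where "p f = from_nat_into (insert k0 {e. f e \<noteq> 0})" for f :: "'k \<Rightarrow> complex"
  have range: "range (p f) = insert k0 {e. f e \<noteq> 0}" if "f \<in> X" for f
    unfolding p_def using X[OF that] by (intro range_from_nat_into) auto
  define J where "J f m = (case prod_decode m of (n, 0) \<Rightarrow> p f n
      | (n, Suc j) \<Rightarrow> if cut (f (p f n)) j then k1 else k0)" for f m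
  have "inj_on J X"
  proof (rule inj_onI)
    fix f g assume fg: "f \<in> X" "g \<in> X" "J f = J g"
    have pe: "p f n = p g n" for n using fun_cong[OF fg(3), of "prod_encode (n, 0)"] by (simp add: J_def)
    have "cut (f (p f n)) j = cut (g (p g n)) j" for n j
      using fun_cong[OF fg(3), of "prod_encode (n, Suc j)"] k by (simp add: J_def split: if_splits)
    then have v: "f (p f n) = g (p f n)" for n using pe by (intro cut_inj) auto
    show "f = g"
    proof
      fix e
      show "f e = g e"
      proof (cases "e \<in> range (p f)")
        case False
        then have "e \<notin> range (p g)" using pe by auto
        then show ?thesis using False range fg by auto
      qed (use v in auto)
    qed
  qed
  then show ?thesis by blast
qed

lemma ex_hilbert_ball_of_density_character:
  fixes \<kappa> :: "'k rel"
  assumes "Card_order \<kappa>" "natLeq <o \<kappa>"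
  shows "\<exists>(M :: (ball_fun, ball_pred, nat \<Rightarrow> 'k) mstruct) G. hilbert_ball M G
    \<and> gram_ball.inf_dim M G \<and> has_density_character M \<kappa>"
proof -
  define S where "S = Field \<kappa>"
  have S: "|S| =o \<kappa>" using assms(1) by (simp add: S_def card_of_Field_ordIso)
  have unc: "uncountable S"
  proof
    assume "countable S"
    then have "|S| \<le>o natLeq"
      unfolding countable_iff_card_of_nat using card_of_nat by (rule ordLeq_ordIso_trans)
    then have "\<kappa> \<le>o natLeq" using S ordIso_symmetric ordIso_ordLeq_trans by blast
    then show False using assms(2) not_ordLess_ordLeq by blast
  qed
  then have inf: "infinite S" by (rule uncountable_infinite)
  then obtain k0 k1 where k: "k0 \<noteq> (k1 :: 'k)" by (metis finite_subset finite.emptyI finite.insertI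
        insertCI subsetI)
  \<comment> \<open>This copy, whose points are the families themselves, supplies countability of
    supports; the model itself lives on the image under \<open>J\<close>.\<close>
  interpret I: l2_coords S "l2_ball S" "\<lambda>f. f" by unfold_locales (simp add: bij_betw_def)
  obtain J :: "('k \<Rightarrow> complex) \<Rightarrow> nat \<Rightarrow> 'k" where J: "inj_on J (l2_ball S)"
    using ex_inj_countable_support[OF k I.countable_support] by blast
  interpret l2_coords S "J ` l2_ball S" "inv_into (l2_ball S) J"
    using J by unfold_locales (intro bij_betw_inv_into, simp add: bij_betw_def)
  have "|unit ` S| =o \<kappa>" using card_unit S by (rule ordIso_transitive)
  moreover have "infinite (unit ` S)"
    using inf card_unit card_of_ordIso_finite by blast
  ultimately have "has_density_character l2_structure \<kappa>"
    using density_character_of_basis[OF unit_basis] by blast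
  then show ?thesis using hilbert_ball_axioms inf_dim_l2[OF unc] hilbert_ball_def by blast
qed

section \<open>Indiscernible subspaces\<close>

text \<open>Each functional lowers the dimension by at most one, so the common kernel in
  \<open>W\<close> stays infinite-dimensional: if \<open>g w0\<close> is not 0, every vector of the
  previous kernel is a multiple of \<open>w0\<close> plus a vector killed by
  \<open>g\<close>.\<close>

lemma ex_in_common_kernel:
  fixes W :: "'a::real_vector set"
  assumes "finite Fs" "\<And>f. f \<in> Fs \<Longrightarrow> linear (f :: 'a \<Rightarrow> real)"
    and W: "subspace W" "\<not> (\<exists>B. finite B \<and> W \<subseteq> span B)"
  shows "\<exists>w\<in>W. w \<noteq> 0 \<and> (\<forall>f\<in>Fs. f w = 0)"
proof -
  have inf: "\<not> (\<exists>B. finite B \<and> {w \<in> W. \<forall>f\<in>Fs. f w = 0} \<subseteq> span B)"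
    using assms(1,2)
  proof (induction Fs rule: finite_induct)
    case empty
    then show ?case using W by simp
  next
    case (insert g Fs)
    let ?K = "{w \<in> W. \<forall>f\<in>Fs. f w = 0}"
    show ?case
    proof
      assume "\<exists>B. finite B \<and> {w \<in> W. \<forall>f\<in>insert g Fs. f w = 0} \<subseteq> span B"
      then obtain B where B: "finite B" "{w \<in> W. \<forall>f\<in>insert g Fs. f w = 0} \<subseteq> span B" by blast
      have lin: "linear f" if "f \<in> insert g Fs" for f using insert.prems that by blast
      have "\<not> ?K \<subseteq> span B" using insert.IH insert.prems B(1) by blast
      then obtain w0 where w0: "w0 \<in> ?K" "w0 \<notin> span B" by blast
      then have "g w0 \<noteq> 0" using B(2) by blast
      have "w \<in> span (insert w0 B)" if w: "w \<in> ?K" for w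
      proof -
        have "w - (g w / g w0) *\<^sub>R w0 \<in> W"
          using w w0 W(1) by (intro subspace_diff subspace_scale) auto
        moreover have "f (w - (g w / g w0) *\<^sub>R w0) = 0" if "f \<in> insert g Fs" for f
        proof -
          have "f (w - (g w / g w0) *\<^sub>R w0) = f w - (g w / g w0) * f w0"
            using lin[OF that] by (simp add: linear_diff linear_scale)
          then show ?thesis using w w0(1) \<open>g w0 \<noteq> 0\<close> that by auto
        qed
        ultimately have "w - (g w / g w0) *\<^sub>R w0 \<in> span B" using B(2) by blast
        then show ?thesis by (meson span_breakdown_eq)
      qed
      then show False using insert.IH insert.prems B(1) by blast
    qed
  qed
  show ?thesis
  proof (rule ccontr)
    assume "\<not> ?thesis"
    then have "{w \<in> W. \<forall>f\<in>Fs. f w = 0} \<subseteq> span {}" by auto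
    then show False using inf finite.emptyI by blast
  qed
qed

text \<open>Here the structure sits in an actual space, but \<open>G\<close> is controlled only on
  the unit ball; the lemmas link it to the operations of the space.\<close>

locale banach_gram =
  gram_ball "unit_ball TYPE('a)" G for G :: "'a::complex_banach \<Rightarrow> 'a \<Rightarrow> complex"
begin

lemma mem_U [simp]: "x \<in> U \<longleftrightarrow> norm x \<le> 1"
  by (simp add: unit_ball_def)

lemma norm_lincomb:
  assumes "length a = length xs" "set xs \<subseteq> U" shows "norm (lincomb a xs) = vnorm (zip a xs)"
  using pint_vnorm[OF assms] by (simp add: unit_ball_def)

lemma G_self: "x \<in> U \<Longrightarrow> G x x = of_real ((norm x)\<^sup>2)"
  using norm_lincomb[of "[1]" "[x]"] gform_self[of "[(1, x)]"] by (simp add: lincomb_def)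

lemma G_scaleC:
  assumes "x \<in> U" "y \<in> U" "cmod c \<le> 1" shows "G (c *\<^sub>C x) y = c * G x y"
proof -
  have "norm (c *\<^sub>C x) \<le> 1" using assms by (simp add: norm_scaleC mult_le_one)
  then have "fint (unit_ball TYPE('a)) (Sigma [c]) [x] = c *\<^sub>C x"
    and "vnorm [(c, x)] \<le> 1"
    using norm_lincomb[of "[c]" "[x]"] assms(1) by (simp_all add: unit_ball_def lincomb_def ball_retract_def)
  then show ?thesis using G_sigma_ball[of "[c]" "[x]" y] assms by simp
qed

text \<open>The real part of the inner product with \<open>a\<close>, by polarization. The norm is
  defined everywhere, so this extends \<open>Re (G v a)\<close> beyond the ball.\<close>

definition functional :: "'a \<Rightarrow> 'a \<Rightarrow> real" where
  "functional a v = ((norm (v + a))\<^sup>2 - (norm (v - a))\<^sup>2) / 4"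

lemma functional_eq:
  assumes "x \<in> U" "y \<in> U" "a \<in> U"
  shows "functional a (r *\<^sub>R x + t *\<^sub>R y) = r * Re (G x a) + t * Re (G y a)"
proof -
  define v :: "(complex \<times> 'a) list" where "v = [(of_real r, x), (of_real t, y)]"
  have v: "v \<in> vecs" "[(1, a)] \<in> vecs" using assms by (auto simp: v_def)
  have "r *\<^sub>R x + t *\<^sub>R y + s *\<^sub>R a = lincomb [of_real r, of_real t, of_real s] [x, y, a]" for s
    by (simp add: lincomb_def scaleC_of_real add.assoc)
  then have "norm (r *\<^sub>R x + t *\<^sub>R y + s *\<^sub>R a) = vnorm (v @ vscale (of_real s) [(1, a)])" for s
    using norm_lincomb[of "[of_real r, of_real t, of_real s]" "[x, y, a]"] assms
    by (simp add: v_def vscale_def)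
  then have *: "(norm (r *\<^sub>R x + t *\<^sub>R y + s *\<^sub>R a))\<^sup>2 = Re (B v v) + 2 * s * Re (B v [(1, a)]) + s * s * Re (G a a)" for s
    using v gform_herm[of v "[(1, a)]"] by (simp add: vnorm_sq distrib_left)
  have "functional a (r *\<^sub>R x + t *\<^sub>R y) = Re (B v [(1, a)])"
    using *[of 1] *[of "-1"] by (simp add: functional_def)
  also have "\<dots> = r * Re (G x a) + t * Re (G y a)"
    by (subst gform_left_sum) (simp add: v_def)
  finally show ?thesis .
qed

lemma linear_functional:
  assumes "a \<in> U" shows "linear (functional a)"
proof
  fix v w :: 'a and c :: real
  \<comment> \<open>Dividing by \<open>m\<close> moves both vectors into the ball, where
    \<open>functional_eq\<close> applies.\<close>
  define m where "m = norm v + norm w + 1"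
  have m: "0 < m" "norm v \<le> m" "norm w \<le> m" by (auto simp: m_def add_nonneg_pos)
  define x y where "x = v /\<^sub>R m" and "y = w /\<^sub>R m"
  have xy: "x \<in> U" "y \<in> U" "v = m *\<^sub>R x" "w = m *\<^sub>R y" using m by (simp_all add: x_def y_def divide_simps)
  have 0: "(0 :: 'a) \<in> U" by simp
  have "functional a v = m * Re (G x a)" "functional a w = m * Re (G y a)" "functional a (c *\<^sub>R v) = (c * m) * Re (G x a)"
    using functional_eq[OF xy(1) 0 assms, of _ 0] functional_eq[OF xy(2) 0 assms, of _ 0] xy by simp_all
  then show "functional a (v + w) = functional a v + functional a w" "functional a (c *\<^sub>R v) = c *\<^sub>R functional a v"
    using functional_eq[OF xy(1,2) assms, of m m] xy by simp_all
qed

text \<open>\<open>W\<close> is only a real subspace, so orthogonality to \<open>a\<close> is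
  imposed by two real functionals, for \<open>a\<close> and for \<open>\<i> *\<^sub>C a\<close>; the
  latter controls the imaginary part, as
  \<open>Re (G x (\<i> *\<^sub>C a)) = Im (G x a)\<close>.\<close>

lemma ex_orthogonal_unit:
  assumes W: "subspace W" "\<not> (\<exists>B. finite B \<and> W \<subseteq> span B)" and A: "finite A" "A \<subseteq> U"
  shows "\<exists>w\<in>W. norm w = 1 \<and> (\<forall>a\<in>A. G w a = 0)"
proof -
  have iU: "\<i> *\<^sub>C a \<in> U" if "a \<in> A" for a
    using A that by (auto simp: norm_scaleC)
  let ?Fs = "functional ` (A \<union> (*\<^sub>C) \<i> ` A)"
  have "linear f" if "f \<in> ?Fs" for f
    using that A iU linear_functional by auto
  then obtain w where w: "w \<in> W" "w \<noteq> 0" "\<forall>f\<in>?Fs. f w = 0"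
    using ex_in_common_kernel[OF _ _ W, of ?Fs] A(1) by auto
  define x where "x = w /\<^sub>R norm w"
  have x: "norm x = 1" "x \<in> U" "w = norm w *\<^sub>R x" using w(2) by (simp_all add: x_def)
  have 0: "(0 :: 'a) \<in> U" by simp
  have Re0: "Re (G x b) = 0" if "b \<in> A \<union> (*\<^sub>C) \<i> ` A" for b
  proof -
    have "b \<in> U" using that A(2) iU by auto
    then have "functional b w = norm w * Re (G x b)"
      using functional_eq[OF x(2) 0, of b "norm w" 0] x(3) by simp
    then show ?thesis using w that by auto
  qed
  have "G x a = 0" if a: "a \<in> A" for a
  proof -
    have aU: "a \<in> U" using a A(2) by auto
    have "G x (\<i> *\<^sub>C a) = cnj (\<i> * G a x)"
      using herm[OF iU[OF a] x(2)] G_scaleC[OF aU x(2), of \<i>] by simp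
    also have "\<dots> = - \<i> * G x a" using herm[OF aU x(2)] by simp
    finally show ?thesis using Re0[of a] Re0[of "\<i> *\<^sub>C a"] a by (simp add: complex_eq_iff)
  qed
  moreover have "x \<in> W" unfolding x_def using w(1) W(1) by (simp add: subspace_scale)
  ultimately show ?thesis using x(1) by blast
qed

lemma inf_dim_unit_ball:
  assumes "\<not> (\<exists>B :: 'a set. finite B \<and> UNIV \<subseteq> span B)" shows inf_dim
  unfolding inf_dim_def
proof (intro allI impI)
  fix F assume "finite F \<and> F \<subseteq> U"
  then obtain w where "norm w = 1" "\<forall>a\<in>F. G w a = 0"
    using ex_orthogonal_unit[of UNIV F] assms subspace_UNIV by blast
  then show "\<exists>e\<in>U. G e e = 1 \<and> (\<forall>f\<in>F. G e f = 0)"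
    using G_self[of w] by (intro bexI[of _ w]) auto
qed

end

lemma real_span_of_infinite_dimensional_space:
  assumes "infinite_dimensional_space TYPE('a::complex_banach)"
  shows "\<not> (\<exists>B :: 'a set. finite B \<and> UNIV \<subseteq> span B)"
proof
  interpret C: module "scaleC :: complex \<Rightarrow> 'a \<Rightarrow> 'a"
    by unfold_locales (simp_all add: scaleC_add_right scaleC_add_left scaleC_scaleC)
  assume "\<exists>B :: 'a set. finite B \<and> UNIV \<subseteq> span B"
  then obtain B :: "'a set" where B: "finite B" "UNIV \<subseteq> span B" by blast
  have "subspace (C.span B)"
    unfolding subspace_def
    by (auto simp: C.span_zero C.span_add scaleC_of_real[symmetric] intro: C.span_scale)
  then have "span B \<subseteq> C.span B" by (intro span_minimal) (auto intro: C.span_base)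
  then show False using assms B unfolding infinite_dimensional_space_def by blast
qed

lemma inf_dim_hilbert:
  assumes "infinite_dimensional_space TYPE('h::complex_hilbert)"
  shows "gram_ball.inf_dim (unit_ball TYPE('h)) cinner"
proof -
  interpret banach_gram "cinner :: 'h \<Rightarrow> 'h \<Rightarrow> complex"
    unfolding banach_gram_def by (rule gram_ball_unit_ball)
  show ?thesis
    using real_span_of_infinite_dimensional_space[OF assms] by (rule inf_dim_unit_ball)
qed

section \<open>Categoricity in uncountable density characters\<close>

theorem inseparably_categorical_hilbert:
  assumes "infinite_dimensional_space TYPE('h::complex_hilbert)"
  shows "inseparably_categorical TYPE('k) TYPE('m) TYPE('n) banach_signature
    (theory_of banach_signature (unit_ball TYPE('h)))" (is "inseparably_categorical _ _ _ ?L ?T")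
  unfolding inseparably_categorical_def
proof (intro allI impI conjI)
  fix \<kappa> :: "'k rel"
  assume "Card_order \<kappa> \<and> natLeq <o \<kappa>"
  then have \<kappa>: "Card_order \<kappa>" "natLeq <o \<kappa>" by auto
  obtain M :: "(ball_fun, ball_pred, nat \<Rightarrow> 'k) mstruct" and G where
    "hilbert_ball M G" "gram_ball.inf_dim M G" "has_density_character M \<kappa>"
    using ex_hilbert_ball_of_density_character[OF \<kappa>] by blast
  then show "\<exists>M :: (ball_fun, ball_pred, nat \<Rightarrow> 'k) mstruct. model_of ?L ?T M \<and> has_density_character M \<kappa>"
    using model_of_theory_of[OF _ _ gram_ball_unit_ball inf_dim_hilbert[OF assms]] by blast
  fix M :: "(ball_fun, ball_pred, 'm) mstruct" and N :: "(ball_fun, ball_pred, 'n) mstruct"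
  assume *: "model_of ?L ?T M \<and> has_density_character M \<kappa> \<and> model_of ?L ?T N \<and> has_density_character N \<kappa>"
  interpret M: hilbert_ball M "polar M" using hilbert_ball_polar[OF gram_ball_unit_ball] * by blast
  interpret N: hilbert_ball N "polar N" using hilbert_ball_polar[OF gram_ball_unit_ball] * by blast
  obtain E E' where E: "M.orthonormal_basis E" "N.orthonormal_basis E'"
    using M.ex_orthonormal_basis N.ex_orthonormal_basis by blast
  have "|E| =o \<kappa>" "|E'| =o \<kappa>"
    using M.basis_of_density_character[OF E(1) _ \<kappa>(2)] N.basis_of_density_character[OF E(2) _ \<kappa>(2)] * by auto
  then have "|E| =o |E'|" using ordIso_symmetric ordIso_transitive by blast
  then obtain b where "bij_betw b E E'" unfolding card_of_ordIso[symmetric] by blast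
  then show "\<exists>h. isomorphism ?L M N h"
    using isomorphism_of_bases[OF M.hilbert_ball_axioms N.hilbert_ball_axioms E] by blast
qed

section \<open>Solution sets of partial types and the phase of a vector\<close>

lemma not_indiscernible_of_imaginary_multiple:
  fixes V :: "'c::complex_banach set"
  assumes b: "b \<in> V" "\<i> *\<^sub>C b \<in> V" "norm b = 1"
  shows "\<not> indiscernible_subspace V"
proof
  assume V: "indiscernible_subspace V"
  define c where "c = \<i> *\<^sub>C b"
  have nc: "norm c = 1" using b by (simp add: c_def norm_scaleC)
  have ic: "\<i> *\<^sub>C c = - b" by (simp add: c_def scaleC_scaleC)
  have nt: "[b, c] \<in> tuples V 2" "[c, b] \<in> tuples V 2" using b by (auto simp: tuples_def c_def)
  have "congruent_tuples [b, c] [c, b]"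
    unfolding congruent_tuples_def
  proof (intro conjI allI impI)
    fix i j assume "i \<le> length [b, c]" "j \<le> length [b, c]"
    then have "i \<in> {0, 1, 2}" "j \<in> {0, 1, 2}" by auto
    then show "norm (([b, c] @ [0]) ! i - ([b, c] @ [0]) ! j) = norm (([c, b] @ [0]) ! i - ([c, b] @ [0]) ! j)"
      using b nc by (auto simp: norm_minus_commute)
  qed simp
  then have st: "same_type banach_signature (unit_ball TYPE('c)) [b, c] [c, b]"
    using V nt unfolding indiscernible_subspace_def by blast
  let ?\<phi> = "Pred (NormComb [1, \<i>]) [Var 0, Var 1] :: ball_fm"
  have "eval (unit_ball TYPE('c)) ?\<phi> ((!) [b, c]) = eval (unit_ball TYPE('c)) ?\<phi> ((!) [c, b])"
    using st unfolding same_type_def by (elim conjE allE[of _ ?\<phi>]) auto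
  \<comment> \<open>As \<open>\<i> *\<^sub>C c = - b\<close>, the left side is 0, whereas the right
    side is the norm of \<open>c + c\<close>, that is 2.\<close>
  then have "norm (b + \<i> *\<^sub>C c) = norm (c + \<i> *\<^sub>C b)"
    by (simp add: unit_ball_def lincomb_def)
  then have "norm (c + c) = 0" unfolding ic by (simp add: c_def)
  then show False using nc by (simp add: scaleR_2[symmetric])
qed

theorem solution_set_not_indiscernible:
  fixes A :: "'c::complex_banach set" and \<kappa> :: "'j rel"
  assumes monster: "monster_model banach_signature
      (theory_of banach_signature (unit_ball TYPE('h::complex_hilbert))) \<kappa> (unit_ball TYPE('c))"
    and A: "A \<subseteq> universe (unit_ball TYPE('c))" "|A| <o \<kappa>"
    and \<Sigma>: "partial_type banach_signature (unit_ball TYPE('c)) A 1 \<Sigma>"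
    and V: "infinite_dimensional_subset (solution_set (unit_ball TYPE('c)) \<Sigma>)"
  shows "\<not> indiscernible_subspace (solution_set (unit_ball TYPE('c)) \<Sigma>)"
proof
  let ?M = "unit_ball TYPE('c)" and ?L = banach_signature
  let ?V = "solution_set ?M \<Sigma>"
  define G where "G = polar ?M"
  assume ind: "indiscernible_subspace ?V"
  have model: "model_of ?L (theory_of ?L (unit_ball TYPE('h))) ?M" and sat: "saturated ?L \<kappa> ?M"
    using monster by (auto simp: monster_model_def)
  interpret hilbert_ball ?M G
    unfolding G_def by (rule hilbert_ball_polar[OF gram_ball_unit_ball model])
  interpret banach_gram G by unfold_locales
  obtain W where W: "subspace W" "?V = cball 0 1 \<inter> W"
    using ind unfolding indiscernible_subspace_def real_subspace_def by blast
  have W_inf: "\<not> (\<exists>B. finite B \<and> W \<subseteq> span B)"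
    using V W(2) unfolding infinite_dimensional_subset_def by blast
  \<comment> \<open>Infinite dimension of the monster model is inherited from the subspace.\<close>
  then have inf_dim by (intro inf_dim_unit_ball) blast
  define upd where "upd x s = (\<lambda>i. if i < Suc 0 then [x] ! i else s i)" for x :: 'c and s
  have sat_iff: "satisfies_upto ?M \<epsilon> X [x] \<longleftrightarrow> (\<forall>p\<in>X. \<bar>eval ?M (fst p) (upd x (snd p))\<bar> \<le> \<epsilon>)" for \<epsilon> X x
    by (simp add: satisfies_upto_def upd_def split_def)
  have sol: "x \<in> ?V \<longleftrightarrow> norm x \<le> 1 \<and> (\<forall>(\<phi>, s)\<in>\<Sigma>. eval ?M \<phi> (upd x s) = 0)" for x
    by (simp add: solution_set_def realizations_def satisfies_upto_def tuples_def upd_def)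
  define unit_norm :: "ball_fm \<times> (nat \<Rightarrow> 'c)" where
    "unit_norm = (fsub (Pred (NormComb [1]) [Var 0]) (fconst 1), \<lambda>_. 0)"
  \<comment> \<open>Variable 0 is the unknown and variable 1 names the parameter
    \<open>a\<close>.\<close>
  define orth_re orth_im :: "'c \<Rightarrow> ball_fm \<times> (nat \<Rightarrow> 'c)"
    where "orth_re a = (fdiffsq 1 (Var 0) (Var 1), \<lambda>_. a)"
      and "orth_im a = (fdiffsq \<i> (Var 0) (Var 1), \<lambda>_. a)" for a
  define \<Sigma>' where "\<Sigma>' = \<Sigma> \<union> {unit_norm} \<union> orth_re ` A \<union> orth_im ` A"
  have upd_simps: "upd x s 0 = x" "upd x s (Suc i) = s (Suc i)" for x s i by (simp_all add: upd_def)
  have ev: "eval ?M (fst unit_norm) (upd x (snd unit_norm)) = norm x - 1"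
      "eval ?M (fst (orth_re a)) (upd x (snd (orth_re a))) = Re (G x a)"
      "eval ?M (fst (orth_im a)) (upd x (snd (orth_im a))) = Im (G x a)" for x a
    by (simp_all add: unit_norm_def orth_re_def orth_im_def upd_simps G_def unit_ball_def lincomb_def)
  have "partial_type ?L ?M A 1 \<Sigma>'"
    unfolding partial_type_def
  proof (intro conjI allI impI)
    have "\<forall>(\<phi>, s)\<in>\<Sigma>. wf_fm ?L \<phi> \<and> (\<forall>i\<in>fv \<phi>. 1 \<le> i \<longrightarrow> s i \<in> A)"
      using \<Sigma> by (simp add: partial_type_def)
    then show "\<forall>(\<phi>, s)\<in>\<Sigma>'. wf_fm ?L \<phi> \<and> (\<forall>i\<in>fv \<phi>. 1 \<le> i \<longrightarrow> s i \<in> A)"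
      by (auto simp: \<Sigma>'_def unit_norm_def orth_re_def orth_im_def intro!: continuous_intros)
  next
    fix \<Sigma>0 and \<epsilon> :: real assume *: "finite \<Sigma>0 \<and> \<Sigma>0 \<subseteq> \<Sigma>' \<and> 0 < \<epsilon>"
    \<comment> \<open>An orthogonality condition keeps its parameter in variable 1. Other conditions
      may contribute further elements of \<open>A\<close>, which does no harm.\<close>
    define A0 where "A0 = A \<inter> (\<lambda>p. snd p 1) ` \<Sigma>0"
    have "finite A0" "A0 \<subseteq> U" using * A(1) by (auto simp: A0_def)
    then obtain w where w: "w \<in> W" "norm w = 1" "\<forall>a\<in>A0. G w a = 0"
      using ex_orthogonal_unit[OF W(1) W_inf] by blast
    \<comment> \<open>Lying in \<open>?V\<close>, the vector \<open>w\<close> satisfies all of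
      \<Sigma> exactly, so \<epsilon> never has to be spent.\<close>
    have wV: "w \<in> ?V" using w W(2) by simp
    have "eval ?M (fst p) (upd w (snd p)) = 0" if p: "p \<in> \<Sigma>0" for p
    proof -
      have "p \<in> \<Sigma>'" using * p by auto
      then consider "p \<in> \<Sigma>" | "p = unit_norm" | a where "a \<in> A" "p = orth_re a \<or> p = orth_im a"
        unfolding \<Sigma>'_def by auto
      then show ?thesis
      proof cases
        case 1
        then show ?thesis using wV by (auto simp: sol)
      next
        case 2
        then show ?thesis using w by (simp add: ev)
      next
        case 3
        then have "snd p 1 = a" by (auto simp: orth_re_def orth_im_def)
        then have "a \<in> A0" using 3(1) p by (auto simp: A0_def)
        then show ?thesis using 3(2) w(3) by (auto simp: ev)
      qed
    qed
    then have "satisfies_upto ?M \<epsilon> \<Sigma>0 [w]"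
      using * by (auto simp: sat_iff)
    moreover have "[w] \<in> tuples (universe ?M) 1" using w by (simp add: tuples_def)
    ultimately show "\<exists>xs\<in>tuples (universe ?M) 1. satisfies_upto ?M \<epsilon> \<Sigma>0 xs" by blast
  qed
  then have "realizations ?M 1 \<Sigma>' \<noteq> {}"
    using sat A unfolding saturated_def by blast
  then obtain xs where xs: "xs \<in> realizations ?M 1 \<Sigma>'" by blast
  then obtain b where "xs = [b]"
    by (auto simp: realizations_def tuples_def length_Suc_conv)
  then have b: "norm b \<le> 1" "\<And>p. p \<in> \<Sigma>' \<Longrightarrow> eval ?M (fst p) (upd b (snd p)) = 0"
    using xs by (auto simp: realizations_def tuples_def satisfies_upto_def upd_def)
  have nb: "norm b = 1" using b(2)[of unit_norm] by (simp add: \<Sigma>'_def ev)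
  have orth: "G b a = 0" if "a \<in> A" for a
    using b(2)[of "orth_re a"] b(2)[of "orth_im a"] that by (simp add: \<Sigma>'_def ev complex_eq_iff)
  have bV: "b \<in> ?V" using b by (auto simp: sol \<Sigma>'_def)
  define c where "c = \<i> *\<^sub>C b"
  have nc: "norm c = 1" by (simp add: c_def norm_scaleC nb)
  have AU: "norm a \<le> 1" if "a \<in> A" for a using A(1) that by auto
  have orth_c: "G c a = 0" if "a \<in> A" for a
    using G_scaleC[of b a \<i>] orth[OF that] AU[OF that] nb by (simp add: c_def)
  have orth': "G a b = 0" "G a c = 0" if "a \<in> A" for a
    using herm[of b a] herm[of c a] orth[OF that] orth_c[OF that] AU[OF that] nb nc by simp_all
  \<comment> \<open>The vectors \<open>b\<close> and \<open>c\<close> have the same Gram data with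
    the parameters: length 1 and all pairings 0. So \<Sigma> cannot see the factor \<i>.\<close>
  have "eval ?M \<phi> (upd c s) = 0" if p: "(\<phi>, s) \<in> \<Sigma>" for \<phi> s
  proof -
    have wf: "wf_fm ?L \<phi>" and par: "\<And>i. i \<in> fv \<phi> \<Longrightarrow> 1 \<le> i \<Longrightarrow> s i \<in> A"
      using \<Sigma> p unfolding partial_type_def by auto
    have upd: "upd x s i = (if i = 0 then x else s i)" for x i by (simp add: upd_def)
    have "gram_pair ?M G ?M G (fv \<phi>) (upd c s) (upd b s)"
    proof unfold_locales
      show "upd c s ` fv \<phi> \<subseteq> U" "upd b s ` fv \<phi> \<subseteq> U"
        using par AU nb nc by (auto simp: upd)
      show "G (upd c s i) (upd c s j) = G (upd b s i) (upd b s j)" if "i \<in> fv \<phi>" "j \<in> fv \<phi>" for i j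
        using par[of i] par[of j] that G_self[of b] G_self[of c] nb nc
        by (auto simp: upd orth orth_c orth')
    qed
    then have "eval ?M \<phi> (upd c s) = eval ?M \<phi> (upd b s)"
      using \<open>inf_dim\<close> \<open>inf_dim\<close> wf by (rule eval_eq_of_same_gram)
    then show ?thesis using bV p by (auto simp: sol)
  qed
  then have "c \<in> ?V" using nc by (auto simp: sol)
  then show False using not_indiscernible_of_imaginary_multiple[OF bV _ nb] ind by (simp add: c_def)
qed

theorem mainTheorem5:
  fixes T :: "(ball_fun, ball_pred) fm set"
  assumes "infinite_dimensional_space TYPE('h::complex_hilbert)"
    and "T = theory_of banach_signature (unit_ball TYPE('h))"
  shows "inseparably_categorical TYPE('k) TYPE('m) TYPE('n) banach_signature T \<and>
    (\<forall>(\<kappa> :: 'j rel) (A :: 'c::complex_banach set) \<Sigma>.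
      monster_model banach_signature T \<kappa> (unit_ball TYPE('c)) \<and>
      A \<subseteq> universe (unit_ball TYPE('c)) \<and> |A| <o \<kappa> \<and>
      partial_type banach_signature (unit_ball TYPE('c)) A 1 \<Sigma> \<longrightarrow>
      \<not> (indiscernible_subspace (solution_set (unit_ball TYPE('c)) \<Sigma>) \<and>
         infinite_dimensional_subset (solution_set (unit_ball TYPE('c)) \<Sigma>)))"
  unfolding assms(2)
  using inseparably_categorical_hilbert[OF assms(1)] solution_set_not_indiscernible by blast

end
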